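(* Let $\nu_k\to0^+$, $c_k\in J_{\nu_k}$, $c_k\to c=(c_1,c_2,c_3)\neq0$ and $c_3=c_3^*(c_1,c_2)$. (i) If $c_k\in J_0$, then $\lim_{k\to\infty}\|U^\pm_{\nu_k,\theta}(c_k)\mp\sqrt{2P_c}\|_{L^\infty(-1,1)}=0$, and for any $0<\beta<2/3$ and any $\epsilon>0$ there exists a constant $C$, depending only on $c,\epsilon$ and $\beta$, such that for large $k$, $$\left\|\tfrac12(U^\pm_{\nu_k,\theta}(c_k))^2-P_{c_k}\right\|_{L^\infty(-1,1)}+\nu_k^\beta\left\|\tfrac12(U^\pm_{\nu_k,\theta}(c_k))^2-P_{c_k}\right\|_{C^\beta(-1+\epsilon,1-\epsilon)}\le C\nu_k^{2/3}.$$ Moreover, $\bar x:=\frac{\sqrt{c_1}-\sqrt{c_2}}{\sqrt{c_1}+\sqrt{c_2}}\in[-1,1]$, and for any $\epsilon>0$ and integer $m\ge0$ there exists a constant $C$, depending only on $c,m$ and $\epsilon$, such that for large $k$, $$\|U^+_{\nu_k,\theta}(c_k)-\sqrt{2P_{c_k}}\|_{C^m([-1,1-\epsilon]\setminus[\bar x-\epsilon,\bar x+\epsilon])}+\|U^-_{\nu_k,\theta}(c_k)+\sqrt{2P_{c_k}}\|_{C^m([-1+\epsilon,1]\setminus[\bar x-\epsilon,\bar x+\epsilon])}\le C\nu_k.$$ (ii) If $c_2=0$, then $\lim_{k\to\infty}\|U^+_{\nu_k,\theta}(c_k)-\sqrt{2P_c}\|_{L^\infty(-1,1)}=0$, and there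 exists a constant $C$, depending only on $c$, such that for large $k$, $$\left\|\tfrac12(U^+_{\nu_k,\theta}(c_k))^2-P_{c_k}\right\|_{L^\infty(-1,1)}\le C\left(|c_{k2}|+|2c_{k3}+c_{k1}|^2+\nu_k^{2/3}\right)=o(1).$$ (iii) If $c_1=0$, then $\lim_{k\to\infty}\|U^-_{\nu_k,\theta}(c_k)+\sqrt{2P_c}\|_{L^\infty(-1,1)}=0$, and there exists a constant $C$, depending only on $c$, such that for large $k$, $$\left\|\tfrac12(U^-_{\nu_k,\theta}(c_k))^2-P_{c_k}\right\|_{L^\infty(-1,1)}\le C\left(|c_{k1}|+|2c_{k3}+c_{k2}|^2+\nu_k^{2/3}\right)=o(1).$$
   Context: For $c=(c_1,c_2,c_3)\in\mathbb{R}^3$ let $P_c(x)=c_1(1-x)+c_2(1+x)+c_3(1-x^2)$; the components of $c_k$ are written $c_k=(c_{k1},c_{k2},c_{k3})$. For $\nu\ge0$ let $$\bar c_3(c_1,c_2;\nu)=-\tfrac12\left(\sqrt{\nu^2+c_1}+\sqrt{\nu^2+c_2}\right)\left(\sqrt{\nu^2+c_1}+\sqrt{\nu^2+c_2}+2\nu\right),$$ $$J_\nu=\{c\in\mathbb{R}^3: c_1\ge-\nu^2,\ c_2\ge-\nu^2,\ c_3\ge\bar c_3(c_1,c_2;\nu)\}.$$ For $c_1,c_2\ge0$, $c_3^*(c_1,c_2)=\bar c_3(c_1,c_2;0)=-\frac12(c_1+2\sqrt{c_1c_2}+c_2)$. For $\nu>0$ and $c\in J_\nu$, consider the differential equation $$\nu(1-x^2)U'+2\nu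 xU+\tfrac12U^2=P_c(x),\qquad -1<x<1.$$ It is known that among its $C^1(-1,1)$ solutions there are a greatest one $U^+_{\nu,\theta}(c)$ (upper solution) and a least one $U^-_{\nu,\theta}(c)$ (lower solution), i.e. $U^-_{\nu,\theta}(c)\le U\le U^+_{\nu,\theta}(c)$ on $(-1,1)$ for every solution $U$; solutions extend continuously to $[-1,1]$. $C^\beta$ denotes the Hölder space. *)

theory Defs
  imports "HOL-Analysis.Analysis" "HOL-Probability.Essential_Supremum" "HOL-Library.Landau_Symbols"
begin

section \<open>Norms\<close>

text \<open>All norms take values in \<^typ>\<open>ennreal\<close>, so that a finite bound also asserts membership in
  the corresponding space. Norms over the empty set are 0.\<close>

definition Linf_norm :: "real set \<Rightarrow> (real \<Rightarrow> real) \<Rightarrow> ennreal" where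
  "Linf_norm S f = esssup (lebesgue_on S) (\<lambda>x. ennreal \<bar>f x\<bar>)"

definition sup_norm :: "real set \<Rightarrow> (real \<Rightarrow> real) \<Rightarrow> ennreal" where
  "sup_norm S f = (SUP x\<in>S. ennreal \<bar>f x\<bar>)"

text \<open>The norm of the Hoelder space of exponent \<open>\<beta>\<close>, for \<open>0 < \<beta> < 1\<close>.\<close>

definition holder_norm :: "real \<Rightarrow> real set \<Rightarrow> (real \<Rightarrow> real) \<Rightarrow> ennreal" where
  "holder_norm \<beta> S f = sup_norm S f +
     (SUP (x, y)\<in>{(x, y). x \<in> S \<and> y \<in> S \<and> x \<noteq> y}. ennreal (\<bar>f x - f y\<bar> / \<bar>x - y\<bar> powr \<beta>))"

text \<open>Derivatives are taken within \<open>S\<close>, hence one-sided at an endpoint belonging to \<open>S\<close>; this is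
  meaningful for sets without isolated points, such as finite unions of nondegenerate intervals.\<close>

definition deriv_within :: "real set \<Rightarrow> nat \<Rightarrow> (real \<Rightarrow> real) \<Rightarrow> real \<Rightarrow> real" where
  "deriv_within S i f = ((\<lambda>g x. vector_derivative g (at x within S)) ^^ i) f"

definition Cm_on :: "nat \<Rightarrow> real set \<Rightarrow> (real \<Rightarrow> real) \<Rightarrow> bool" where
  "Cm_on m S f \<longleftrightarrow>
     (\<forall>i<m. deriv_within S i f differentiable_on S) \<and> continuous_on S (deriv_within S m f)"

definition Cm_norm :: "nat \<Rightarrow> real set \<Rightarrow> (real \<Rightarrow> real) \<Rightarrow> ennreal" where
  "Cm_norm m S f = (if Cm_on m S f then \<Sum>i\<le>m. sup_norm S (deriv_within S i f) else \<infinity>)"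

section \<open>The differential equation\<close>

definition P :: "real^3 \<Rightarrow> real \<Rightarrow> real" where
  "P c x = c$1 * (1 - x) + c$2 * (1 + x) + c$3 * (1 - x\<^sup>2)"

definition c3_bar :: "real \<Rightarrow> real \<Rightarrow> real \<Rightarrow> real" where
  "c3_bar c1 c2 \<nu> = - (1/2) * (sqrt (\<nu>\<^sup>2 + c1) + sqrt (\<nu>\<^sup>2 + c2))
                            * (sqrt (\<nu>\<^sup>2 + c1) + sqrt (\<nu>\<^sup>2 + c2) + 2 * \<nu>)"

definition c3_star :: "real \<Rightarrow> real \<Rightarrow> real" where
  "c3_star c1 c2 = c3_bar c1 c2 0"

definition J :: "real \<Rightarrow> (real^3) set" where
  "J \<nu> = {c. c$1 \<ge> - \<nu>\<^sup>2 \<and> c$2 \<ge> - \<nu>\<^sup>2 \<and> c$3 \<ge> c3_bar (c$1) (c$2) \<nu>}"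

definition ode_solution :: "real \<Rightarrow> real^3 \<Rightarrow> (real \<Rightarrow> real) \<Rightarrow> bool" where
  "ode_solution \<nu> c U \<longleftrightarrow> U C1_differentiable_on {-1<..<1} \<and>
     (\<forall>x\<in>{-1<..<1}. \<nu> * (1 - x\<^sup>2) * deriv U x + 2 * \<nu> * x * U x + (1/2) * (U x)\<^sup>2 = P c x)"

text \<open>Continuity on \<open>[-1,1]\<close> only fixes the values at the two endpoints, to which every solution
  extends continuously. The competitors \<open>V\<close> are arbitrary solutions on the open interval.\<close>

definition upper_solution :: "real \<Rightarrow> real^3 \<Rightarrow> (real \<Rightarrow> real) \<Rightarrow> bool" where
  "upper_solution \<nu> c U \<longleftrightarrow> ode_solution \<nu> c U \<and> continuous_on {-1..1} U \<and>
     (\<forall>V. ode_solution \<nu> c V \<longrightarrow> (\<forall>x\<in>{-1<..<1}. V x \<le> U x))"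

definition lower_solution :: "real \<Rightarrow> real^3 \<Rightarrow> (real \<Rightarrow> real) \<Rightarrow> bool" where
  "lower_solution \<nu> c U \<longleftrightarrow> ode_solution \<nu> c U \<and> continuous_on {-1..1} U \<and>
     (\<forall>V. ode_solution \<nu> c V \<longrightarrow> (\<forall>x\<in>{-1<..<1}. U x \<le> V x))"

definition vanishing_viscosity :: "real^3 \<Rightarrow> (nat \<Rightarrow> real) \<Rightarrow> (nat \<Rightarrow> real^3) \<Rightarrow> bool" where
  "vanishing_viscosity c \<nu> cs \<longleftrightarrow>
     (\<forall>k. \<nu> k > 0) \<and> \<nu> \<longlonglongrightarrow> 0 \<and> (\<forall>k. cs k \<in> J (\<nu> k)) \<and> cs \<longlonglongrightarrow> c"

definition x_bar :: "real^3 \<Rightarrow> real" where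
  "x_bar c = (sqrt (c$1) - sqrt (c$2)) / (sqrt (c$1) + sqrt (c$2))"

end

theory Submission imports Defs begin

text \<open>Put \<open>F = U\<^sup>2/2 - P\<close>, the defect of \<open>U\<close> from solving the equation without viscosity. The reflection \<open>x \<mapsto> -x\<close>,
  \<open>U \<mapsto> -U\<close> exchanges upper and lower solutions, so only upper solutions are treated.

  Maximality enters through one fact, \<open>U(-1) \<ge> 2\<nu>\<close> (\<open>upper_solution_left_end_ge\<close>): otherwise a solution above \<open>U\<close>
  can be written down by quadratures. As \<open>U(-1)\<close> solves a quadratic equation, this selects its larger root; in particular
  \<open>U\<close> starts above \<open>\<surd>(2P)\<close> at \<open>-1\<close>, and it stays positive as long as \<open>P \<ge> 0\<close> (\<open>upper_solution_pos\<close>).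

  The sup bounds come from the maximum principle. At an extremum of \<open>F\<close> one has \<open>U U' = P'\<close>, hence
  \<open>\<bar>F\<bar> \<bar>U\<bar> \<le> C \<nu> (1 + U\<^sup>2)\<close> (\<open>defect_at_extremum\<close>). If \<open>F\<close> is positive and exceeds the negative part of \<open>2P\<close>, then \<open>\<bar>U\<bar> \<ge> \<surd>F\<close>, so
  \<open>F \<le> C \<nu>\<^sup>2\<^sup>/\<^sup>3\<close> (\<open>defect_upper\<close>). If \<open>F\<close> is negative, a lower bound for \<open>U\<close> is needed. When \<open>P \<ge> 0\<close> it is the barrier
  \<open>\<surd>(2P) - K \<nu>\<^sup>1\<^sup>/\<^sup>3\<close> (\<open>upper_solution_barrier\<close>, \<open>defect_lower\<close>). When \<open>c\<^sub>2 = 0\<close> in the limit, \<open>P\<close> may be negative near \<open>1\<close>,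
  but outside a neighbourhood of \<open>1\<close> in which \<open>P\<close> is at most of the claimed order one has \<open>P > 0\<close> and \<open>P' < 0\<close>, and there
  positivity of \<open>U\<close> suffices (\<open>degenerate_defect\<close>). The equation converts the sup bound on \<open>F\<close> into the Lipschitz
  bound \<open>C \<nu>\<^sup>-\<^sup>1\<^sup>/\<^sup>3\<close> in the interior, and interpolation gives the Hoelder bound.

  Away from the zero of the limit, \<open>V = (U - \<surd>(2P))/\<nu>\<close> solves a linear singularly perturbed equation
  \<open>\<nu> (1 - x\<^sup>2) V' + H V = G\<close> with \<open>H\<close> bounded below. Its solutions are bounded, since the influence of values
  further left is exponentially small, and at the singular point \<open>-1\<close> there is no such influence (\<open>linear_bound\<close>). The derivatives of \<open>V\<close> satisfy equations of the same
  kind, so all of them are bounded uniformly in \<open>\<nu>\<close> (\<open>linear_unif_bounded\<close>, \<open>riccati_unif_bounded\<close>). Every estimate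
  holds uniformly in a neighbourhood of \<open>c\<close>, so that its constant does not depend on the sequences.\<close>

section \<open>Elementary properties of solutions\<close>

definition dP :: "real^3 \<Rightarrow> real \<Rightarrow> real" where
  "dP c x = - c$1 + c$2 - 2 * c$3 * x"

lemma P_has_derivative: "(P c has_real_derivative dP c x) (at x within S)"
  unfolding P_def dP_def by (auto intro!: derivative_eq_intros simp: algebra_simps)

lemma continuous_on_P [continuous_intros]: "continuous_on S (P c)"
  unfolding P_def by (intro continuous_intros)

lemma abs_P_le:
  assumes "\<And>i. \<bar>c$i\<bar> \<le> M" "\<bar>x\<bar> \<le> 1"
  shows "\<bar>P c x\<bar> \<le> 5 * M"
proof -
  have x: "-1 \<le> x" "x \<le> 1" and x2: "0 \<le> 1 - x\<^sup>2" "1 - x\<^sup>2 \<le> 1"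
    using assms(2) by (auto simp: abs_square_le_1 abs_le_iff)
  have M: "0 \<le> M" using assms(1)[of 1] by linarith
  have "\<bar>c$1 * (1 - x)\<bar> \<le> M * 2" "\<bar>c$2 * (1 + x)\<bar> \<le> M * 2" "\<bar>c$3 * (1 - x\<^sup>2)\<bar> \<le> M * 1"
    unfolding abs_mult using x x2 by (intro mult_mono assms(1) M; simp)+
  then show ?thesis unfolding P_def by linarith
qed

lemma abs_dP_le:
  assumes "\<And>i. \<bar>c$i\<bar> \<le> M" "\<bar>x\<bar> \<le> 1"
  shows "\<bar>dP c x\<bar> \<le> 4 * M"
proof -
  have M: "0 \<le> M" using assms(1)[of 1] by linarith
  have "\<bar>c$3 * x\<bar> \<le> M * 1" unfolding abs_mult by (intro mult_mono assms M) auto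
  then show ?thesis unfolding dP_def using assms(1)[of 1] assms(1)[of 2] by linarith
qed

lemma one_minus_square_pos: "-1 < x \<Longrightarrow> x < 1 \<Longrightarrow> 0 < 1 - x\<^sup>2" for x :: real
  by (simp add: abs_square_less_1)

lemma abs_aP_le:
  assumes "\<And>i. \<bar>c$i\<bar> \<le> M" "\<bar>x\<bar> \<le> 1"
  shows "\<bar>(1 - x\<^sup>2) * dP c x\<bar> \<le> 4 * M"
proof -
  have "0 \<le> 1 - x\<^sup>2" "1 - x\<^sup>2 \<le> 1" using assms(2) by (auto simp: abs_square_le_1)
  then have "\<bar>(1 - x\<^sup>2) * dP c x\<bar> \<le> 1 * \<bar>dP c x\<bar>"
    unfolding abs_mult by (intro mult_right_mono) auto
  then show ?thesis using abs_dP_le[OF assms] by linarith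
qed

lemma ode_solution_deriv:
  assumes "ode_solution \<nu> c U" "-1 < x" "x < 1"
  shows "(U has_real_derivative deriv U x) (at x)"
proof -
  obtain D where "\<And>x. x \<in> {-1<..<1} \<Longrightarrow> (U has_vector_derivative D x) (at x)"
    using assms(1) unfolding ode_solution_def C1_differentiable_on_def by blast
  then have "(U has_real_derivative D x) (at x)"
    using assms(2,3) by (simp add: has_real_derivative_iff_has_vector_derivative)
  then show ?thesis using DERIV_imp_deriv[of U] by metis
qed

lemma ode_solution_eq:
  assumes "ode_solution \<nu> c U" "-1 < x" "x < 1"
  shows "\<nu> * (1 - x\<^sup>2) * deriv U x = P c x - 2 * \<nu> * x * U x - (1/2) * (U x)\<^sup>2"
  using assms unfolding ode_solution_def by force

subsection \<open>Reflection\<close>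

text \<open>The equation is invariant under \<open>x \<mapsto> -x\<close>, \<open>U \<mapsto> -U\<close>, exchanging the two endpoints and hence
  \<open>c\<^sub>1\<close> and \<open>c\<^sub>2\<close>. As this reverses the order of solutions, every statement about lower solutions is
  the reflection of one about upper solutions.\<close>

definition swap :: "real^3 \<Rightarrow> real^3" where
  "swap c = (\<chi> i. if i = 1 then c$2 else if i = 2 then c$1 else c$3)"

lemma swap_nth [simp]: "swap c $ 1 = c$2" "swap c $ 2 = c$1" "swap c $ 3 = c$3"
  by (simp_all add: swap_def)

lemma swap_swap [simp]: "swap (swap c) = c"
  by (simp add: vec_eq_iff forall_3)

lemma P_swap: "P (swap c) x = P c (- x)"
  by (simp add: P_def)

lemma swap_in_J: "swap c \<in> J \<nu> \<longleftrightarrow> c \<in> J \<nu>"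
  by (auto simp: J_def c3_bar_def add.commute)

lemma continuous_on_reflect:
  fixes U :: "real \<Rightarrow> real"
  assumes "continuous_on {-1..1} U"
  shows "continuous_on {-1..1} (\<lambda>x. - U (- x))"
proof -
  have "continuous_on {-1..1} (\<lambda>x::real. - x)" by (intro continuous_intros)
  then have "continuous_on {-1..1} (\<lambda>x. U (- x))"
    by (rule continuous_on_compose2[OF assms]) auto
  then show ?thesis by (rule continuous_on_minus)
qed

lemma ode_solution_reflect:
  assumes "ode_solution \<nu> c U"
  shows "ode_solution \<nu> (swap c) (\<lambda>x. - U (- x))"
proof -
  have d: "((\<lambda>x. - U (- x)) has_real_derivative deriv U (- x)) (at x)" if "-1 < x" "x < 1" for x
    using ode_solution_deriv[OF assms, of "- x"] that
    by (auto intro!: derivative_eq_intros DERIV_chain2[of U _ "\<lambda>x. - x"] simp: minus_equation_iff)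
  obtain D where D: "\<And>x. x \<in> {-1<..<1} \<Longrightarrow> (U has_vector_derivative D x) (at x)"
    and cD: "continuous_on {-1<..<1} D"
    using assms unfolding ode_solution_def C1_differentiable_on_def by blast
  have "continuous_on {-1<..<1} (\<lambda>x::real. - x)" by (intro continuous_intros)
  then have "continuous_on {-1<..<1} (\<lambda>x. D (- x))"
    by (rule continuous_on_compose2[OF cD]) auto
  moreover have "D x = deriv U x" if "x \<in> {-1<..<1}" for x
    using DERIV_imp_deriv[OF D[OF that, folded has_real_derivative_iff_has_vector_derivative]] by simp
  ultimately have "continuous_on {-1<..<1} (\<lambda>x. deriv U (- x))"
    by (rule continuous_on_eq) auto
  then have C1: "(\<lambda>x. - U (- x)) C1_differentiable_on {-1<..<1}"
    unfolding C1_differentiable_on_def using d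
    by (intro exI[of _ "\<lambda>x. deriv U (- x)"])
       (auto simp: has_real_derivative_iff_has_vector_derivative)
  have eq: "\<nu> * (1 - x\<^sup>2) * deriv (\<lambda>x. - U (- x)) x + 2 * \<nu> * x * - U (- x) + 1/2 * (- U (- x))\<^sup>2 = P (swap c) x"
    if "x \<in> {-1<..<1}" for x
    using ode_solution_eq[OF assms, of "- x"] DERIV_imp_deriv[OF d, of x] that by (simp add: P_swap)
  show ?thesis unfolding ode_solution_def using C1 eq by blast
qed

lemma lower_solution_reflect:
  assumes "lower_solution \<nu> c U"
  shows "upper_solution \<nu> (swap c) (\<lambda>x. - U (- x))"
  unfolding upper_solution_def
proof (intro conjI allI impI ballI)
  show "ode_solution \<nu> (swap c) (\<lambda>x. - U (- x))"
    using assms by (intro ode_solution_reflect) (auto simp: lower_solution_def)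
  have "continuous_on {-1..1} U" using assms by (auto simp: lower_solution_def)
  then show "continuous_on {-1..1} (\<lambda>x. - U (- x))"
    by (rule continuous_on_reflect)
  fix V x assume V: "ode_solution \<nu> (swap c) V" and x: "x \<in> {-1<..<1::real}"
  have "\<forall>V. ode_solution \<nu> c V \<longrightarrow> (\<forall>x\<in>{-1<..<1}. U x \<le> V x)"
    using assms by (simp add: lower_solution_def)
  moreover have "ode_solution \<nu> c (\<lambda>x. - V (- x))" using ode_solution_reflect[OF V] by simp
  ultimately have "U (- x) \<le> - V (- (- x))" using x by fastforce
  then show "V x \<le> - U (- x)" by simp
qed

subsection \<open>Values at the endpoints\<close>

text \<open>Near \<open>-1\<close> the equation makes \<open>(1 + x) U'\<close> converge to some \<open>L\<close>. By l'Hopital's rule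
  \<open>U = (1 + x) U / (1 + x)\<close> then tends to \<open>U(-1) + L\<close>, so \<open>L = 0\<close> and the equation degenerates to a
  quadratic equation for \<open>U(-1)\<close>.\<close>

lemma value_at_left_end:
  assumes "ode_solution \<nu> c U" "continuous_on {-1..1} U" "\<nu> > 0"
  shows "(1/2) * (U (-1))\<^sup>2 - 2 * \<nu> * U (-1) = P c (-1)"
proof -
  define L where "L = (P c (-1) + 2 * \<nu> * U (-1) - (1/2) * (U (-1))\<^sup>2) / (2 * \<nu>)"
  have U: "(U \<longlongrightarrow> U (-1)) (at_right (-1))"
    using assms(2) by (simp add: continuous_on_Icc_at_rightD)
  have Pc: "(P c \<longlongrightarrow> P c (-1)) (at_right (-1))"
    using continuous_on_P[of "{-1..1}" c] by (simp add: continuous_on_Icc_at_rightD)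
  have "((\<lambda>x. U x + (P c x - 2 * \<nu> * x * U x - (1/2) * (U x)\<^sup>2) / (\<nu> * (1 - x))) \<longlongrightarrow>
      U (-1) + (P c (-1) - 2 * \<nu> * (-1) * U (-1) - (1/2) * (U (-1))\<^sup>2) / (\<nu> * (1 - (-1)))) (at_right (-1))"
    using assms(3) by (intro tendsto_intros U Pc) auto
  then have lim: "((\<lambda>x. (U x + (P c x - 2 * \<nu> * x * U x - (1/2) * (U x)\<^sup>2) / (\<nu> * (1 - x))) / 1)
      \<longlongrightarrow> U (-1) + L) (at_right (-1))"
    by (simp add: L_def mult.commute)
  have near: "\<forall>\<^sub>F x in at_right (-1). x \<in> {-1<..<1::real}"
    by (rule eventually_at_right_real) simp
  have der: "((\<lambda>x. (1 + x) * U x) has_real_derivative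
      U x + (P c x - 2 * \<nu> * x * U x - (1/2) * (U x)\<^sup>2) / (\<nu> * (1 - x))) (at x)"
    if "x \<in> {-1<..<1}" for x
  proof -
    have "1 - x\<^sup>2 = (1 + x) * (1 - x)" by (simp add: power2_eq_square algebra_simps)
    then have "(1 + x) * deriv U x = (P c x - 2 * \<nu> * x * U x - (1/2) * (U x)\<^sup>2) / (\<nu> * (1 - x))"
      using ode_solution_eq[OF assms(1), of x] that assms(3) by (simp add: field_simps)
    then show ?thesis
      using ode_solution_deriv[OF assms(1), of x] that
      by (auto intro!: derivative_eq_intros simp: mult.commute)
  qed
  have "((\<lambda>x. (1 + x) * U x / (1 + x)) \<longlongrightarrow> U (-1) + L) (at_right (-1))"
  proof (rule lhopital_right[OF _ _ _ _ _ _ lim])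
    have "((\<lambda>x. (1 + x) * U x) \<longlongrightarrow> (1 + -1) * U (-1)) (at_right (-1))"
      by (intro tendsto_intros U)
    then show "((\<lambda>x. (1 + x) * U x) \<longlongrightarrow> 0) (at_right (-1))" by simp
    have "((\<lambda>x::real. 1 + x) \<longlongrightarrow> 1 + -1) (at_right (-1))" by (intro tendsto_intros)
    then show "((\<lambda>x::real. 1 + x) \<longlongrightarrow> 0) (at_right (-1))" by simp
    show "\<forall>\<^sub>F x in at_right (-1). 1 + x \<noteq> (0::real)"
      using near by eventually_elim auto
    show "\<forall>\<^sub>F x in at_right (-1). ((\<lambda>x. (1 + x) * U x) has_real_derivative
      U x + (P c x - 2 * \<nu> * x * U x - (1/2) * (U x)\<^sup>2) / (\<nu> * (1 - x))) (at x)"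
      using near by eventually_elim (rule der)
    show "\<forall>\<^sub>F x in at_right (-1). ((+) 1 has_real_derivative 1) (at (x::real))"
      by (intro always_eventually allI) (auto intro!: derivative_eq_intros)
  qed auto
  then have "(U \<longlongrightarrow> U (-1) + L) (at_right (-1))"
    by (rule Lim_transform_eventually) (use near in \<open>eventually_elim, auto\<close>)
  then have "U (-1) + L = U (-1)" using U tendsto_unique trivial_limit_at_right_real by blast
  then show ?thesis using assms(3) by (simp add: L_def)
qed

lemma value_at_right_end:
  assumes "ode_solution \<nu> c U" "continuous_on {-1..1} U" "\<nu> > 0"
  shows "(1/2) * (U 1)\<^sup>2 + 2 * \<nu> * U 1 = P c 1"
proof -
  from value_at_left_end[OF ode_solution_reflect[OF assms(1)] continuous_on_reflect[OF assms(2)] assms(3)]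
  show ?thesis by (simp add: P_swap)
qed

subsection \<open>Integrating factors\<close>

lemma antiderivative_on_interval:
  fixes f :: "real \<Rightarrow> real"
  assumes "continuous_on {a<..<b} f" "a < b"
  obtains F where "\<And>x. a < x \<Longrightarrow> x < b \<Longrightarrow> (F has_real_derivative f x) (at x)"
proof -
  have "\<exists>F. \<forall>x. ereal a < ereal x \<longrightarrow> ereal x < ereal b \<longrightarrow> (F has_vector_derivative f x) (at x)"
    using assms
    by (intro einterval_antiderivative)
       (auto simp: continuous_on_eq_continuous_at open_greaterThanLessThan)
  then show ?thesis
    using that by (auto simp: has_real_derivative_iff_has_vector_derivative)
qed

lemma solution_continuous:
  assumes "continuous_on {-1..1} U" "S \<subseteq> {-1..1}"
  shows "continuous_on S U"
  using assms continuous_on_subset by blast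

text \<open>Given a solution \<open>U\<close>, the substitution \<open>V = U + 1/z\<close> turns the equation for \<open>V\<close> into a linear
  first order equation for \<open>z\<close>, which is solved by \<open>z = e\<^sup>G (K + A)\<close> below. If \<open>U(-1) < 2\<nu>\<close>, then \<open>A\<close> is
  bounded below near \<open>-1\<close>, so that \<open>z\<close> is positive on the whole interval for large \<open>K\<close>: there
  is a solution above \<open>U\<close>.\<close>

lemma upper_solution_left_end_ge:
  assumes up: "upper_solution \<nu> c U" and \<nu>: "\<nu> > 0"
  shows "U (-1) \<ge> 2 * \<nu>"
proof (rule ccontr)
  assume "\<not> ?thesis"
  then have neg: "U (-1) - 2 * \<nu> < 0" by simp
  have sol: "ode_solution \<nu> c U" and cont: "continuous_on {-1..1} U"
    using up by (auto simp: upper_solution_def)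
  have contU: "continuous_on {-1<..<1} U" by (rule solution_continuous[OF cont]) auto
  define G' where "G' x = (2 * \<nu> * x + U x) / (\<nu> * (1 - x\<^sup>2))" for x
  have nz: "\<nu> * (1 - x\<^sup>2) > 0" if "x \<in> {-1<..<1}" for x
    using \<nu> that one_minus_square_pos[of x] by simp
  have nz0: "\<forall>x\<in>{-1<..<1}. \<nu> * (1 - x\<^sup>2) \<noteq> 0" "\<forall>x\<in>{-1<..<1}. 2 * \<nu> * (1 - x\<^sup>2) \<noteq> 0"
    using nz by force+
  have cG': "continuous_on {-1<..<1} G'"
    unfolding G'_def by (intro continuous_on_divide[OF _ _ nz0(1)] continuous_intros contU)
  obtain G where G: "\<And>x. -1 < x \<Longrightarrow> x < 1 \<Longrightarrow> (G has_real_derivative G' x) (at x)"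
    using antiderivative_on_interval[OF cG'] by auto
  have cG: "continuous_on {-1<..<1} G"
    by (rule DERIV_continuous_on) (auto intro: G has_field_derivative_at_within)
  define A' where "A' x = exp (- G x) / (2 * \<nu> * (1 - x\<^sup>2))" for x
  have cA': "continuous_on {-1<..<1} A'"
    unfolding A'_def by (intro continuous_on_divide[OF _ _ nz0(2)] continuous_intros cG)
  obtain A where A: "\<And>x. -1 < x \<Longrightarrow> x < 1 \<Longrightarrow> (A has_real_derivative A' x) (at x)"
    using antiderivative_on_interval[OF cA'] by auto
  have A'_pos: "A' x > 0" if "x \<in> {-1<..<1}" for x
    using nz[OF that] unfolding A'_def by (simp add: zero_less_mult_iff)
  have A_mono: "A x \<le> A y" if "-1 < x" "x \<le> y" "y < 1" for x y
  proof (rule DERIV_nonneg_imp_nondecreasing[OF that(2)])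
    fix u assume "x \<le> u" "u \<le> y"
    then have u: "-1 < u" "u < 1" using that by auto
    show "\<exists>d. (A has_real_derivative d) (at u) \<and> 0 \<le> d"
      using A[OF u] A'_pos[of u] u by (intro exI[of _ "A' u"]) auto
  qed
  define m where "m = (2 * \<nu> - U (-1)) / 2"
  have m: "m > 0" using neg by (simp add: m_def)
  have "((\<lambda>x. 2 * \<nu> * x + U x) \<longlongrightarrow> 2 * \<nu> * (-1) + U (-1)) (at_right (-1))"
    using cont by (intro tendsto_intros continuous_on_Icc_at_rightD) auto
  then have "\<forall>\<^sub>F x in at_right (-1). 2 * \<nu> * x + U x < - m"
    using neg by (intro order_tendstoD(2)) (auto simp: m_def field_simps)
  moreover have "\<forall>\<^sub>F x in at_right (-1). x \<in> {-1<..<1::real}"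
    by (rule eventually_at_right_real) simp
  ultimately have "\<forall>\<^sub>F x in at_right (-1). 2 * \<nu> * x + U x < - m \<and> x < 1"
    by eventually_elim auto
  then obtain x1 where x1: "x1 > -1" "\<And>x. -1 < x \<Longrightarrow> x < x1 \<Longrightarrow> 2 * \<nu> * x + U x < - m \<and> x < 1"
    unfolding eventually_at_right_field by blast
  define x2 where "x2 = (-1 + min x1 1) / 2"
  have x2: "-1 < x2" "x2 < x1" "x2 < 1" using x1(1) by (auto simp: x2_def min_def field_simps)
  define B where "B = A x2 - exp (- G x2) / (2 * m)"
  \<comment> \<open>Left of \<open>x\<^sub>2\<close> the derivative of \<open>e\<^sup>-\<^sup>G\<close> is at least \<open>2 m A'\<close>, so the positive function \<open>e\<^sup>-\<^sup>G\<close> controls the decrease of \<open>A\<close> towards \<open>-1\<close>.\<close>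
  have AB: "A x \<ge> B" if "-1 < x" "x < 1" for x
  proof (cases "x \<le> x2")
    case True
    have "exp (- G x) - 2 * m * A x \<le> exp (- G x2) - 2 * m * A x2"
    proof (rule DERIV_nonneg_imp_nondecreasing[OF True, where f = "\<lambda>x. exp (- G x) - 2 * m * A x"])
      fix y assume y: "x \<le> y" "y \<le> x2"
      then have y': "y \<in> {-1<..<1}" using x2 that by auto
      have "2 * \<nu> * y + U y \<le> - m" using x1(2)[of y] y x2 that by auto
      then have "G' y \<le> - m / (\<nu> * (1 - y\<^sup>2))"
        unfolding G'_def using nz[OF y'] by (intro divide_right_mono) auto
      then have "m / (\<nu> * (1 - y\<^sup>2)) * exp (- G y) \<le> - G' y * exp (- G y)"
        by (intro mult_right_mono) auto
      moreover have "2 * m * A' y = m / (\<nu> * (1 - y\<^sup>2)) * exp (- G y)"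
        unfolding A'_def by simp
      ultimately have "- G' y * exp (- G y) - 2 * m * A' y \<ge> 0" by linarith
      moreover have "((\<lambda>x. exp (- G x) - 2 * m * A x) has_real_derivative - G' y * exp (- G y) - 2 * m * A' y) (at y)"
        using G[of y] A[of y] y' by (auto intro!: derivative_eq_intros)
      ultimately show "\<exists>z. ((\<lambda>x. exp (- G x) - 2 * m * A x) has_real_derivative z) (at y) \<and> 0 \<le> z" by blast
    qed
    then have "2 * m * B \<le> 2 * m * A x - exp (- G x)" unfolding B_def using m by (simp add: algebra_simps)
    then have "2 * m * B \<le> 2 * m * A x" using exp_gt_zero[of "- G x"] by linarith
    then show ?thesis using m by simp
  next
    case False
    then have "A x \<ge> A x2" using that x2 by (intro A_mono) auto
    moreover have "exp (- G x2) / (2 * m) \<ge> 0" using m by simp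
    ultimately show ?thesis by (simp add: B_def)
  qed
  define z where "z x = exp (G x) * (A x - B + 1)" for x
  have z_pos: "z x > 0" if "x \<in> {-1<..<1}" for x
    using AB[of x] that unfolding z_def by (simp add: zero_less_mult_iff)
  have dz: "(z has_real_derivative G' x * z x + 1 / (2 * \<nu> * (1 - x\<^sup>2))) (at x)" if "x \<in> {-1<..<1}" for x
  proof -
    have "(z has_real_derivative exp (G x) * G' x * (A x - B + 1) + A' x * exp (G x)) (at x)"
      unfolding z_def using G[of x] A[of x] that by (auto intro!: derivative_eq_intros)
    moreover have "A' x * exp (G x) = 1 / (2 * \<nu> * (1 - x\<^sup>2))"
      unfolding A'_def by (simp add: exp_minus)
    ultimately show ?thesis by (simp add: z_def mult_ac)
  qed
  define V where "V x = U x + 1 / z x" for x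
  define V' where "V' x = deriv U x - (G' x * z x + 1 / (2 * \<nu> * (1 - x\<^sup>2))) / (z x)\<^sup>2" for x
  have dV: "(V has_real_derivative V' x) (at x)" if "x \<in> {-1<..<1}" for x
  proof -
    define D where "D = G' x * z x + 1 / (2 * \<nu> * (1 - x\<^sup>2))"
    have "(z has_real_derivative D) (at x)" using dz[OF that] by (simp add: D_def)
    then have "(V has_real_derivative deriv U x - D / (z x)\<^sup>2) (at x)"
      unfolding V_def using ode_solution_deriv[OF sol, of x] z_pos[OF that] that
      by (auto intro!: derivative_eq_intros simp: power2_eq_square)
    then show ?thesis by (simp only: V'_def D_def)
  qed
  have cz: "continuous_on {-1<..<1} z"
    by (rule DERIV_continuous_on[OF has_field_derivative_at_within[OF dz]])
  have dU: "deriv U x = (P c x - 2 * \<nu> * x * U x - (1/2) * (U x)\<^sup>2) / (\<nu> * (1 - x\<^sup>2))" if "x \<in> {-1<..<1}" for x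
    using ode_solution_eq[OF sol, of x] that nz[OF that]
    by (metis nonzero_mult_div_cancel_left less_irrefl greaterThanLessThan_iff)
  have "continuous_on {-1<..<1} (\<lambda>x. (P c x - 2 * \<nu> * x * U x - (1/2) * (U x)\<^sup>2) / (\<nu> * (1 - x\<^sup>2)))"
    by (intro continuous_on_divide[OF _ _ nz0(1)] continuous_intros contU)
  then have "continuous_on {-1<..<1} (deriv U)"
    by (rule continuous_on_eq) (rule dU[symmetric])
  moreover have "(z x)\<^sup>2 \<noteq> 0" "2 * \<nu> * (1 - x\<^sup>2) \<noteq> 0" if "x \<in> {-1<..<1}" for x
    using z_pos[OF that] nz[OF that] by auto
  ultimately have cV': "continuous_on {-1<..<1} V'"
    unfolding V'_def by (intro continuous_intros cG' cz) auto
  have "ode_solution \<nu> c V" unfolding ode_solution_def C1_differentiable_on_def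
  proof (intro conjI exI ballI)
    show "continuous_on {-1<..<1} V'" by fact
    show "(V has_vector_derivative V' x) (at x)" if "x \<in> {-1<..<1}" for x
      using dV[OF that] by (simp add: has_real_derivative_iff_has_vector_derivative)
    fix x :: real assume x: "x \<in> {-1<..<1}"
    define w where "w = 1 / z x"
    have G: "\<nu> * (1 - x\<^sup>2) * G' x = 2 * \<nu> * x + U x"
      by (simp only: G'_def times_divide_eq_right nonzero_mult_div_cancel_left[OF nz0(1)[rule_format, OF x]])
    have V': "V' x = deriv U x - G' x * w - w\<^sup>2 / (2 * \<nu> * (1 - x\<^sup>2))"
    proof -
      have "(a * z x + q) / (z x)\<^sup>2 = a * w + w\<^sup>2 * q" for a q
        using z_pos[OF x] by (simp add: w_def power2_eq_square field_simps)
      then show ?thesis by (simp only: V'_def) simp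
    qed
    have "\<nu> * (1 - x\<^sup>2) * V' x = \<nu> * (1 - x\<^sup>2) * deriv U x - \<nu> * (1 - x\<^sup>2) * G' x * w
        - \<nu> * (1 - x\<^sup>2) * (w\<^sup>2 / (2 * \<nu> * (1 - x\<^sup>2)))"
      unfolding V' by (simp add: algebra_simps)
    also have "\<nu> * (1 - x\<^sup>2) * (w\<^sup>2 / (2 * \<nu> * (1 - x\<^sup>2))) = w\<^sup>2 / 2"
    proof -
      have "n * (v / (2 * n)) = v / 2" if "n \<noteq> 0" for n v :: real using that by simp
      from this[OF nz0(1)[rule_format, OF x]] show ?thesis by (simp only: mult.assoc)
    qed
    finally have "\<nu> * (1 - x\<^sup>2) * V' x = P c x - 2 * \<nu> * x * U x - (1/2) * (U x)\<^sup>2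
        - (2 * \<nu> * x + U x) * w - w\<^sup>2 / 2"
      using ode_solution_eq[OF sol, of x] x by (simp add: G)
    then show "\<nu> * (1 - x\<^sup>2) * deriv V x + 2 * \<nu> * x * V x + 1/2 * (V x)\<^sup>2 = P c x"
      unfolding DERIV_imp_deriv[OF dV[OF x]] V_def w_def[symmetric]
      by (simp add: power2_eq_square algebra_simps)
  qed
  then have "V 0 \<le> U 0" using up unfolding upper_solution_def by auto
  then show False using z_pos[of 0] by (simp add: V_def)
qed

text \<open>Where \<open>P \<ge> 0\<close> the equation says that \<open>U\<close> times an integrating factor is nondecreasing.\<close>

lemma upper_solution_pos:
  assumes up: "upper_solution \<nu> c U" and \<nu>: "\<nu> > 0"
    and Pnn: "\<And>x. -1 < x \<Longrightarrow> x \<le> t \<Longrightarrow> P c x \<ge> 0" and x: "-1 \<le> x" "x \<le> t" "x < 1"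
  shows "U x > 0"
proof (cases "x = -1")
  case True
  then show ?thesis using upper_solution_left_end_ge[OF up \<nu>] \<nu> by simp
next
  case False
  have sol: "ode_solution \<nu> c U" and cont: "continuous_on {-1..1} U"
    using up by (auto simp: upper_solution_def)
  have contU: "continuous_on {-1<..<1} U" by (rule solution_continuous[OF cont]) auto
  define G' where "G' x = (2 * \<nu> * x + (1/2) * U x) / (\<nu> * (1 - x\<^sup>2))" for x
  have nz: "\<nu> * (1 - x\<^sup>2) > 0" if "x \<in> {-1<..<1}" for x
    using \<nu> that one_minus_square_pos[of x] by simp
  have nz0: "\<forall>x\<in>{-1<..<1}. \<nu> * (1 - x\<^sup>2) \<noteq> 0" "\<forall>x\<in>{-1<..<1}. 2 * \<nu> * (1 - x\<^sup>2) \<noteq> 0"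
    using nz by force+
  have cG': "continuous_on {-1<..<1} G'"
    unfolding G'_def by (intro continuous_on_divide[OF _ _ nz0(1)] continuous_intros contU)
  obtain G where G: "\<And>x. -1 < x \<Longrightarrow> x < 1 \<Longrightarrow> (G has_real_derivative G' x) (at x)"
    using antiderivative_on_interval[OF cG'] by auto
  have "(U \<longlongrightarrow> U (-1)) (at_right (-1))"
    using cont by (simp add: continuous_on_Icc_at_rightD)
  then have "\<forall>\<^sub>F y in at_right (-1). U y > 0"
    using upper_solution_left_end_ge[OF up \<nu>] \<nu> by (intro order_tendstoD(1)[where y = "U (-1)"]) auto
  moreover have "\<forall>\<^sub>F y in at_right (-1). y \<in> {-1<..<x}"
    using False x by (intro eventually_at_right_real) auto
  ultimately have "\<forall>\<^sub>F y in at_right (-1). U y > 0 \<and> y \<in> {-1<..<x}" by eventually_elim auto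
  then obtain s where s: "U s > 0" "-1 < s" "s < x"
    using eventually_happens'[OF trivial_limit_at_right_real] by auto
  have "U s * exp (G s) \<le> U x * exp (G x)"
  proof (rule DERIV_nonneg_imp_nondecreasing[where f = "\<lambda>x. U x * exp (G x)"])
    show "s \<le> x" using s by simp
    fix y assume "s \<le> y" "y \<le> x"
    then have y: "-1 < y" "y < 1" "y \<le> t" using s x by auto
    have n: "\<nu> * (1 - y\<^sup>2) > 0" using nz y by auto
    have "\<nu> * (1 - y\<^sup>2) * (deriv U y + U y * G' y) = \<nu> * (1 - y\<^sup>2) * deriv U y + U y * (2 * \<nu> * y + (1/2) * U y)"
      using n by (simp only: G'_def distrib_left[of "\<nu> * (1 - y\<^sup>2)"] times_divide_eq_right) auto
    also have "\<dots> = P c y" using ode_solution_eq[OF sol y(1,2)] by (simp add: power2_eq_square algebra_simps)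
    finally have "deriv U y + U y * G' y = P c y / (\<nu> * (1 - y\<^sup>2))"
      using n by (metis nonzero_mult_div_cancel_left less_irrefl)
    then have "deriv U y + U y * G' y \<ge> 0" using Pnn[OF y(1,3)] n by simp
    then have "(deriv U y + U y * G' y) * exp (G y) \<ge> 0" by simp
    moreover have "((\<lambda>x. U x * exp (G x)) has_real_derivative (deriv U y + U y * G' y) * exp (G y)) (at y)"
      using ode_solution_deriv[OF sol y(1,2)] G[OF y(1,2)]
      by (auto intro!: derivative_eq_intros simp: algebra_simps)
    ultimately show "\<exists>z. ((\<lambda>x. U x * exp (G x)) has_real_derivative z) (at y) \<and> 0 \<le> z" by blast
  qed
  moreover have "U s * exp (G s) > 0" using s by simp
  ultimately have "U x * exp (G x) > 0" by linarith
  then show ?thesis by (simp add: zero_less_mult_iff)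
qed

section \<open>Uniform estimates for the defect\<close>

abbreviation (input) defect :: "real^3 \<Rightarrow> (real \<Rightarrow> real) \<Rightarrow> real \<Rightarrow> real" where
  "defect c U x \<equiv> (1/2) * (U x)\<^sup>2 - P c x"

lemma derivative_at_extremum:
  assumes sol: "ode_solution \<nu> c U" and x: "-1 < x" "x < 1"
    and d: "0 < \<delta>" and ext: "(\<forall>y. \<bar>x - y\<bar> < \<delta> \<longrightarrow> defect c U y \<le> defect c U x) \<or>
      (\<forall>y. \<bar>x - y\<bar> < \<delta> \<longrightarrow> defect c U x \<le> defect c U y)"
  shows "defect c U x * U x = - \<nu> * ((1 - x\<^sup>2) * dP c x + 2 * x * (U x)\<^sup>2)"
proof -
  have "((\<lambda>x. defect c U x) has_real_derivative U x * deriv U x - dP c x) (at x)"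
    using ode_solution_deriv[OF sol x] by (auto intro!: derivative_eq_intros P_has_derivative)
  then have "U x * deriv U x - dP c x = 0"
    using ext DERIV_local_max[OF _ d] DERIV_local_min[OF _ d] by blast
  then have 1: "dP c x = U x * deriv U x" by simp
  have 2: "defect c U x = - \<nu> * (1 - x\<^sup>2) * deriv U x - 2 * \<nu> * x * U x"
    using ode_solution_eq[OF sol x] by simp
  then show ?thesis unfolding 1 2 by (simp add: power2_eq_square algebra_simps)
qed

text \<open>At an extremum of the defect \<open>U\<^sup>2/2 - P\<close> one has \<open>U U' = P'\<close>. Multiplying the equation by \<open>U\<close> thus
  turns its viscous term into \<open>\<nu> (1 - x\<^sup>2) P'\<close>, which is bounded in terms of the coefficients. At the endpoints the same bound
  comes from the quadratic equations there.\<close>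

lemma defect_at_extremum:
  assumes sol: "ode_solution \<nu> c U" and cont: "continuous_on {-1..1} U" and \<nu>: "\<nu> > 0"
    and M: "\<And>i. \<bar>c$i\<bar> \<le> M" and x: "x \<in> {-1..1}"
    and ext: "(\<forall>y\<in>{-1..1}. defect c U y \<le> defect c U x) \<or>
      (\<forall>y\<in>{-1..1}. defect c U x \<le> defect c U y)"
  shows "\<bar>defect c U x\<bar> * \<bar>U x\<bar> \<le> \<nu> * (4 * M + 2 * (U x)\<^sup>2)"
proof -
  have M0: "0 \<le> M" using M[of 1] by linarith
  consider "x = -1" | "x = 1" | "-1 < x" "x < 1" using x by force
  then show ?thesis
  proof cases
    case 1
    have "defect c U x = 2 * \<nu> * U x" using value_at_left_end[OF sol cont \<nu>] 1 by simp
    then have "\<bar>defect c U x\<bar> * \<bar>U x\<bar> = \<nu> * (2 * (U x)\<^sup>2)"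
      using \<nu> by (simp add: abs_mult power2_eq_square)
    then show ?thesis using \<nu> M0 by (simp add: distrib_left)
  next
    case 2
    have "defect c U x = - (2 * \<nu> * U x)" using value_at_right_end[OF sol cont \<nu>] 2 by simp
    then have "\<bar>defect c U x\<bar> * \<bar>U x\<bar> = \<nu> * (2 * (U x)\<^sup>2)"
      using \<nu> by (simp add: abs_mult power2_eq_square)
    then show ?thesis using \<nu> M0 by (simp add: distrib_left)
  next
    case 3
    define \<delta> where "\<delta> = min (x + 1) (1 - x)"
    have dy: "y \<in> {-1..1}" if "\<bar>x - y\<bar> < \<delta>" for y
      using 3 that by (auto simp: \<delta>_def)
    have d: "\<delta> > 0" using 3 by (auto simp: \<delta>_def)
    have "defect c U x * U x = - \<nu> * ((1 - x\<^sup>2) * dP c x + 2 * x * (U x)\<^sup>2)"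
      using ext dy by (intro derivative_at_extremum[OF sol 3 d]) blast
    then have "\<bar>defect c U x\<bar> * \<bar>U x\<bar> = \<nu> * \<bar>(1 - x\<^sup>2) * dP c x + 2 * x * (U x)\<^sup>2\<bar>"
      using \<nu> by (metis abs_mult abs_minus_cancel abs_of_pos mult_minus_left)
    also have "\<dots> \<le> \<nu> * (4 * M + 2 * (U x)\<^sup>2)"
    proof (intro mult_left_mono)
      have "\<bar>x * (U x)\<^sup>2\<bar> \<le> 1 * (U x)\<^sup>2" unfolding abs_mult using 3 by (intro mult_mono) auto
      then show "\<bar>(1 - x\<^sup>2) * dP c x + 2 * x * (U x)\<^sup>2\<bar> \<le> 4 * M + 2 * (U x)\<^sup>2"
        using abs_aP_le[OF M, of x] 3 by (simp add: mult.assoc) linarith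
    qed (use \<nu> in simp)
    finally show ?thesis .
  qed
qed

lemma continuous_defect:
  assumes "continuous_on {-1..1} U"
  shows "continuous_on {-1..1} (\<lambda>x. defect c U x)"
  by (intro continuous_intros assms)

text \<open>In the following estimates \<open>\<nu> = e\<^sup>3\<close>. At a maximum of the defect \<open>F\<close> with \<open>F \<ge> e\<^sup>2\<close> and \<open>F \<ge> 2\<rho>\<close> the solution
  satisfies \<open>U\<^sup>2 \<ge> F \<ge> e\<^sup>2\<close>, so that the bound on \<open>F \<bar>U\<bar>\<close> above gives \<open>F \<le> C \<nu> / e = C e\<^sup>2\<close>: this is the origin of
  the exponent \<open>2/3\<close>.\<close>

lemma defect_upper:
  assumes sol: "ode_solution \<nu> c U" and cont: "continuous_on {-1..1} U"
    and \<nu>: "\<nu> = e ^ 3" and e: "0 < e" "e \<le> 1/2" and M: "\<And>i. \<bar>c$i\<bar> \<le> M"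
    and \<rho>: "\<rho> \<ge> 0" "\<And>x. x \<in> {-1..1} \<Longrightarrow> P c x \<ge> - \<rho>" and x: "x \<in> {-1..1}"
  shows "defect c U x \<le> 2 * \<rho> + (5 + 28 * M) * e\<^sup>2"
proof -
  have M0: "0 \<le> M" using M[of 1] by linarith
  have \<nu>0: "\<nu> > 0" using \<nu> e by simp
  have e2: "e\<^sup>2 > 0" using e by simp
  have \<nu>e: "\<nu> = e\<^sup>2 * e" using \<nu> by (simp add: power2_eq_square power3_eq_cube)
  have "e\<^sup>2 \<le> (1/2)\<^sup>2" using e by (intro power_mono) auto
  then have "e\<^sup>2 * e \<le> (1/2)\<^sup>2 * (1/2)" using e by (intro mult_mono) auto
  then have \<nu>8: "\<nu> \<le> 1/8" unfolding \<nu>e by (simp add: power2_eq_square)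
  have \<nu>e2: "\<nu> \<le> e\<^sup>2" unfolding \<nu>e using e mult_left_le[of e "e\<^sup>2"] by simp
  obtain z where z: "z \<in> {-1..1}"
    and max: "\<forall>y\<in>{-1..1}. defect c U y \<le> defect c U z"
    using continuous_attains_sup[OF _ _ continuous_defect[OF cont, of c]] by auto
  define F where "F = defect c U z"
  define u where "u = \<bar>U z\<bar>"
  have u2: "u\<^sup>2 = 2 * (P c z + F)" by (simp add: u_def F_def)
  have crit: "\<bar>F\<bar> * u \<le> \<nu> * (4 * M + 2 * u\<^sup>2)"
    using defect_at_extremum[OF sol cont \<nu>0 M z] max unfolding F_def u_def by simp
  have Pz: "P c z \<le> 5 * M" using abs_P_le[OF M, of z] z by (auto simp: abs_le_iff)
  have "F \<le> 2 * \<rho> + (5 + 28 * M) * e\<^sup>2"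
  proof (rule ccontr)
    assume "\<not> ?thesis"
    then have big: "F > 2 * \<rho> + 5 * e\<^sup>2 + 28 * (M * e\<^sup>2)" by (simp add: algebra_simps)
    have Me: "M * e\<^sup>2 \<ge> 0" using M0 by simp
    have "F \<ge> 2 * \<rho>" using big Me e2 by linarith
    then have "u\<^sup>2 \<ge> F" using \<rho>(2)[OF z] unfolding u2 by simp
    then have "u\<^sup>2 \<ge> e\<^sup>2" using big Me \<rho>(1) e2 by linarith
    moreover have "u \<ge> 0" by (simp add: u_def)
    ultimately have u: "u \<ge> e" using e power2_le_imp_le by blast
    have F0: "F > 0" using big \<rho>(1) Me e2 by linarith
    have "\<nu> \<le> e\<^sup>2 * u" unfolding \<nu>e using u by (intro mult_left_mono) auto
    then have "4 * M * \<nu> \<le> 4 * M * (e\<^sup>2 * u)" using M0 by (intro mult_left_mono) auto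
    then have "F * u \<le> (4 * (M * e\<^sup>2) + 2 * \<nu> * u) * u"
      using crit F0 by (simp add: algebra_simps power2_eq_square)
    then have F1: "F \<le> 4 * (M * e\<^sup>2) + 2 * \<nu> * u" using u e by (simp add: mult_le_cancel_right)
    \<comment> \<open>The term \<open>2 \<nu> u\<close> is linear in \<open>\<surd>F\<close> and is absorbed into \<open>F\<close>.\<close>
    have "2 * u \<le> 1 + u\<^sup>2" using sum_squares_bound[of u 1] by simp
    then have "\<nu> * (2 * u) \<le> \<nu> * (1 + 10 * M + 2 * F)"
      using \<nu>0 Pz unfolding u2 by (intro mult_left_mono) auto
    moreover have "\<nu> * (1 + 10 * M) \<le> e\<^sup>2 * (1 + 10 * M)" using \<nu>e2 M0 by (intro mult_right_mono) auto
    moreover have "\<nu> * F \<le> 1/8 * F" using \<nu>8 F0 by (intro mult_right_mono) auto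
    ultimately have "2 * \<nu> * u \<le> e\<^sup>2 + 10 * (M * e\<^sup>2) + 1/4 * F" by (simp add: algebra_simps)
    then show False using F1 big Me e2 \<rho>(1) by linarith
  qed
  then show ?thesis using max x F_def by fastforce
qed

lemma first_zero:
  fixes g :: "real \<Rightarrow> real"
  assumes "continuous_on {a..b} g" "g a < 0" "g b \<ge> 0" "a \<le> b"
  obtains x where "a < x" "x \<le> b" "g x = 0" "\<And>y. a \<le> y \<Longrightarrow> y < x \<Longrightarrow> g y < 0"
proof -
  define Z where "Z = {x \<in> {a..b}. 0 \<le> g x}"
  have "closed Z" unfolding Z_def using assms(1) by (intro continuous_on_closed_Collect_le continuous_intros) auto
  moreover have "bounded Z" by (rule bounded_subset[of "{a..b}"]) (auto simp: Z_def)
  ultimately have "compact Z" by (simp add: compact_eq_bounded_closed)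
  moreover have "b \<in> Z" using assms by (auto simp: Z_def)
  ultimately obtain x where x: "x \<in> Z" "\<And>y. y \<in> Z \<Longrightarrow> x \<le> y"
    using compact_attains_inf[of Z] by auto
  have ab: "a \<le> x" "x \<le> b" "0 \<le> g x" using x(1) by (auto simp: Z_def)
  have neg: "g y < 0" if "a \<le> y" "y < x" for y
    using x(2)[of y] that ab by (force simp: Z_def)
  have "g x = 0"
  proof (rule ccontr)
    assume "g x \<noteq> 0"
    then have "g x > 0" using ab by simp
    moreover have "continuous_on {a..x} g" using assms(1) ab by (auto intro: continuous_on_subset)
    ultimately obtain y where "a \<le> y" "y \<le> x" "g y = 0"
      using IVT'[of g a 0 x] assms(2) ab by auto
    then show False using neg[of y] \<open>g x \<noteq> 0\<close> by force
  qed
  moreover have "a < x" using ab assms(2) by (cases "a = x") auto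
  ultimately show ?thesis using that ab neg by blast
qed

text \<open>If \<open>P \<ge> 0\<close>, then \<open>\<surd>(2P) - K e\<close> is a barrier from below. It lies below \<open>U\<close> at \<open>-1\<close>. Where it is
  positive its slope is at most \<open>C/e\<close>, so that its viscous terms are \<open>O(\<nu>/e) = O(e\<^sup>2)\<close>, which the
  gain \<open>(K e)\<^sup>2/2\<close> in the quadratic term beats for large \<open>K\<close>. Where it is not positive there is
  nothing to show, as \<open>U > 0\<close>.\<close>

lemma upper_solution_barrier:
  assumes up: "upper_solution \<nu> c U"
    and \<nu>: "\<nu> = e ^ 3" and e: "0 < e" "e \<le> 1/2" and M: "\<And>i. \<bar>c$i\<bar> \<le> M"
    and P0: "\<And>x. x \<in> {-1..1} \<Longrightarrow> P c x \<ge> 0" and x: "-1 \<le> x" "x < 1"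
  shows "sqrt (2 * P c x) - (3 + 14 * M) * e \<le> U x"
proof (rule ccontr)
  define \<kappa> where "\<kappa> = (3 + 14 * M) * e"
  assume "\<not> ?thesis"
  then have gx: "sqrt (2 * P c x) - \<kappa> - U x > 0" by (simp add: \<kappa>_def)
  have sol: "ode_solution \<nu> c U" and cont: "continuous_on {-1..1} U"
    using up by (auto simp: upper_solution_def)
  have M0: "0 \<le> M" using M[of 1] by linarith
  have \<nu>0: "\<nu> > 0" using \<nu> e by simp
  have \<nu>e: "\<nu> = e\<^sup>2 * e" using \<nu> by (simp add: power2_eq_square power3_eq_cube)
  have \<nu>e2: "\<nu> \<le> e\<^sup>2" unfolding \<nu>e using e mult_left_le[of e "e\<^sup>2"] by simp
  have "1 * e \<le> (3 + 14 * M) * e" using e M0 by (intro mult_right_mono) auto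
  then have \<kappa>e: "\<kappa> \<ge> e" by (simp add: \<kappa>_def)
  have pos: "U y > 0" if "-1 \<le> y" "y < 1" for y
    using that P0 by (intro upper_solution_pos[OF up \<nu>0, of y]) auto
  define g where "g y = sqrt (2 * P c y) - \<kappa> - U y" for y
  have "continuous_on {-1..x} U" using cont x by (auto intro: continuous_on_subset)
  then have cg: "continuous_on {-1..x} g" unfolding g_def by (intro continuous_intros)
  have "(U (-1))\<^sup>2 \<ge> 2 * P c (-1)"
    using value_at_left_end[OF sol cont \<nu>0] mult_pos_pos[OF \<nu>0 pos[of "-1"]] by simp
  then have "sqrt (2 * P c (-1)) \<le> U (-1)"
    using pos[of "-1"] by (simp add: real_le_lsqrt)
  then have "g (-1) < 0" using \<kappa>e e by (simp add: g_def)
  moreover have "g x \<ge> 0" using gx by (simp add: g_def)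
  ultimately obtain z where z: "-1 < z" "z \<le> x" "g z = 0" and before: "\<And>y. -1 \<le> y \<Longrightarrow> y < z \<Longrightarrow> g y < 0"
    using first_zero[OF cg] x by metis
  have z1: "z < 1" "z \<in> {-1..1}" using z x by auto
  define s where "s = sqrt (2 * P c z)"
  have U: "U z = s - \<kappa>" using z(3) by (simp add: g_def s_def)
  have s: "s > \<kappa>" using pos[of z] z z1 U by simp
  have P: "P c z = s\<^sup>2 / 2" using P0[OF z1(2)] by (simp add: s_def)
  have Ppos: "P c z > 0" unfolding P using s \<kappa>e e by simp
  define g' where "g' = dP c z / s - deriv U z"
  have dg: "(g has_real_derivative g') (at z)"
  proof -
    have "((\<lambda>y. sqrt (2 * P c y)) has_real_derivative (inverse (sqrt (2 * P c z)) / 2) * (2 * dP c z)) (at z)"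
      using Ppos by (intro DERIV_chain2[OF DERIV_real_sqrt] DERIV_cmult P_has_derivative) auto
    then have "((\<lambda>y. sqrt (2 * P c y)) has_real_derivative dP c z / s) (at z)"
      by (simp add: s_def field_simps)
    from DERIV_diff[OF DERIV_diff[OF this DERIV_const[of \<kappa>]] ode_solution_deriv[OF sol z(1) z1(1)]]
    show ?thesis by (simp add: g_def[abs_def] g'_def)
  qed
  have "g' \<ge> 0"
  proof (rule ccontr)
    assume "\<not> g' \<ge> 0"
    then obtain d where d: "d > 0" "\<And>h. h > 0 \<Longrightarrow> h < d \<Longrightarrow> g z < g (z - h)"
      using DERIV_neg_dec_left[OF dg] by auto
    define h where "h = min (d / 2) ((z + 1) / 2)"
    have "h > 0" "h < d" "-1 \<le> z - h" using d(1) z by (auto simp: h_def min_def field_simps)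
    then show False using d(2)[of h] before[of "z - h"] z by auto
  qed
  moreover have "\<nu> * (1 - z\<^sup>2) * g' < 0"
  proof -
    have "\<nu> * (1 - z\<^sup>2) * g' = \<nu> * ((1 - z\<^sup>2) * dP c z) / s - \<nu> * (1 - z\<^sup>2) * deriv U z"
      by (simp add: g'_def algebra_simps diff_divide_distrib)
    also have "\<dots> = \<nu> * ((1 - z\<^sup>2) * dP c z) / s + 2 * \<nu> * (z * (s - \<kappa>)) - \<kappa> * s + \<kappa>\<^sup>2 / 2"
      unfolding ode_solution_eq[OF sol z(1) z1(1)] U P by (simp add: power2_eq_square algebra_simps)
    also have "\<dots> < 0"
    proof -
      have "\<nu> * ((1 - z\<^sup>2) * dP c z) / s \<le> \<nu> * (4 * M) / e"
        using abs_aP_le[OF M, of z] z1 \<nu>0 e s \<kappa>e M0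
        by (intro frac_le mult_left_mono) (auto simp: abs_le_iff)
      moreover have "\<nu> * (4 * M) / e = 4 * (M * e\<^sup>2)" using e by (simp add: \<nu>e)
      ultimately have 1: "\<nu> * ((1 - z\<^sup>2) * dP c z) / s \<le> 4 * (M * e\<^sup>2)" by linarith
      have "s\<^sup>2 \<le> 10 * M" using P abs_P_le[OF M, of z] z1 by (auto simp: abs_le_iff)
      moreover have "2 * s \<le> 1 + s\<^sup>2" using sum_squares_bound[of s 1] by simp
      ultimately have sM: "2 * (s - \<kappa>) \<le> 1 + 10 * M" using \<kappa>e e by simp
      have "z * (s - \<kappa>) \<le> 1 * (s - \<kappa>)" using z1 s by (intro mult_right_mono) auto
      then have "2 * (z * (s - \<kappa>)) \<le> 1 + 10 * M" using sM by simp
      then have "\<nu> * (2 * (z * (s - \<kappa>))) \<le> e\<^sup>2 * (1 + 10 * M)"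
        using \<nu>0 M0 s z1 by (intro order_trans[OF mult_left_mono[of _ "1 + 10 * M"] mult_right_mono] \<nu>e2) auto
      then have 2: "2 * \<nu> * (z * (s - \<kappa>)) \<le> e\<^sup>2 + 10 * (M * e\<^sup>2)" by (simp add: algebra_simps)
      have ks: "\<kappa> * s \<ge> \<kappa>\<^sup>2" using s \<kappa>e e by (simp add: power2_eq_square)
      have "\<kappa>\<^sup>2 = (3 + 14 * M) * (3 + 14 * M) * e\<^sup>2" by (simp add: \<kappa>_def power2_eq_square)
      moreover have "3 * (3 + 14 * M) * e\<^sup>2 \<le> (3 + 14 * M) * (3 + 14 * M) * e\<^sup>2"
        using M0 by (intro mult_right_mono) auto
      moreover have "3 * (3 + 14 * M) * e\<^sup>2 = 9 * e\<^sup>2 + 42 * (M * e\<^sup>2)" by (simp add: algebra_simps)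
      ultimately have "\<kappa> * s - \<kappa>\<^sup>2 / 2 \<ge> 9/2 * e\<^sup>2 + 21 * (M * e\<^sup>2)" using ks by linarith
      moreover have "e\<^sup>2 > 0" "M * e\<^sup>2 \<ge> 0" using e M0 by auto
      ultimately show ?thesis using 1 2 by linarith
    qed
    finally show ?thesis .
  qed
  moreover have "\<nu> * (1 - z\<^sup>2) > 0" using \<nu>0 one_minus_square_pos z z1 by simp
  ultimately show False using mult_nonneg_nonneg[of "\<nu> * (1 - z\<^sup>2)" g'] by (meson less_imp_le not_le)
qed

text \<open>The barrier makes \<open>U\<close> at least \<open>K e\<close> unless \<open>P = O(e\<^sup>2)\<close>, in which case the bound is trivial. In the
  first case the estimate at extrema applies as before.\<close>

lemma defect_lower:
  assumes up: "upper_solution \<nu> c U"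
    and \<nu>: "\<nu> = e ^ 3" and e: "0 < e" "e \<le> 1/2" and M: "\<And>i. \<bar>c$i\<bar> \<le> M"
    and P0: "\<And>x. x \<in> {-1..1} \<Longrightarrow> P c x \<ge> 0" and x: "x \<in> {-1..1}"
  shows "P c x - (1/2) * (U x)\<^sup>2 \<le> (1 + 14 * M + 2 * (3 + 14 * M)\<^sup>2) * e\<^sup>2"
proof -
  define \<kappa> where "\<kappa> = (3 + 14 * M) * e"
  have sol: "ode_solution \<nu> c U" and cont: "continuous_on {-1..1} U"
    using up by (auto simp: upper_solution_def)
  have M0: "0 \<le> M" using M[of 1] by linarith
  have \<nu>0: "\<nu> > 0" using \<nu> e by simp
  have e2: "e\<^sup>2 > 0" using e by simp
  have \<nu>e: "\<nu> = e\<^sup>2 * e" using \<nu> by (simp add: power2_eq_square power3_eq_cube)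
  have \<nu>e2: "\<nu> \<le> e\<^sup>2" unfolding \<nu>e using e mult_left_le[of e "e\<^sup>2"] by simp
  have "1 * e \<le> (3 + 14 * M) * e" using e M0 by (intro mult_right_mono) auto
  then have \<kappa>e: "\<kappa> \<ge> e" by (simp add: \<kappa>_def)
  have k2: "\<kappa>\<^sup>2 = (3 + 14 * M)\<^sup>2 * e\<^sup>2" by (simp add: \<kappa>_def power_mult_distrib)
  obtain z where z: "z \<in> {-1..1}"
    and min: "\<forall>y\<in>{-1..1}. defect c U z \<le> defect c U y"
    using continuous_attains_inf[OF _ _ continuous_defect[OF cont, of c]] by auto
  define F where "F = P c z - (1/2) * (U z)\<^sup>2"
  have Pz: "P c z \<le> 5 * M" using abs_P_le[OF M, of z] z by (auto simp: abs_le_iff)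
  have "F \<le> (1 + 14 * M) * e\<^sup>2 + 2 * \<kappa>\<^sup>2"
  proof (cases "F \<le> 0 \<or> sqrt (2 * P c z) < 2 * \<kappa>")
    case True
    have "2 * P c z \<le> (2 * \<kappa>)\<^sup>2" if "sqrt (2 * P c z) < 2 * \<kappa>"
      using that P0[OF z] \<kappa>e e by (metis less_imp_le sqrt_le_D)
    moreover have FP: "F \<le> P c z" by (simp add: F_def)
    ultimately have "F \<le> 2 * \<kappa>\<^sup>2" if "\<not> F \<le> 0" using True that by (simp add: power_mult_distrib)
    then have "F \<le> 2 * \<kappa>\<^sup>2" using zero_le_power2[of \<kappa>] by linarith
    moreover have "(1 + 14 * M) * e\<^sup>2 \<ge> 0" using M0 by simp
    ultimately show ?thesis by simp
  next
    case False
    then have F: "F > 0" and s: "sqrt (2 * P c z) \<ge> 2 * \<kappa>" by auto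
    have "(U z)\<^sup>2 \<le> 10 * M" using F Pz by (simp add: F_def)
    moreover have "2 * \<bar>U z\<bar> \<le> 1 + (U z)\<^sup>2" using sum_squares_bound[of "\<bar>U z\<bar>" 1] by simp
    ultimately have "2 * \<bar>U z\<bar> \<le> 1 + 10 * M" by linarith
    then have "\<nu> * (2 * \<bar>U z\<bar>) \<le> e\<^sup>2 * (1 + 10 * M)"
      using \<nu>0 M0 by (intro mult_mono \<nu>e2) auto
    then have \<nu>U: "2 * \<nu> * \<bar>U z\<bar> \<le> e\<^sup>2 * (1 + 10 * M)" by simp
    have "F \<le> e\<^sup>2 * (1 + 14 * M)"
    proof (cases "z = 1")
      case True
      have "2 * \<nu> * U z = F" using value_at_right_end[OF sol cont \<nu>0] True by (simp add: F_def)
      moreover have "2 * \<nu> * U z \<le> 2 * \<nu> * \<bar>U z\<bar>" using \<nu>0 by (intro mult_left_mono) auto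
      moreover have "e\<^sup>2 * (1 + 10 * M) \<le> e\<^sup>2 * (1 + 14 * M)" using M0 by (intro mult_left_mono) auto
      ultimately show ?thesis using \<nu>U by linarith
    next
      case False
      then have U: "U z \<ge> \<kappa>"
        using upper_solution_barrier[OF up \<nu> e M P0, of z] z s by (simp add: \<kappa>_def)
      have "F * U z \<le> \<nu> * (4 * M + 2 * (U z)\<^sup>2)"
        using defect_at_extremum[OF sol cont \<nu>0 M z] min F U \<kappa>e e unfolding F_def by (simp add: abs_if)
      moreover have "\<nu> \<le> e\<^sup>2 * U z" unfolding \<nu>e using U \<kappa>e by (intro mult_left_mono) auto
      then have "4 * M * \<nu> \<le> 4 * M * (e\<^sup>2 * U z)" using M0 by (intro mult_left_mono) auto
      ultimately have "F * U z \<le> (4 * (M * e\<^sup>2) + 2 * \<nu> * \<bar>U z\<bar>) * U z"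
        using U \<kappa>e e by (simp add: algebra_simps power2_eq_square)
      then have "F \<le> 4 * (M * e\<^sup>2) + 2 * \<nu> * \<bar>U z\<bar>" using U \<kappa>e e by (simp add: mult_le_cancel_right)
      then show ?thesis using \<nu>U by (simp add: algebra_simps)
    qed
    then show ?thesis by (simp add: mult.commute add_increasing2)
  qed
  then have "F \<le> (1 + 14 * M + 2 * (3 + 14 * M)\<^sup>2) * e\<^sup>2" by (simp add: k2 algebra_simps)
  then show ?thesis using min x F_def by fastforce
qed

section \<open>The degenerate endpoint\<close>

text \<open>With \<open>y = 1 - x\<close>, \<open>A = -2 c\<^sub>3\<close> and \<open>d = 2 c\<^sub>3 + c\<^sub>1\<close> one has \<open>P = 2 c\<^sub>2 + (d - c\<^sub>2) y + A y\<^sup>2/2\<close>. If \<open>c\<^sub>2 = O(r\<^sup>2)\<close>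
  and \<open>d = O(r)\<close>, then for \<open>y \<ge> K r\<close> the quadratic term dominates, whereas for \<open>y \<le> K r\<close> all terms are \<open>O(r\<^sup>2)\<close>.\<close>

lemma P_near_degenerate:
  assumes q: "q > 0" "q/2 \<le> - 2 * c$3" "- 2 * c$3 \<le> 2 * q"
    and r: "0 < r" "r \<le> 1" "\<bar>c$2\<bar> \<le> r\<^sup>2" "\<bar>2 * c$3 + c$1\<bar> \<le> r"
    and K: "K = 16 / q + 2" and x: "x \<in> {-1..1}"
  shows "P c x \<ge> - ((2 + 4 / q) * r\<^sup>2)"
    and "1 - x \<ge> K * r \<Longrightarrow> P c x > 0"
    and "1 - x \<ge> K * r \<Longrightarrow> dP c x < 0"
    and "1 - x \<le> K * r \<Longrightarrow> P c x \<le> (2 + 2 * K + q * K\<^sup>2) * r\<^sup>2"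
proof -
  define y where "y = 1 - x"
  define A where "A = - 2 * c$3"
  define d where "d = 2 * c$3 + c$1"
  have x_eq: "x = 1 - y" and y0: "y \<ge> 0" using x by (auto simp: y_def)
  have Pe: "P c x = 2 * c$2 + (d - c$2) * y + A / 2 * y\<^sup>2"
    unfolding P_def x_eq A_def d_def by (simp add: power2_eq_square algebra_simps)
  have dPe: "dP c x = - (d - c$2) - A * y"
    unfolding dP_def x_eq A_def d_def by (simp add: algebra_simps)
  have A: "q / 2 \<le> A" "A \<le> 2 * q" using q by (auto simp: A_def)
  have "r\<^sup>2 \<le> r" using r by (simp add: power2_eq_square mult_left_le)
  then have dc: "\<bar>d - c$2\<bar> \<le> 2 * r" using r(3,4) unfolding d_def by linarith
  have lin: "\<bar>(d - c$2) * y\<bar> \<le> 2 * r * y" unfolding abs_mult using dc y0 by (intro mult_mono) auto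
  have c2: "\<bar>2 * c$2\<bar> \<le> 2 * r\<^sup>2" using r by simp
  have quad: "q / 4 * y\<^sup>2 \<le> A / 2 * y\<^sup>2" using A by (intro mult_right_mono) auto
  have "q * p = 1 \<Longrightarrow> q / 4 * y\<^sup>2 - 2 * r * y + 4 * p * r\<^sup>2 = q / 4 * (y - 4 * r * p)\<^sup>2" for p
    by algebra
  from this[of "1 / q"] have "q / 4 * y\<^sup>2 - 2 * r * y + 4 / q * r\<^sup>2 = q / 4 * (y - 4 * r * (1 / q))\<^sup>2"
    using q by simp
  also have "\<dots> \<ge> 0" using q by simp
  finally have "q / 4 * y\<^sup>2 - 2 * r * y \<ge> - (4 / q * r\<^sup>2)" by simp
  then have "P c x \<ge> - (2 * r\<^sup>2) - 4 / q * r\<^sup>2" unfolding Pe using lin c2 quad by linarith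
  then show "P c x \<ge> - ((2 + 4 / q) * r\<^sup>2)" by (simp add: algebra_simps)
  have K2: "K > 2" using q by (simp add: K)
  have Ay: "A * y > 8 * r" and yr: "y > r" if "1 - x \<ge> K * r"
  proof -
    have y: "y \<ge> K * r" using that by (simp add: y_def)
    have "q / 2 * (K * r) \<le> A * y" using A y q K2 r by (intro mult_mono) auto
    moreover have "q * K = 16 + 2 * q" using q by (simp add: K distrib_left)
    then have "q / 2 * (K * r) = 8 * r + q * r" by algebra
    ultimately show "A * y > 8 * r" using q r mult_pos_pos[of q r] by linarith
    have "K * r > 1 * r" using K2 r by (intro mult_strict_right_mono) auto
    then show "y > r" using y by simp
  qed
  show "P c x > 0" if "1 - x \<ge> K * r"
  proof -
    have "8 * r * y \<le> A * y * y" using Ay[OF that] y0 by (intro mult_right_mono) auto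
    then have "4 * (r * y) \<le> A / 2 * y\<^sup>2" by (simp add: power2_eq_square)
    moreover have "r * y > r * r" using yr[OF that] r by simp
    ultimately show ?thesis unfolding Pe using lin c2 by (simp add: power2_eq_square)
  qed
  show "dP c x < 0" if "1 - x \<ge> K * r"
    using Ay[OF that] dc r unfolding dPe by linarith
  show "P c x \<le> (2 + 2 * K + q * K\<^sup>2) * r\<^sup>2" if "1 - x \<le> K * r"
  proof -
    have y: "y \<le> K * r" using that by (simp add: y_def)
    have "2 * r * y \<le> 2 * r * (K * r)" using y r by (intro mult_left_mono) auto
    moreover have "A / 2 * y\<^sup>2 \<le> q * (K * r)\<^sup>2" using A y y0 q by (intro mult_mono power_mono) auto
    ultimately have "P c x \<le> 2 * r\<^sup>2 + 2 * r * (K * r) + q * (K * r)\<^sup>2"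
      unfolding Pe using lin c2 by linarith
    then show ?thesis by (simp add: power2_eq_square algebra_simps)
  qed
qed

lemma degenerate_positive:
  assumes up: "upper_solution \<nu> c U" and \<nu>: "\<nu> > 0"
    and q: "q > 0" "q/2 \<le> - 2 * c$3" "- 2 * c$3 \<le> 2 * q"
    and r: "0 < r" "r \<le> 1" "\<bar>c$2\<bar> \<le> r\<^sup>2" "\<bar>2 * c$3 + c$1\<bar> \<le> r"
    and x: "-1 \<le> x" "1 - x \<ge> (16 / q + 2) * r"
  shows "U x > 0"
proof -
  have K: "(16 / q + 2) * r > 0" using q r by (intro mult_pos_pos add_pos_pos) auto
  show ?thesis
  proof (rule upper_solution_pos[OF up \<nu>, of x])
    show "P c y \<ge> 0" if "-1 < y" "y \<le> x" for y
      using P_near_degenerate(2)[OF q r refl, of y] that x K by force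
  qed (use x K in auto)
qed

text \<open>Where \<open>P' < 0\<close> and \<open>U > 0\<close>, the viscous term has the favourable sign at a maximum of \<open>P - U\<^sup>2/2\<close>.\<close>

lemma degenerate_defect:
  assumes up: "upper_solution \<nu> c U"
    and \<nu>: "\<nu> = e ^ 3" and e: "0 < e" "e \<le> 1/2" "e \<le> r" and M: "\<And>i. \<bar>c$i\<bar> \<le> M"
    and q: "q > 0" "q/2 \<le> - 2 * c$3" "- 2 * c$3 \<le> 2 * q"
    and r: "r \<le> 1" "\<bar>c$2\<bar> \<le> r\<^sup>2" "\<bar>2 * c$3 + c$1\<bar> \<le> r"
    and K: "K = 16 / q + 2" and x: "x \<in> {-1..1}"
  shows "\<bar>defect c U x\<bar> \<le> (2 * (2 + 4 / q) + 6 + 38 * M + 2 + 2 * K + q * K\<^sup>2) * r\<^sup>2"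
proof -
  have sol: "ode_solution \<nu> c U" and cont: "continuous_on {-1..1} U"
    using up by (auto simp: upper_solution_def)
  have M0: "0 \<le> M" using M[of 1] by linarith
  have \<nu>0: "\<nu> > 0" using \<nu> e by simp
  have r0: "0 < r" using e by simp
  note r' = r0 r
  have K0: "K > 0" using q by (simp add: K add_pos_pos)
  have \<nu>e: "\<nu> = e\<^sup>2 * e" using \<nu> by (simp add: power2_eq_square power3_eq_cube)
  have er: "e\<^sup>2 \<le> r\<^sup>2" using e by (intro power_mono) auto
  have "\<nu> \<le> e\<^sup>2" unfolding \<nu>e using e mult_left_le[of e "e\<^sup>2"] by simp
  then have \<nu>r: "\<nu> \<le> r\<^sup>2" using er by linarith
  define \<rho> where "\<rho> = (2 + 4 / q) * r\<^sup>2"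
  have "defect c U x \<le> 2 * \<rho> + (5 + 28 * M) * e\<^sup>2"
  proof (rule defect_upper[OF sol cont \<nu> e(1,2) M _ _ x])
    show "P c x \<ge> - \<rho>" if "x \<in> {-1..1}" for x
      using P_near_degenerate(1)[OF q r' refl that] by (simp add: \<rho>_def)
    show "\<rho> \<ge> 0" using q by (simp add: \<rho>_def)
  qed
  moreover have "(5 + 28 * M) * e\<^sup>2 \<le> (5 + 28 * M) * r\<^sup>2" using M0 er by (intro mult_left_mono) auto
  ultimately have upper: "defect c U x \<le> (2 * (2 + 4 / q) + 5 + 28 * M) * r\<^sup>2"
    by (simp add: \<rho>_def algebra_simps)
  define B where "B = (2 + 2 * K + q * K\<^sup>2) * r\<^sup>2"
  have B0: "B \<ge> 0" using q K0 by (simp add: B_def)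
  have "P c x - (1/2) * (U x)\<^sup>2 \<le> B + (1 + 10 * M) * r\<^sup>2"
  proof (cases "1 - x \<le> K * r")
    case True
    have "P c x \<le> B" using P_near_degenerate(4)[OF q r' K x True] by (simp add: B_def)
    moreover have "(1 + 10 * M) * r\<^sup>2 \<ge> 0" using M0 by simp
    ultimately show ?thesis using zero_le_power2[of "U x"] by linarith
  next
    case False
    define t where "t = 1 - K * r"
    have t1: "t < 1" using K0 r0 by (simp add: t_def)
    have X: "{-1..t} \<noteq> {}" "x \<in> {-1..t}" "{-1..t} \<subseteq> {-1..1}" using False x t1 by (auto simp: t_def)
    have "continuous_on {-1..t} (\<lambda>x. defect c U x)"
      using continuous_defect[OF cont] X(3) continuous_on_subset by blast
    from continuous_attains_inf[OF compact_Icc X(1) this]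
    obtain z where z: "z \<in> {-1..t}"
      and min: "\<forall>y\<in>{-1..t}. defect c U z \<le> defect c U y" by blast
    define F where "F = P c z - (1/2) * (U z)\<^sup>2"
    have z1: "z \<in> {-1..1}" using z t1 by auto
    have Pz: "P c z \<le> 5 * M" using abs_P_le[OF M, of z] z1 by (auto simp: abs_le_iff)
    have "F \<le> B + (1 + 10 * M) * r\<^sup>2"
    proof (cases "F \<le> 0 \<or> z = t")
      case True
      have "F \<le> P c z" by (simp add: F_def)
      moreover have "P c z \<le> B" if "z = t"
        using P_near_degenerate(4)[OF q r' K z1] that by (simp add: B_def t_def)
      ultimately have "F \<le> B" using True B0 by linarith
      moreover have "(1 + 10 * M) * r\<^sup>2 \<ge> 0" using M0 by simp
      ultimately show ?thesis by simp
    next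
      case False
      then have F: "F > 0" and zt: "z < t" using z by auto
      have Uz: "U z > 0" using degenerate_positive[OF up \<nu>0 q r', of z] z by (simp add: t_def K)
      have zm: "-1 < z"
      proof (rule ccontr)
        assume "\<not> -1 < z"
        then have "z = -1" using z by auto
        then have "F = - (2 * \<nu> * U z)" using value_at_left_end[OF sol cont \<nu>0] by (simp add: F_def)
        then show False using F mult_pos_pos[OF \<nu>0 Uz] by simp
      qed
      have z2: "z < 1" using zt t1 by simp
      define \<delta> where "\<delta> = min (z + 1) (t - z)"
      have d: "\<delta> > 0" using zm zt by (simp add: \<delta>_def)
      have "y \<in> {-1..t}" if "\<bar>z - y\<bar> < \<delta>" for y
        using that by (auto simp: \<delta>_def abs_if split: if_splits)
      then have "\<forall>y. \<bar>z - y\<bar> < \<delta> \<longrightarrow> defect c U z \<le> defect c U y"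
        using min by blast
      then have "defect c U z * U z = - \<nu> * ((1 - z\<^sup>2) * dP c z + 2 * z * (U z)\<^sup>2)"
        by (intro derivative_at_extremum[OF sol zm z2 d]) blast
      then have "F * U z = \<nu> * ((1 - z\<^sup>2) * dP c z + 2 * z * (U z)\<^sup>2)"
        by (simp add: F_def algebra_simps)
      also have "\<dots> \<le> \<nu> * (2 * (U z)\<^sup>2)"
      proof (intro mult_left_mono)
        have "dP c z < 0" using P_near_degenerate(3)[OF q r' K z1] zt by (simp add: t_def)
        then have "(1 - z\<^sup>2) * dP c z \<le> 0" using one_minus_square_pos[OF zm z2] by (simp add: mult_le_0_iff)
        moreover have "z * (U z)\<^sup>2 \<le> 1 * (U z)\<^sup>2" using z2 by (intro mult_right_mono) auto
        ultimately show "(1 - z\<^sup>2) * dP c z + 2 * z * (U z)\<^sup>2 \<le> 2 * (U z)\<^sup>2" by simp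
      qed (use \<nu>0 in simp)
      finally have "F * U z \<le> (\<nu> * (2 * U z)) * U z" by (simp add: power2_eq_square algebra_simps)
      then have "F \<le> \<nu> * (2 * U z)" using Uz by (simp add: mult_le_cancel_right_pos)
      also have "\<dots> \<le> r\<^sup>2 * (1 + 10 * M)"
      proof (rule mult_mono[OF \<nu>r])
        have "(U z)\<^sup>2 \<le> 10 * M" using F Pz by (simp add: F_def)
        moreover have "2 * U z \<le> 1 + (U z)\<^sup>2" using sum_squares_bound[of "U z" 1] by simp
        ultimately show "2 * U z \<le> 1 + 10 * M" by linarith
      qed (use Uz in auto)
      finally show ?thesis using B0 by (simp add: mult.commute)
    qed
    then show ?thesis using min X(2) F_def by fastforce
  qed
  then have lower: "P c x - (1/2) * (U x)\<^sup>2 \<le> (2 + 2 * K + q * K\<^sup>2 + 1 + 10 * M) * r\<^sup>2"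
    by (simp add: B_def algebra_simps)
  have nn: "0 \<le> (2 + 2 * K + q * K\<^sup>2 + 1 + 10 * M) * r\<^sup>2" "0 \<le> (2 * (2 + 4 / q) + 5 + 28 * M) * r\<^sup>2"
    using K0 q M0 by simp_all
  have "(2 * (2 + 4 / q) + 6 + 38 * M + 2 + 2 * K + q * K\<^sup>2) * r\<^sup>2 =
      (2 + 2 * K + q * K\<^sup>2 + 1 + 10 * M) * r\<^sup>2 + (2 * (2 + 4 / q) + 5 + 28 * M) * r\<^sup>2"
    by (simp add: algebra_simps)
  then show ?thesis using upper lower nn by linarith
qed

section \<open>Estimates in a neighbourhood of the limit parameters\<close>

lemma P_diff: "P c' x - P c x = P (c' - c) x"
  by (simp add: P_def algebra_simps)

lemma abs_P_diff_le:
  assumes "\<bar>x\<bar> \<le> 1"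
  shows "\<bar>P c' x - P c x\<bar> \<le> 5 * norm (c' - c)"
  unfolding P_diff by (rule abs_P_le[OF component_le_norm_cart assms])

lemma component_bound:
  fixes c c' :: "real^3"
  assumes "norm (c' - c) \<le> 1"
  shows "\<bar>c'$i\<bar> \<le> norm c + 1"
proof -
  have "\<bar>c'$i\<bar> \<le> norm c'" by (rule component_le_norm_cart)
  also have "\<dots> \<le> norm c + norm (c' - c)" using norm_triangle_ineq[of c "c' - c"] by simp
  finally show ?thesis using assms by simp
qed

text \<open>On the boundary \<open>c\<^sub>3 = c\<^sub>3\<^sup>*\<close> of \<open>J\<^sub>0\<close> the polynomial \<open>P\<close> is half the square of
  \<open>\<surd>c\<^sub>2 (1 + x) - \<surd>c\<^sub>1 (1 - x)\<close>.\<close>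

lemma P_square:
  assumes "c$1 \<ge> 0" "c$2 \<ge> 0"
  shows "P c x = (1/2) * (sqrt (c$2) * (1 + x) - sqrt (c$1) * (1 - x))\<^sup>2
    + (c$3 - c3_star (c$1) (c$2)) * (1 - x\<^sup>2)"
proof -
  define s1 s2 where "s1 = sqrt (c$1)" and "s2 = sqrt (c$2)"
  have c: "c$1 = s1\<^sup>2" "c$2 = s2\<^sup>2" using assms by (simp_all add: s1_def s2_def)
  have "c3_star (c$1) (c$2) = - (1/2) * (s1 + s2) * (s1 + s2)"
    unfolding c3_star_def c3_bar_def by (simp add: s1_def s2_def)
  moreover have "s1\<^sup>2 * (1 - x) + s2\<^sup>2 * (1 + x) + c$3 * (1 - x\<^sup>2) = (1/2) * (s2 * (1 + x) - s1 * (1 - x))\<^sup>2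
      + (c$3 - - (1/2) * (s1 + s2) * (s1 + s2)) * (1 - x\<^sup>2)"
    by (simp add: field_simps power2_eq_square)
  ultimately show ?thesis unfolding P_def s1_def[symmetric] s2_def[symmetric]
    by (simp only: c(1) c(2))
qed

lemma P_nonneg:
  assumes "c \<in> J 0" "x \<in> {-1..1}"
  shows "P c x \<ge> 0"
proof -
  have "c$1 \<ge> 0" "c$2 \<ge> 0" "c$3 \<ge> c3_star (c$1) (c$2)" using assms by (auto simp: J_def c3_star_def)
  moreover have "1 - x\<^sup>2 \<ge> 0" using assms(2) by (simp add: abs_square_le_1 abs_le_iff)
  ultimately show ?thesis using P_square[of c x] by simp
qed

text \<open>The sum of the constants in the upper and the lower bound for the defect.\<close>

definition defect_const :: "real \<Rightarrow> real" where
  "defect_const M = 6 + 42 * M + 2 * (3 + 14 * M)\<^sup>2"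

lemma nondegenerate_defect:
  assumes up: "upper_solution \<nu> c U" and J: "c \<in> J 0"
    and \<nu>: "\<nu> = e ^ 3" and e: "0 < e" "e \<le> 1/2" and M: "\<And>i. \<bar>c$i\<bar> \<le> M" and x: "x \<in> {-1..1}"
  shows "\<bar>defect c U x\<bar> \<le> defect_const M * e\<^sup>2"
proof -
  have sol: "ode_solution \<nu> c U" and cont: "continuous_on {-1..1} U"
    using up by (auto simp: upper_solution_def)
  have M0: "0 \<le> M" using M[of 1] by linarith
  have "defect c U x \<le> 2 * 0 + (5 + 28 * M) * e\<^sup>2"
    using P_nonneg[OF J] by (intro defect_upper[OF sol cont \<nu> e M _ _ x]) auto
  moreover have "P c x - (1/2) * (U x)\<^sup>2 \<le> (1 + 14 * M + 2 * (3 + 14 * M)\<^sup>2) * e\<^sup>2"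
    using P_nonneg[OF J] by (intro defect_lower[OF up \<nu> e M _ x]) auto
  moreover have "(5 + 28 * M) * e\<^sup>2 \<le> defect_const M * e\<^sup>2"
    "(1 + 14 * M + 2 * (3 + 14 * M)\<^sup>2) * e\<^sup>2 \<le> defect_const M * e\<^sup>2"
    using M0 by (intro mult_right_mono; simp add: defect_const_def)+
  ultimately show ?thesis by (simp add: abs_le_iff)
qed

text \<open>The scale \<open>e = \<nu>\<^sup>1\<^sup>/\<^sup>3\<close> replaces fractional powers of \<open>\<nu>\<close> by integral powers of \<open>e\<close>.\<close>

lemma cube_root_scale:
  fixes \<nu> :: real
  assumes "0 < \<nu>" "\<nu> \<le> 1/8"
  obtains e where "0 < e" "e \<le> 1/2" "\<nu> = e ^ 3" "\<nu> powr (2/3) = e\<^sup>2"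
proof
  show "0 < \<nu> powr (1/3)" using assms by simp
  have "\<nu> powr (1/3) \<le> (1/8) powr (1/3)" using assms by (intro powr_mono2) auto
  also have "(1/8::real) powr (1/3) = 1/2"
  proof -
    have "(1/8::real) powr (1/3) = ((1/2) powr 3) powr (1/3)" by (simp add: powr_numeral power3_eq_cube)
    then show ?thesis by (simp only: powr_powr) simp
  qed
  finally show "\<nu> powr (1/3) \<le> 1/2" .
  show "\<nu> = (\<nu> powr (1/3)) ^ 3" using assms by (simp add: powr_powr flip: powr_numeral)
  show "\<nu> powr (2/3) = (\<nu> powr (1/3))\<^sup>2" using assms by (simp add: powr_powr flip: powr_numeral)
qed

abbreviation (input) degenerate_rate :: "real^3 \<Rightarrow> real \<Rightarrow> real" where
  "degenerate_rate c \<nu> \<equiv> \<bar>c$2\<bar> + \<bar>2 * c$3 + c$1\<bar>\<^sup>2 + \<nu> powr (2/3)"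

text \<open>The natural length is \<open>r = \<surd>R\<close> with \<open>R\<close> the asserted order of the defect: it satisfies \<open>c\<^sub>2 = O(r\<^sup>2)\<close>,
  \<open>2 c\<^sub>3 + c\<^sub>1 = O(r)\<close> and \<open>\<nu>\<^sup>1\<^sup>/\<^sup>3 = O(r)\<close>. The sign of \<open>U\<close> is unknown only within distance \<open>O(r)\<close> of the endpoint,
  where the limit \<open>P c\<close> is \<open>O(r\<^sup>2)\<close>.\<close>

lemma degenerate_near:
  fixes c :: "real^3"
  assumes c: "c$1 > 0" "c$2 = 0" "c$3 = - (1/2) * c$1"
  obtains \<eta> C K where "\<eta> > 0" "C \<ge> 0"
    "\<And>\<nu> c' U x. upper_solution \<nu> c' U \<Longrightarrow> 0 < \<nu> \<Longrightarrow> \<nu> < \<eta> \<Longrightarrow> norm (c' - c) < \<eta> \<Longrightarrow> x \<in> {-1..1} \<Longrightarrow>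
      \<bar>defect c' U x\<bar> \<le> C * degenerate_rate c' \<nu>"
    "\<And>\<nu> c' U x. upper_solution \<nu> c' U \<Longrightarrow> 0 < \<nu> \<Longrightarrow> \<nu> < \<eta> \<Longrightarrow> norm (c' - c) < \<eta> \<Longrightarrow> x \<in> {-1..1} \<Longrightarrow>
      U x > 0 \<or> P c x \<le> K * degenerate_rate c' \<nu>" "K \<ge> 0"
proof -
  define q where "q = c$1"
  define M where "M = norm c + 1"
  define L where "L = 16 / q + 2"
  \<comment> \<open>\<open>1/8\<close> makes \<open>R \<le> 1\<close>, and \<open>q/4\<close> keeps \<open>-2 c\<^sub>3\<close> comparable to its limit \<open>q\<close>.\<close>
  define \<eta> where "\<eta> = min (1/8) (q/4)"
  define C where "C = 2 * (2 + 4 / q) + 6 + 38 * M + 2 + 2 * L + q * L\<^sup>2"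
  have q0: "q > 0" using c by (simp add: q_def)
  have L0: "L > 0" using q0 by (simp add: L_def add_pos_pos)
  have main: "\<bar>defect c' U x\<bar> \<le> C * R" "U x > 0 \<or> P c x \<le> (q/2 * L\<^sup>2) * R"
    if up: "upper_solution \<nu> c' U" and \<nu>: "0 < \<nu>" "\<nu> < \<eta>" and c': "norm (c' - c) < \<eta>"
      and x: "x \<in> {-1..1}" and R: "R = degenerate_rate c' \<nu>" for \<nu> c' U x R
  proof -
    have "\<nu> \<le> 1/8" using \<nu> by (simp add: \<eta>_def)
    then obtain e where e: "0 < e" "e \<le> 1/2" "\<nu> = e ^ 3" and e2: "\<nu> powr (2/3) = e\<^sup>2"
      using cube_root_scale[OF \<nu>(1)] by metis
    have comp: "\<bar>c'$i - c$i\<bar> < \<eta>" for i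
      using component_le_norm_cart[of "c' - c" i] c' by simp
    have M: "\<bar>c'$i\<bar> \<le> M" for i
      using component_bound[of c' c] c' by (simp add: M_def \<eta>_def)
    define r where "r = sqrt R"
    have R0: "R \<ge> 0" unfolding R by simp
    have r2: "r\<^sup>2 = R" using R0 by (simp add: r_def)
    have "e\<^sup>2 \<le> R" unfolding R e2 by simp
    then have er: "e \<le> r" using e by (simp add: r_def real_le_rsqrt)
    then have r0: "r > 0" using e by simp
    have qq: "q/2 \<le> - 2 * c'$3" "- 2 * c'$3 \<le> 2 * q"
    proof -
      have "\<bar>c'$3 - c$3\<bar> < q / 4" using comp[of 3] by (simp add: \<eta>_def)
      then show "q/2 \<le> - 2 * c'$3" "- 2 * c'$3 \<le> 2 * q" using c(3) q0 unfolding q_def by linarith+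
    qed
    have d: "\<bar>2 * c'$3 + c'$1\<bar> \<le> 1/2"
    proof -
      have "\<bar>c'$3 - c$3\<bar> < 1/8" "\<bar>c'$1 - c$1\<bar> < 1/8" using comp[of 3] comp[of 1] by (simp_all add: \<eta>_def)
      then show ?thesis using c(3) by linarith
    qed
    have "\<bar>2 * c'$3 + c'$1\<bar>\<^sup>2 \<le> (1/2)\<^sup>2" "e\<^sup>2 \<le> (1/2)\<^sup>2" using d e by (intro power_mono; simp)+
    moreover have "\<bar>c'$2\<bar> \<le> 1/8" using comp[of 2] c by (simp add: \<eta>_def)
    ultimately have "R \<le> 1" unfolding R e2 by (simp add: power2_eq_square)
    then have r1: "r \<le> 1" using R0 by (simp add: r_def)
    have c2: "\<bar>c'$2\<bar> \<le> r\<^sup>2" unfolding r2 R by simp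
    have "\<bar>2 * c'$3 + c'$1\<bar>\<^sup>2 \<le> R" unfolding R by simp
    then have dr: "\<bar>2 * c'$3 + c'$1\<bar> \<le> r" unfolding r_def by (rule real_le_rsqrt)
    show "\<bar>defect c' U x\<bar> \<le> C * R"
      using degenerate_defect[OF up e(3,1,2) er M q0 qq r1 c2 dr L_def x] by (simp add: C_def r2)
    show "U x > 0 \<or> P c x \<le> (q/2 * L\<^sup>2) * R"
    proof (cases "1 - x \<ge> L * r")
      case True
      then show ?thesis
        using degenerate_positive[OF up \<nu>(1) q0 qq r0 r1 c2 dr, of x] x by (simp add: L_def)
    next
      case False
      have "P c x = q/2 * (1 - x)\<^sup>2" using c by (simp add: P_def q_def power2_eq_square field_simps)
      also have "\<dots> \<le> q/2 * (L * r)\<^sup>2" using False x q0 by (intro mult_left_mono power_mono) auto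
      finally show ?thesis by (simp add: power_mult_distrib r2 mult.assoc)
    qed
  qed
  show ?thesis
  proof (rule that)
    show "\<eta> > 0" using q0 by (simp add: \<eta>_def)
    show "C \<ge> 0" using q0 L0 by (simp add: C_def M_def)
    show "q/2 * L\<^sup>2 \<ge> 0" using q0 by simp
  qed (use main in blast)+
qed

section \<open>Norm estimates\<close>

lemma Linf_norm_le:
  assumes "continuous_on {-1<..<1} f" "\<And>x. -1 < x \<Longrightarrow> x < 1 \<Longrightarrow> \<bar>f x\<bar> \<le> B"
  shows "Linf_norm {-1<..<1} f \<le> ennreal B"
  unfolding Linf_norm_def
proof (rule esssup_I)
  have "continuous_on {-1<..<1} (\<lambda>x. \<bar>f x\<bar>)" using assms(1) by (intro continuous_intros)
  then have "(\<lambda>x. \<bar>f x\<bar>) \<in> borel_measurable (lebesgue_on {-1<..<1})"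
    by (rule continuous_imp_measurable_on_sets_lebesgue) simp
  then show "(\<lambda>x. ennreal \<bar>f x\<bar>) \<in> borel_measurable (lebesgue_on {-1<..<1})" by measurable
  show "AE x in lebesgue_on {-1<..<1}. ennreal \<bar>f x\<bar> \<le> ennreal B"
    using assms(2) by (intro AE_I2 ennreal_leI) (auto simp: space_restrict_space)
qed

text \<open>Interpolation between the sup bound and the Lipschitz bound, split at distance \<open>h\<close>.\<close>

lemma holder_norm_le:
  assumes h: "0 < h" "h \<le> 1" and \<beta>: "0 < \<beta>" "\<beta> < 1" and B: "B \<ge> 0" and L: "L \<ge> 0"
    and fB: "\<And>x. x \<in> S \<Longrightarrow> \<bar>f x\<bar> \<le> B" and fL: "\<And>x y. x \<in> S \<Longrightarrow> y \<in> S \<Longrightarrow> \<bar>f x - f y\<bar> \<le> L * \<bar>x - y\<bar>"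
  shows "ennreal (h powr \<beta>) * holder_norm \<beta> S f \<le> ennreal (3 * B + L * h)"
proof -
  have quot: "\<bar>f x - f y\<bar> / \<bar>x - y\<bar> powr \<beta> \<le> (2 * B + L * h) / h powr \<beta>"
    if "x \<in> S" "y \<in> S" "x \<noteq> y" for x y
  proof -
    define d where "d = \<bar>x - y\<bar>"
    have d: "d > 0" using that by (simp add: d_def)
    show ?thesis
    proof (cases "d \<le> h")
      case True
      have "\<bar>f x - f y\<bar> / d powr \<beta> \<le> L * d / d powr \<beta>"
        using fL[OF that(1,2)] d by (intro divide_right_mono) (auto simp: d_def)
      also have "\<dots> = L * d powr (1 - \<beta>)" using d by (simp add: powr_diff)
      also have "\<dots> \<le> L * h powr (1 - \<beta>)" using True d \<beta> L by (intro mult_left_mono powr_mono2) auto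
      also have "\<dots> = L * h / h powr \<beta>" using h by (simp add: powr_diff)
      also have "\<dots> \<le> (2 * B + L * h) / h powr \<beta>" using B by (intro divide_right_mono) auto
      finally show ?thesis by (simp add: d_def)
    next
      case False
      have "\<bar>f x - f y\<bar> \<le> 2 * B" using fB[OF that(1)] fB[OF that(2)] by linarith
      also have "\<dots> \<le> 2 * B + L * h" using L h by simp
      finally have "\<bar>f x - f y\<bar> / d powr \<beta> \<le> (2 * B + L * h) / h powr \<beta>"
        using False h \<beta> by (intro frac_le powr_mono2) auto
      then show ?thesis by (simp add: d_def)
    qed
  qed
  have "sup_norm S f \<le> ennreal B"
    unfolding sup_norm_def using fB by (intro SUP_least ennreal_leI)
  moreover have "(SUP (x, y)\<in>{(x, y). x \<in> S \<and> y \<in> S \<and> x \<noteq> y}. ennreal (\<bar>f x - f y\<bar> / \<bar>x - y\<bar> powr \<beta>))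
      \<le> ennreal ((2 * B + L * h) / h powr \<beta>)"
    by (rule SUP_least) (auto intro!: ennreal_leI quot)
  ultimately have "holder_norm \<beta> S f \<le> ennreal B + ennreal ((2 * B + L * h) / h powr \<beta>)"
    unfolding holder_norm_def by (rule add_mono)
  also have "\<dots> = ennreal (B + (2 * B + L * h) / h powr \<beta>)" using B L h by simp
  finally have "ennreal (h powr \<beta>) * holder_norm \<beta> S f \<le> ennreal (h powr \<beta>) * \<dots>"
    by (rule mult_left_mono) simp
  also have "\<dots> = ennreal (h powr \<beta> * (B + (2 * B + L * h) / h powr \<beta>))"
    using B L h by (simp add: ennreal_mult')
  also have "h powr \<beta> * (B + (2 * B + L * h) / h powr \<beta>) = h powr \<beta> * B + (2 * B + L * h)"
    using h by (simp add: distrib_left[of "h powr \<beta>" B])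
  also have "ennreal \<dots> \<le> ennreal (3 * B + L * h)"
  proof (rule ennreal_leI)
    have "h powr \<beta> \<le> 1 powr \<beta>" using h \<beta> by (intro powr_mono2) auto
    then have "h powr \<beta> * B \<le> 1 * B" using B by (intro mult_right_mono) auto
    then show "h powr \<beta> * B + (2 * B + L * h) \<le> 3 * B + L * h" by simp
  qed
  finally show ?thesis .
qed

text \<open>Away from \<open>\<plusminus>1\<close> the equation bounds \<open>U'\<close> by the defect divided by \<open>\<nu>\<close>.\<close>

lemma defect_lipschitz:
  assumes sol: "ode_solution \<nu> c U" and \<nu>: "\<nu> = e ^ 3" and e: "0 < e" "e \<le> 1" and M: "\<And>i. \<bar>c$i\<bar> \<le> M"
    and B: "\<And>x. -1 < x \<Longrightarrow> x < 1 \<Longrightarrow> \<bar>defect c U x\<bar> \<le> B * e\<^sup>2" and \<epsilon>: "\<epsilon> > 0"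
    and xy: "x \<in> {-1+\<epsilon><..<1-\<epsilon>}" "y \<in> {-1+\<epsilon><..<1-\<epsilon>}" and N: "N = 1 + 5 * M + B"
  shows "\<bar>defect c U x - defect c U y\<bar> \<le> (N * (B + 2 * N) / \<epsilon> + 4 * M) / e * \<bar>x - y\<bar>"
proof -
  have M0: "0 \<le> M" using M[of 1] by linarith
  have e2: "0 < e\<^sup>2" "e\<^sup>2 \<le> 1" using e by (auto simp: power_le_one)
  have "0 \<le> B * e\<^sup>2" using B[of 0] by linarith
  then have B0: "B \<ge> 0" using e2 by (simp add: zero_le_mult_iff)
  have \<nu>0: "\<nu> > 0" using \<nu> e by simp
  have bound: "\<bar>U z * deriv U z - dP c z\<bar> \<le> (N * (B + 2 * N) / \<epsilon> + 4 * M) / e" if z: "z \<in> {-1+\<epsilon><..<1-\<epsilon>}" for z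
  proof -
    have z1: "-1 < z" "z < 1" using z \<epsilon> by auto
    have f: "\<bar>defect c U z\<bar> \<le> B * e\<^sup>2" by (rule B[OF z1])
    also have "B * e\<^sup>2 \<le> B" using e2 B0 by (simp add: mult_left_le)
    finally have "(U z)\<^sup>2 \<le> 2 * B + 10 * M" using abs_P_le[OF M, of z] z1 by (auto simp: abs_le_iff)
    moreover have "2 * \<bar>U z\<bar> \<le> 1 + (U z)\<^sup>2" using sum_squares_bound[of "\<bar>U z\<bar>" 1] by simp
    ultimately have UN: "\<bar>U z\<bar> \<le> N" by (simp add: N)
    have "\<bar>z\<bar> * \<bar>z\<bar> \<le> \<bar>z\<bar> * 1" using z1 by (intro mult_left_mono) auto
    then have "z\<^sup>2 \<le> \<bar>z\<bar>" by (simp add: power2_eq_square abs_mult_self_eq)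
    then have a: "\<epsilon> \<le> 1 - z\<^sup>2" using z by (auto simp: abs_if split: if_splits)
    have "\<nu> * (1 - z\<^sup>2) * deriv U z = - defect c U z - 2 * \<nu> * (z * U z)"
      using ode_solution_eq[OF sol z1] by simp
    also have "\<bar>\<dots>\<bar> \<le> B * e\<^sup>2 + 2 * \<nu> * N"
    proof -
      have "\<bar>z * U z\<bar> \<le> 1 * N" unfolding abs_mult using UN z1 by (intro mult_mono) auto
      then have "\<bar>2 * \<nu> * (z * U z)\<bar> \<le> 2 * \<nu> * N" using \<nu>0 by (simp add: abs_mult)
      then show ?thesis using f by linarith
    qed
    also have "2 * \<nu> * N \<le> e\<^sup>2 * (2 * N)"
    proof -
      have "\<nu> \<le> e\<^sup>2" using e unfolding \<nu> by (intro power_decreasing) auto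
      moreover have "0 \<le> 2 * N" using M0 B0 by (simp add: N)
      ultimately have "\<nu> * (2 * N) \<le> e\<^sup>2 * (2 * N)" by (rule mult_right_mono)
      then show ?thesis by (simp add: mult_ac)
    qed
    finally have 1: "\<bar>\<nu> * (1 - z\<^sup>2) * deriv U z\<bar> \<le> (B + 2 * N) * e\<^sup>2" by (simp add: algebra_simps)
    have "e ^ 3 * \<epsilon> * \<bar>deriv U z\<bar> \<le> \<nu> * (1 - z\<^sup>2) * \<bar>deriv U z\<bar>"
      unfolding \<nu> using a e by (intro mult_right_mono mult_left_mono) auto
    also have "\<dots> = \<bar>\<nu> * (1 - z\<^sup>2) * deriv U z\<bar>" using \<nu>0 a \<epsilon> by (simp add: abs_mult)
    finally have "e\<^sup>2 * (e * \<epsilon> * \<bar>deriv U z\<bar>) \<le> e\<^sup>2 * (B + 2 * N)"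
      using 1 by (simp add: power2_eq_square power3_eq_cube mult_ac)
    then have "e * \<epsilon> * \<bar>deriv U z\<bar> \<le> B + 2 * N" using e2 by (simp add: mult_le_cancel_left_pos)
    then have D: "\<bar>deriv U z\<bar> \<le> (B + 2 * N) / (e * \<epsilon>)" using e \<epsilon> by (simp add: pos_le_divide_eq mult.commute)
    have "\<bar>U z * deriv U z\<bar> \<le> N * ((B + 2 * N) / (e * \<epsilon>))"
      unfolding abs_mult using UN D by (intro mult_mono) auto
    moreover have "\<bar>dP c z\<bar> \<le> 4 * M" using abs_dP_le[OF M, of z] z1 by (simp add: abs_le_iff)
    moreover have "4 * M \<le> 4 * M / e" using e M0 by (simp add: pos_le_divide_eq mult_left_le)
    ultimately have "\<bar>U z * deriv U z - dP c z\<bar> \<le> N * ((B + 2 * N) / (e * \<epsilon>)) + 4 * M / e" by linarith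
    also have "\<dots> = (N * (B + 2 * N) / \<epsilon> + 4 * M) / e" by (simp add: add_divide_distrib[of _ _ e] mult.commute)
    finally show ?thesis .
  qed
  have "norm (defect c U x - defect c U y) \<le> (N * (B + 2 * N) / \<epsilon> + 4 * M) / e * norm (x - y)"
  proof (rule field_differentiable_bound[where f' = "\<lambda>z. U z * deriv U z - dP c z" and S = "{-1+\<epsilon><..<1-\<epsilon>}"])
    fix z assume z: "z \<in> {-1+\<epsilon><..<1-\<epsilon>}"
    have "((\<lambda>x. defect c U x) has_real_derivative U z * deriv U z - dP c z) (at z)"
      using ode_solution_deriv[OF sol, of z] z \<epsilon> by (auto intro!: derivative_eq_intros P_has_derivative)
    then show "((\<lambda>x. defect c U x) has_real_derivative U z * deriv U z - dP c z) (at z within {-1+\<epsilon><..<1-\<epsilon>})"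
      by (rule has_field_derivative_at_within)
  qed (use bound xy in auto)
  then show ?thesis by simp
qed

text \<open>A bound on the defect determines \<open>U\<close> up to sign. Where the sign is not known, \<open>P\<close> has to be small.\<close>

lemma sqrt_close:
  fixes u p \<eta> \<kappa> :: real
  assumes "\<bar>(1/2) * u\<^sup>2 - p\<bar> \<le> \<eta>" "p \<ge> 0" "u \<ge> 0 \<or> p \<le> \<kappa>" "\<kappa> \<ge> 0"
  shows "\<bar>u - sqrt (2 * p)\<bar> \<le> 2 * sqrt (2 * (\<kappa> + \<eta>))"
proof (cases "u \<ge> 0")
  case True
  define s where "s = sqrt (2 * p)"
  have s: "s \<ge> 0" "s\<^sup>2 = 2 * p" using assms(2) by (simp_all add: s_def)
  have "\<bar>u - s\<bar>\<^sup>2 \<le> \<bar>u - s\<bar> * \<bar>u + s\<bar>"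
    unfolding power2_eq_square using True s by (intro mult_left_mono) auto
  also have "\<dots> = \<bar>u\<^sup>2 - s\<^sup>2\<bar>" by (simp add: power2_eq_square algebra_simps flip: abs_mult)
  also have "\<dots> \<le> 2 * (\<kappa> + \<eta>)" using assms(1,4) unfolding s by (simp add: abs_le_iff)
  finally have "\<bar>u - s\<bar> \<le> sqrt (2 * (\<kappa> + \<eta>))" by (rule real_le_rsqrt)
  moreover have "0 \<le> sqrt (2 * (\<kappa> + \<eta>))" using assms(1,4) by simp
  ultimately show ?thesis unfolding s_def by linarith
next
  case False
  have "\<bar>u\<bar> = sqrt (u\<^sup>2)" by simp
  also have "\<dots> \<le> sqrt (2 * (\<kappa> + \<eta>))" using assms False by (intro real_sqrt_le_mono) (simp add: abs_le_iff)
  finally have "\<bar>u\<bar> \<le> sqrt (2 * (\<kappa> + \<eta>))" .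
  moreover have "sqrt (2 * p) \<le> sqrt (2 * (\<kappa> + \<eta>))" using assms False by (intro real_sqrt_le_mono) auto
  moreover have "sqrt (2 * p) \<ge> 0" using assms(2) by simp
  ultimately show ?thesis by linarith
qed

lemma Linf_norm_tendsto_0:
  assumes "\<And>k. continuous_on {-1<..<1} (f k)"
    and "\<forall>\<^sub>F k in sequentially. \<forall>x. -1 < x \<longrightarrow> x < 1 \<longrightarrow> \<bar>f k x\<bar> \<le> B k" and "B \<longlonglongrightarrow> 0"
  shows "(\<lambda>k. Linf_norm {-1<..<1} (f k)) \<longlonglongrightarrow> 0"
proof (rule tendsto_sandwich[where f = "\<lambda>_. 0" and h = "\<lambda>k. ennreal (B k)"])
  show "\<forall>\<^sub>F k in sequentially. Linf_norm {-1<..<1} (f k) \<le> ennreal (B k)"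
    using assms(2) by eventually_elim (auto intro!: Linf_norm_le assms(1))
  show "(\<lambda>k. ennreal (B k)) \<longlonglongrightarrow> 0" using tendsto_ennrealI[OF assms(3)] by simp
qed auto

section \<open>Families with uniformly bounded derivatives\<close>

text \<open>This is boundedness of a family in \<open>C\<^sup>n\<close>. The recursion on \<open>n\<close> makes its closure under products,
  inverses and square roots a plain induction, without Leibniz' formula.\<close>

primrec unif_bounded :: "nat \<Rightarrow> 'k set \<Rightarrow> real set \<Rightarrow> ('k \<Rightarrow> real \<Rightarrow> real) \<Rightarrow> bool" where
  "unif_bounded 0 K I f = (\<exists>M. \<forall>k\<in>K. \<forall>x\<in>I. \<bar>f k x\<bar> \<le> M)"
| "unif_bounded (Suc n) K I f = ((\<exists>M. \<forall>k\<in>K. \<forall>x\<in>I. \<bar>f k x\<bar> \<le> M) \<and>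
     (\<exists>f'. (\<forall>k\<in>K. \<forall>x\<in>I. (f k has_real_derivative f' k x) (at x)) \<and> unif_bounded n K I f'))"

lemma unif_bounded_bound:
  assumes "unif_bounded n K I f"
  obtains M where "\<forall>k\<in>K. \<forall>x\<in>I. \<bar>f k x\<bar> \<le> M" "M \<ge> 0"
proof -
  obtain M where "\<forall>k\<in>K. \<forall>x\<in>I. \<bar>f k x\<bar> \<le> M" using assms by (cases n) auto
  then have "\<forall>k\<in>K. \<forall>x\<in>I. \<bar>f k x\<bar> \<le> max M 0" by (simp add: le_max_iff_disj)
  then show ?thesis using that[of "max M 0"] by simp
qed

lemma unif_bounded_0I:
  assumes "\<And>k x. k \<in> K \<Longrightarrow> x \<in> I \<Longrightarrow> \<bar>f k x\<bar> \<le> M"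
  shows "unif_bounded 0 K I f"
  using assms by (simp only: unif_bounded.simps) blast

lemma unif_bounded_SucI:
  assumes "unif_bounded 0 K I f"
    and "\<And>k x. k \<in> K \<Longrightarrow> x \<in> I \<Longrightarrow> (f k has_real_derivative f' k x) (at x)" and "unif_bounded n K I f'"
  shows "unif_bounded (Suc n) K I f"
  using assms by auto

lemma unif_bounded_SucE:
  assumes "unif_bounded (Suc n) K I f"
  obtains f' where "\<forall>k\<in>K. \<forall>x\<in>I. (f k has_real_derivative f' k x) (at x)" "unif_bounded n K I f'"
  using assms by auto

lemma unif_bounded_0: "unif_bounded n K I f \<Longrightarrow> unif_bounded 0 K I f"
  by (cases n) auto

lemma unif_bounded_pred: "unif_bounded (Suc n) K I f \<Longrightarrow> unif_bounded n K I f"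
proof (induction n arbitrary: f)
  case (Suc n)
  obtain f' where f': "\<forall>k\<in>K. \<forall>x\<in>I. (f k has_real_derivative f' k x) (at x)" "unif_bounded (Suc n) K I f'"
    using unif_bounded_SucE[OF Suc.prems] by metis
  note f' = f'(1)[rule_format] f'(2)
  show ?case
    by (rule unif_bounded_SucI[OF unif_bounded_0[OF Suc.prems] f'(1) Suc.IH[OF f'(2)]])
qed auto

lemma unif_bounded_subset:
  assumes "unif_bounded n K I f" "I' \<subseteq> I"
  shows "unif_bounded n K I' f"
  using assms
proof (induction n arbitrary: f)
  case 0
  obtain M where "\<forall>k\<in>K. \<forall>x\<in>I. \<bar>f k x\<bar> \<le> M" by (rule unif_bounded_bound[OF 0(1)])
  then show ?case using 0(2) by (intro unif_bounded_0I) blast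
next
  case (Suc n)
  obtain f' where f': "\<forall>k\<in>K. \<forall>x\<in>I. (f k has_real_derivative f' k x) (at x)" "unif_bounded n K I f'"
    using unif_bounded_SucE[OF Suc.prems(1)] by metis
  note f' = f'(1)[rule_format] f'(2)
  obtain M where "\<forall>k\<in>K. \<forall>x\<in>I. \<bar>f k x\<bar> \<le> M" by (rule unif_bounded_bound[OF Suc.prems(1)])
  then have "unif_bounded 0 K I' f" using Suc.prems(2) by (intro unif_bounded_0I) blast
  then show ?case
    using Suc.prems(2) f'(1) by (intro unif_bounded_SucI[OF _ _ Suc.IH[OF f'(2) Suc.prems(2)]]) auto
qed

lemma unif_bounded_cong:
  assumes "unif_bounded n K I f" "open I" "\<And>k x. k \<in> K \<Longrightarrow> x \<in> I \<Longrightarrow> f k x = g k x"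
  shows "unif_bounded n K I g"
proof (cases n)
  case 0
  then show ?thesis using assms by auto
next
  case (Suc m)
  obtain f' where f': "\<forall>k\<in>K. \<forall>x\<in>I. (f k has_real_derivative f' k x) (at x)" "unif_bounded m K I f'"
    using unif_bounded_SucE[OF assms(1)[unfolded Suc]] by metis
  note f' = f'(1)[rule_format] f'(2)
  have "unif_bounded 0 K I g" using unif_bounded_0[OF assms(1)] assms(3) by auto
  moreover have "(g k has_real_derivative f' k x) (at x)" if "k \<in> K" "x \<in> I" for k x
    using f'(1)[OF that] assms(2) that(2) by (rule has_field_derivative_transform_within_open) (use assms(3) that in auto)
  ultimately show ?thesis unfolding Suc using f'(2) by (intro unif_bounded_SucI)
qed

lemma unif_bounded_const:
  assumes "\<And>k. k \<in> K \<Longrightarrow> \<bar>a k\<bar> \<le> M"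
  shows "unif_bounded n K I (\<lambda>k x. a k)"
proof -
  have z: "unif_bounded n K I (\<lambda>k x. 0)" for n
  proof (induction n)
    case (Suc n)
    then show ?case by (intro unif_bounded_SucI[where f' = "\<lambda>k x. 0"]) auto
  qed auto
  show ?thesis
  proof (cases n)
    case (Suc m)
    show ?thesis unfolding Suc
      using assms by (intro unif_bounded_SucI[where f' = "\<lambda>k x. 0"] z) auto
  qed (use assms in auto)
qed

lemma unif_bounded_ident:
  assumes "I \<subseteq> {-1..1}"
  shows "unif_bounded n K I (\<lambda>k x. x)"
proof -
  have 0: "unif_bounded 0 K I (\<lambda>k x. x)"
    using assms by (intro unif_bounded_0I[of _ _ _ 1]) (force simp: abs_le_iff)
  show ?thesis
  proof (cases n)
    case (Suc m)
    have "unif_bounded m K I (\<lambda>k x. 1)" by (rule unif_bounded_const[where M = 1]) simp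
    then show ?thesis unfolding Suc
      by (intro unif_bounded_SucI[where f' = "\<lambda>k x. 1"] 0) auto
  qed (use 0 in simp)
qed

lemma unif_bounded_add:
  assumes "unif_bounded n K I f" "unif_bounded n K I g"
  shows "unif_bounded n K I (\<lambda>k x. f k x + g k x)"
  using assms
proof (induction n arbitrary: f g)
  case 0
  obtain M where M: "\<forall>k\<in>K. \<forall>x\<in>I. \<bar>f k x\<bar> \<le> M" by (rule unif_bounded_bound[OF 0(1)])
  obtain N where N: "\<forall>k\<in>K. \<forall>x\<in>I. \<bar>g k x\<bar> \<le> N" by (rule unif_bounded_bound[OF 0(2)])
  show ?case
    by (rule unif_bounded_0I[of _ _ _ "M + N"])
       (intro order_trans[OF abs_triangle_ineq] add_mono M[rule_format] N[rule_format])
next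
  case (Suc n)
  obtain f' where f': "\<forall>k\<in>K. \<forall>x\<in>I. (f k has_real_derivative f' k x) (at x)" "unif_bounded n K I f'"
    using unif_bounded_SucE[OF Suc.prems(1)] by metis
  note f' = f'(1)[rule_format] f'(2)
  obtain g' where g': "\<forall>k\<in>K. \<forall>x\<in>I. (g k has_real_derivative g' k x) (at x)" "unif_bounded n K I g'"
    using unif_bounded_SucE[OF Suc.prems(2)] by metis
  note g' = g'(1)[rule_format] g'(2)
  have "unif_bounded 0 K I (\<lambda>k x. f k x + g k x)"
    using Suc.IH[OF Suc.prems[THEN unif_bounded_pred]] by (rule unif_bounded_0)
  then show ?case
    using f'(1) g'(1) Suc.IH[OF f'(2) g'(2)]
    by (intro unif_bounded_SucI[where f' = "\<lambda>k x. f' k x + g' k x"] DERIV_add)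
qed

lemma unif_bounded_mult:
  assumes "unif_bounded n K I f" "unif_bounded n K I g"
  shows "unif_bounded n K I (\<lambda>k x. f k x * g k x)"
  using assms
proof (induction n arbitrary: f g)
  case 0
  obtain M where M: "\<forall>k\<in>K. \<forall>x\<in>I. \<bar>f k x\<bar> \<le> M" "M \<ge> 0" by (rule unif_bounded_bound[OF 0(1)])
  note M = M(1)[rule_format] M(2)
  obtain N where N: "\<forall>k\<in>K. \<forall>x\<in>I. \<bar>g k x\<bar> \<le> N" "N \<ge> 0" by (rule unif_bounded_bound[OF 0(2)])
  note N = N(1)[rule_format] N(2)
  show ?case
    by (rule unif_bounded_0I[of _ _ _ "M * N"]) (auto simp: abs_mult intro!: mult_mono M N)
next
  case (Suc n)
  obtain f' where f': "\<forall>k\<in>K. \<forall>x\<in>I. (f k has_real_derivative f' k x) (at x)" "unif_bounded n K I f'"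
    using unif_bounded_SucE[OF Suc.prems(1)] by metis
  note f' = f'(1)[rule_format] f'(2)
  obtain g' where g': "\<forall>k\<in>K. \<forall>x\<in>I. (g k has_real_derivative g' k x) (at x)" "unif_bounded n K I g'"
    using unif_bounded_SucE[OF Suc.prems(2)] by metis
  note g' = g'(1)[rule_format] g'(2)
  note pred = Suc.prems[THEN unif_bounded_pred]
  have "unif_bounded 0 K I (\<lambda>k x. f k x * g k x)" using Suc.IH[OF pred] by (rule unif_bounded_0)
  moreover have "unif_bounded n K I (\<lambda>k x. f' k x * g k x + g' k x * f k x)"
    by (intro unif_bounded_add Suc.IH pred f' g')
  ultimately show ?case
    using f'(1) g'(1) by (intro unif_bounded_SucI[where f' = "\<lambda>k x. f' k x * g k x + g' k x * f k x"] DERIV_mult)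
qed

lemma unif_bounded_cmult:
  assumes "unif_bounded n K I f"
  shows "unif_bounded n K I (\<lambda>k x. a * f k x)"
  by (intro unif_bounded_mult unif_bounded_const[where M = "\<bar>a\<bar>"] assms) simp

lemma unif_bounded_minus:
  assumes "unif_bounded n K I f"
  shows "unif_bounded n K I (\<lambda>k x. - f k x)"
  using unif_bounded_cmult[OF assms, of "-1"] by simp

lemma unif_bounded_diff:
  assumes "unif_bounded n K I f" "unif_bounded n K I g"
  shows "unif_bounded n K I (\<lambda>k x. f k x - g k x)"
  using unif_bounded_add[OF assms(1) unif_bounded_minus[OF assms(2)]] by simp

lemma unif_bounded_inverse:
  assumes "unif_bounded n K I f" "\<delta> > 0" "\<And>k x. k \<in> K \<Longrightarrow> x \<in> I \<Longrightarrow> f k x \<ge> \<delta>"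
  shows "unif_bounded n K I (\<lambda>k x. inverse (f k x))"
  using assms(1)
proof (induction n)
  case 0
  have "\<bar>inverse (f k x)\<bar> \<le> inverse \<delta>" if "k \<in> K" "x \<in> I" for k x
    using assms(3)[OF that] assms(2) by (simp add: le_imp_inverse_le)
  then show ?case by (rule unif_bounded_0I)
next
  case (Suc n)
  obtain f' where f': "\<forall>k\<in>K. \<forall>x\<in>I. (f k has_real_derivative f' k x) (at x)" "unif_bounded n K I f'"
    using unif_bounded_SucE[OF Suc.prems(1)] by metis
  note f' = f'(1)[rule_format] f'(2)
  note IH = Suc.IH[OF unif_bounded_pred[OF Suc.prems]]
  have "unif_bounded n K I (\<lambda>k x. - (inverse (f k x) * f' k x * inverse (f k x)))"
    by (intro unif_bounded_minus unif_bounded_mult IH f')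
  moreover have "((\<lambda>x. inverse (f k x)) has_real_derivative - (inverse (f k x) * f' k x * inverse (f k x))) (at x)"
    if "k \<in> K" "x \<in> I" for k x
    using assms(3)[OF that] assms(2) by (intro DERIV_inverse' f' that) auto
  ultimately show ?case by (intro unif_bounded_SucI[OF unif_bounded_0[OF IH]])
qed

lemma unif_bounded_sqrt:
  assumes "unif_bounded n K I f" "\<delta> > 0" "\<And>k x. k \<in> K \<Longrightarrow> x \<in> I \<Longrightarrow> f k x \<ge> \<delta>"
  shows "unif_bounded n K I (\<lambda>k x. sqrt (f k x))"
  using assms(1)
proof (induction n)
  case 0
  obtain M where M: "\<forall>k\<in>K. \<forall>x\<in>I. \<bar>f k x\<bar> \<le> M" "M \<ge> 0" by (rule unif_bounded_bound[OF 0(1)])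
  note M = M(1)[rule_format] M(2)
  have "\<bar>sqrt (f k x)\<bar> \<le> sqrt M" if "k \<in> K" "x \<in> I" for k x
    using M(1)[OF that] assms(3)[OF that] assms(2) by simp
  then show ?case by (rule unif_bounded_0I)
next
  case (Suc n)
  obtain f' where f': "\<forall>k\<in>K. \<forall>x\<in>I. (f k has_real_derivative f' k x) (at x)" "unif_bounded n K I f'"
    using unif_bounded_SucE[OF Suc.prems(1)] by metis
  note f' = f'(1)[rule_format] f'(2)
  note IH = Suc.IH[OF unif_bounded_pred[OF Suc.prems]]
  have "unif_bounded n K I (\<lambda>k x. inverse (sqrt (f k x)))"
    using assms(2,3) by (intro unif_bounded_inverse[OF IH, of "sqrt \<delta>"]) auto
  then have "unif_bounded n K I (\<lambda>k x. 1/2 * inverse (sqrt (f k x)) * f' k x)"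
    by (intro unif_bounded_mult[OF unif_bounded_cmult f'(2)])
  moreover have "((\<lambda>x. sqrt (f k x)) has_real_derivative 1/2 * inverse (sqrt (f k x)) * f' k x) (at x)"
    if "k \<in> K" "x \<in> I" for k x
    using DERIV_chain2[OF DERIV_real_sqrt f'(1)[OF that]] assms(3)[OF that] assms(2) by simp
  ultimately show ?case by (intro unif_bounded_SucI[OF unif_bounded_0[OF IH]])
qed

lemma unif_bounded_derivatives:
  assumes "unif_bounded n K I f"
  obtains D B where "D 0 = f"
    "\<forall>i k x. i < n \<longrightarrow> k \<in> K \<longrightarrow> x \<in> I \<longrightarrow> (D i k has_real_derivative D (Suc i) k x) (at x)"
    "\<forall>i k x. i \<le> n \<longrightarrow> k \<in> K \<longrightarrow> x \<in> I \<longrightarrow> \<bar>D i k x\<bar> \<le> B"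
proof -
  have "\<exists>D B. D 0 = f \<and> (\<forall>i k x. i < n \<longrightarrow> k \<in> K \<longrightarrow> x \<in> I \<longrightarrow> (D i k has_real_derivative D (Suc i) k x) (at x)) \<and>
    (\<forall>i k x. i \<le> n \<longrightarrow> k \<in> K \<longrightarrow> x \<in> I \<longrightarrow> \<bar>D i k x\<bar> \<le> B)"
    using assms
  proof (induction n arbitrary: f)
    case 0
    then obtain M where "\<forall>k\<in>K. \<forall>x\<in>I. \<bar>f k x\<bar> \<le> M" by auto
    then show ?case by (intro exI[of _ "\<lambda>_. f"] exI[of _ M]) auto
  next
    case (Suc n)
    obtain M where M: "\<forall>k\<in>K. \<forall>x\<in>I. \<bar>f k x\<bar> \<le> M" by (rule unif_bounded_bound[OF Suc.prems])
    obtain f' where f': "\<forall>k\<in>K. \<forall>x\<in>I. (f k has_real_derivative f' k x) (at x)" "unif_bounded n K I f'"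
      using unif_bounded_SucE[OF Suc.prems(1)] by metis
    obtain D B where D: "D 0 = f'"
      "\<forall>i k x. i < n \<longrightarrow> k \<in> K \<longrightarrow> x \<in> I \<longrightarrow> (D i k has_real_derivative D (Suc i) k x) (at x)"
      "\<forall>i k x. i \<le> n \<longrightarrow> k \<in> K \<longrightarrow> x \<in> I \<longrightarrow> \<bar>D i k x\<bar> \<le> B"
      using Suc.IH[OF f'(2)] by metis
    define E where "E i = (case i of 0 \<Rightarrow> f | Suc j \<Rightarrow> D j)" for i
    have "(E i k has_real_derivative E (Suc i) k x) (at x)" if i: "i < Suc n" "k \<in> K" "x \<in> I" for i k x
    proof (cases i)
      case 0
      then show ?thesis using f'(1)[rule_format, OF i(2,3)] by (simp add: E_def D(1))
    next
      case (Suc j)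
      then show ?thesis using D(2)[rule_format, of j, OF _ i(2,3)] i(1) by (simp add: E_def)
    qed
    moreover have "\<bar>E i k x\<bar> \<le> max M B" if i: "i \<le> Suc n" "k \<in> K" "x \<in> I" for i k x
    proof (cases i)
      case 0
      then show ?thesis using M[rule_format, OF i(2,3)] by (simp add: E_def le_max_iff_disj)
    next
      case (Suc j)
      then show ?thesis using D(3)[rule_format, of j, OF _ i(2,3)] i(1) by (simp add: E_def le_max_iff_disj)
    qed
    moreover have "E 0 = f" by (simp add: E_def)
    ultimately show ?case by blast
  qed
  then show ?thesis using that by blast
qed

section \<open>Linear equations with a small parameter\<close>

text \<open>The bounds propagate from \<open>p\<close> to the right with an arbitrarily small loss. At the singular point
  \<open>-1\<close> there is no loss, as the integrating factor vanishes there.\<close>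

definition starts_before :: "real \<Rightarrow> real \<Rightarrow> bool" where
  "starts_before p p' \<longleftrightarrow> p < p' \<or> p = -1 \<and> p' = -1"

lemma starts_before_le: "starts_before p p' \<Longrightarrow> p \<le> p'"
  by (auto simp: starts_before_def)

lemma starts_before_dense:
  assumes "starts_before p p'"
  obtains p'' where "starts_before p p''" "starts_before p'' p'"
  using assms dense unfolding starts_before_def by metis

text \<open>By Young's inequality \<open>Q = Y\<^sup>2\<close> satisfies \<open>\<nu> (1 - x\<^sup>2) Q' + h\<^sub>0 Q \<le> M\<^sup>2/h\<^sub>0\<close>, whose integrating factor is a
  power of \<open>(1 + x)/(1 - x)\<close>.\<close>

lemma linear_decay:
  assumes st: "-1 < s" "s \<le> t" "t < 1" and \<nu>: "0 < \<nu>" and h0: "0 < h0"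
    and Y: "\<And>x. s \<le> x \<Longrightarrow> x \<le> t \<Longrightarrow> (Y has_real_derivative Y' x) (at x)"
    and eq: "\<And>x. s \<le> x \<Longrightarrow> x \<le> t \<Longrightarrow> \<nu> * (1 - x\<^sup>2) * Y' x + H x * Y x = F x"
    and H: "\<And>x. s \<le> x \<Longrightarrow> x \<le> t \<Longrightarrow> H x \<ge> h0" and F: "\<And>x. s \<le> x \<Longrightarrow> x \<le> t \<Longrightarrow> \<bar>F x\<bar> \<le> M"
  shows "(Y t)\<^sup>2 \<le> (M / h0)\<^sup>2 + (Y s)\<^sup>2 * exp (h0 / (2 * \<nu>) * ((ln (1 + s) - ln (1 - s)) - (ln (1 + t) - ln (1 - t))))"
proof -
  define w where "w = h0 / (2 * \<nu>)"
  define l where "l x = ln (1 + x) - ln (1 - x)" for x :: real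
  define Z where "Z x = ((Y x)\<^sup>2 - (M / h0)\<^sup>2) * exp (w * l x)" for x
  have "Z t \<le> Z s"
  proof (rule DERIV_nonpos_imp_nonincreasing[OF st(2), where f = Z])
    fix x assume x: "s \<le> x" "x \<le> t"
    then have x1: "-1 < x" "x < 1" using st by auto
    define a where "a = 1 - x\<^sup>2"
    have a: "a > 0" using one_minus_square_pos[OF x1] by (simp add: a_def)
    have "1 / (1 + x) + 1 / (1 - x) = 2 / ((1 + x) * (1 - x))"
      using x1 by (simp add: add_divide_eq_iff divide_add_eq_iff field_simps)
    also have "(1 + x) * (1 - x) = a" by (simp add: a_def power2_eq_square algebra_simps)
    finally have l': "1 / (1 + x) + 1 / (1 - x) = 2 / a" .
    have "(l has_real_derivative 1 / (1 + x) + 1 / (1 - x)) (at x)"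
      unfolding l_def using x1 by (auto intro!: derivative_eq_intros)
    then have dl: "(l has_real_derivative 2 / a) (at x)" by (simp only: l')
    define z where "z = 2 * Y x * Y' x + ((Y x)\<^sup>2 - (M / h0)\<^sup>2) * (w * (2 / a))"
    have "(Z has_real_derivative z * exp (w * l x)) (at x)"
      unfolding Z_def z_def using Y[OF x] dl
      by (auto intro!: derivative_eq_intros simp: algebra_simps)
    moreover have "z \<le> 0"
    proof -
      have wa: "\<nu> * a * (w * (2 / a)) = h0" using \<nu> a by (simp add: w_def)
      have "\<nu> * a * z = 2 * Y x * (\<nu> * a * Y' x) + ((Y x)\<^sup>2 - (M / h0)\<^sup>2) * (\<nu> * a * (w * (2 / a)))"
        by (simp add: z_def algebra_simps)
      also have "\<dots> = 2 * Y x * F x - 2 * H x * (Y x)\<^sup>2 + ((Y x)\<^sup>2 - (M / h0)\<^sup>2) * h0"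
      proof -
        have e: "\<nu> * a * Y' x = F x - H x * Y x" using eq[OF x] by (simp add: a_def)
        show ?thesis unfolding wa e by (simp add: power2_eq_square algebra_simps)
      qed
      also have "\<dots> \<le> 0"
      proof -
        have "h0 * (Y x)\<^sup>2 \<le> H x * (Y x)\<^sup>2" using H[OF x] by (intro mult_right_mono) auto
        moreover have "Y x * F x \<le> \<bar>Y x\<bar> * M"
        proof -
          have "Y x * F x \<le> \<bar>Y x\<bar> * \<bar>F x\<bar>" using abs_ge_self[of "Y x * F x"] by (simp add: abs_mult)
          also have "\<dots> \<le> \<bar>Y x\<bar> * M" using F[OF x] by (intro mult_left_mono) auto
          finally show ?thesis .
        qed
        moreover have "2 * (\<bar>Y x\<bar> * M) \<le> h0 * (Y x)\<^sup>2 + (M / h0)\<^sup>2 * h0"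
        proof -
          define m where "m = M / h0"
          have M: "M = m * h0" using h0 by (simp add: m_def)
          have "0 \<le> h0 * (\<bar>Y x\<bar> - m)\<^sup>2" using h0 by simp
          also have "\<dots> = h0 * \<bar>Y x\<bar>\<^sup>2 + m\<^sup>2 * h0 - 2 * (\<bar>Y x\<bar> * (m * h0))"
            by (simp only: power2_diff) (simp add: algebra_simps)
          finally show ?thesis by (simp only: M[symmetric] m_def[symmetric] power2_abs diff_ge_0_iff_ge)
        qed
        moreover have "2 * Y x * F x - 2 * H x * (Y x)\<^sup>2 + ((Y x)\<^sup>2 - (M / h0)\<^sup>2) * h0
            = 2 * (Y x * F x) - 2 * (H x * (Y x)\<^sup>2) + (h0 * (Y x)\<^sup>2 - (M / h0)\<^sup>2 * h0)"
          by (simp only: left_diff_distrib mult.assoc mult.commute[of "(Y x)\<^sup>2" h0])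
        ultimately show ?thesis by linarith
      qed
      finally have "\<nu> * a * z \<le> 0" .
      moreover have "\<nu> * a > 0" using \<nu> a by simp
      ultimately show ?thesis by (metis mult_pos_pos not_le)
    qed
    then have "z * exp (w * l x) \<le> 0" by (simp add: mult_le_0_iff)
    ultimately show "\<exists>d. (Z has_real_derivative d) (at x) \<and> d \<le> 0" by blast
  qed
  also have "Z s \<le> (Y s)\<^sup>2 * exp (w * l s)" unfolding Z_def by (intro mult_right_mono) auto
  finally have "((Y t)\<^sup>2 - (M / h0)\<^sup>2) * exp (w * l t) * exp (- (w * l t)) \<le> (Y s)\<^sup>2 * exp (w * l s) * exp (- (w * l t))"
    unfolding Z_def by (intro mult_right_mono) auto
  then have "(Y t)\<^sup>2 - (M / h0)\<^sup>2 \<le> (Y s)\<^sup>2 * exp (w * (l s - l t))"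
    by (simp add: mult.assoc exp_minus_inverse flip: exp_add) (simp add: algebra_simps)
  then show ?thesis by (simp add: w_def l_def)
qed

lemma square_times_exp_le:
  fixes z :: real
  assumes "z \<ge> 0"
  shows "z\<^sup>2 * exp (- z) \<le> 2"
proof -
  have "z\<^sup>2 / 2 \<le> exp z" using exp_lower_Taylor_quadratic[OF assms] assms by linarith
  then have "z\<^sup>2 / 2 * exp (- z) \<le> exp z * exp (- z)" by (intro mult_right_mono) auto
  then show ?thesis by (simp add: exp_minus)
qed

text \<open>A solution that is at most \<open>O(1/\<nu>)\<close> is in fact bounded: the integrating factor is smaller than any
  power of \<open>\<nu>\<close>, and at \<open>-1\<close> it beats the singularity of \<open>1/(1 - x\<^sup>2)\<close>.\<close>

lemma linear_bound:
  fixes Y :: "'k \<Rightarrow> real \<Rightarrow> real"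
  assumes pq: "-1 \<le> p" "q \<le> 1" and h0: "0 < h0" and \<nu>: "\<And>k. k \<in> K \<Longrightarrow> 0 < \<nu> k \<and> \<nu> k \<le> h0 / 8"
    and Y: "\<And>k x. k \<in> K \<Longrightarrow> x \<in> {p<..<q} \<Longrightarrow> (Y k has_real_derivative Y' k x) (at x)"
    and eq: "\<And>k x. k \<in> K \<Longrightarrow> x \<in> {p<..<q} \<Longrightarrow> \<nu> k * (1 - x\<^sup>2) * Y' k x + H k x * Y k x = F k x"
    and H: "\<And>k x. k \<in> K \<Longrightarrow> x \<in> {p<..<q} \<Longrightarrow> H k x \<ge> h0"
    and F: "\<And>k x. k \<in> K \<Longrightarrow> x \<in> {p<..<q} \<Longrightarrow> \<bar>F k x\<bar> \<le> M"
    and C: "\<And>k x. k \<in> K \<Longrightarrow> x \<in> {p<..<q} \<Longrightarrow> \<bar>Y k x\<bar> * (\<nu> k * (1 - x\<^sup>2)) \<le> C"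
    and p': "starts_before p p'"
  shows "unif_bounded 0 K {p'<..<q} Y"
proof -
  define l where "l x = ln (1 + x) - ln (1 - x)" for x :: real
  have l_mono: "l x \<le> l y" and l_strict: "x < y \<Longrightarrow> l x < l y" if "-1 < x" "x \<le> y" "y < 1" for x y
    using that by (auto simp: l_def intro!: diff_mono diff_strict_mono)
  have decay: "(Y k t)\<^sup>2 \<le> (M / h0)\<^sup>2 + (Y k s)\<^sup>2 * exp (h0 / (2 * \<nu> k) * (l s - l t))"
    if "k \<in> K" "p < s" "s \<le> t" "t < q" for k s t
    unfolding l_def
    by (rule linear_decay[where Y' = "Y' k" and H = "H k" and F = "F k"])
       (use that pq \<nu> h0 in \<open>auto intro!: Y eq H F\<close>)
  have aY: "(Y k x)\<^sup>2 \<le> (C / (\<nu> k * (1 - x\<^sup>2)))\<^sup>2" if "k \<in> K" "x \<in> {p<..<q}" for k x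
  proof -
    have "\<nu> k * (1 - x\<^sup>2) > 0" using \<nu>[OF that(1)] one_minus_square_pos[of x] that pq by auto
    then have "\<bar>Y k x\<bar> \<le> C / (\<nu> k * (1 - x\<^sup>2))" using C[OF that] by (simp add: pos_le_divide_eq)
    then have "\<bar>Y k x\<bar>\<^sup>2 \<le> (C / (\<nu> k * (1 - x\<^sup>2)))\<^sup>2" by (intro power_mono) auto
    then show ?thesis by simp
  qed
  have "\<exists>B. \<forall>k\<in>K. \<forall>x\<in>{p'<..<q}. (Y k x)\<^sup>2 \<le> B"
  proof (cases "p < p' \<and> p' < q")
    case True
    \<comment> \<open>Decay over the fixed interval from \<open>s\<close> to \<open>p'\<close> yields a factor \<open>e\<^sup>-\<^sup>z\<close> with \<open>z\<close> proportional to \<open>1/\<nu>\<close>.\<close>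
    define s where "s = (p + p') / 2"
    have s: "p < s" "s < p'" "-1 < s" "s < 1" using True pq by (auto simp: s_def)
    define a where "a = 1 - s\<^sup>2"
    have a: "a > 0" using one_minus_square_pos[of s] s by (simp add: a_def)
    define d where "d = l p' - l s"
    have l0: "d > 0" using l_strict[of s p'] s True pq by (simp add: d_def)
    have "(Y k t)\<^sup>2 \<le> (M / h0)\<^sup>2 + 2 * (C / a * (2 / (h0 * d)))\<^sup>2" if k: "k \<in> K" and t: "t \<in> {p'<..<q}" for k t
    proof -
      define z where "z = h0 / (2 * \<nu> k) * d"
      have z: "z > 0" using h0 \<nu>[OF k] l0 by (simp add: z_def)
      have "l p' \<le> l t" using t True s pq by (intro l_mono) auto
      then have "h0 / (2 * \<nu> k) * (l s - l t) \<le> h0 / (2 * \<nu> k) * (- d)"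
        using h0 \<nu>[OF k] by (intro mult_left_mono) (auto simp: d_def)
      then have "h0 / (2 * \<nu> k) * (l s - l t) \<le> - z" by (simp add: z_def)
      then have "exp (h0 / (2 * \<nu> k) * (l s - l t)) \<le> exp (- z)" by simp
      then have "(Y k s)\<^sup>2 * exp (h0 / (2 * \<nu> k) * (l s - l t)) \<le> (C / (\<nu> k * a))\<^sup>2 * exp (- z)"
        using aY[OF k, of s] s t by (intro mult_mono) (auto simp: a_def)
      also have "C / (\<nu> k * a) = C / a * (2 / (h0 * d)) * z"
      proof -
        have "1 / \<nu> k = 2 / (h0 * d) * z" using h0 l0 by (simp add: z_def)
        have "C / (\<nu> k * a) = C / a * (1 / \<nu> k)" by (simp add: mult.commute)
        also have "1 / \<nu> k = 2 / (h0 * d) * z" by fact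
        finally show ?thesis by (simp only: mult.assoc)
      qed
      also have "(C / a * (2 / (h0 * d)) * z)\<^sup>2 * exp (- z) = (C / a * (2 / (h0 * d)))\<^sup>2 * (z\<^sup>2 * exp (- z))"
        by (simp only: power_mult_distrib mult.assoc)
      also have "\<dots> \<le> (C / a * (2 / (h0 * d)))\<^sup>2 * 2"
        using square_times_exp_le[of z] z by (intro mult_left_mono) auto
      finally show ?thesis using decay[OF k, of s t] s t by simp
    qed
    then show ?thesis by blast
  next
    case False
    show ?thesis
    proof (cases "p' < q")
      case False
      then show ?thesis by (intro exI[of _ 0]) auto
    next
      case q: True
      then have p: "p = -1" "p' = -1" using False p' by (auto simp: starts_before_def)
      have "(Y k t)\<^sup>2 \<le> (M / h0)\<^sup>2" if k: "k \<in> K" and t: "t \<in> {p'<..<q}" for k t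
      proof -
        define w where "w = h0 / (2 * \<nu> k)"
        have w4: "w \<ge> 4" using \<nu>[OF k] h0 by (simp add: w_def pos_le_divide_eq)
        \<comment> \<open>Since \<open>w \<ge> 4\<close>, the integrating factor at \<open>s\<close> is at most \<open>(1 + s)\<^sup>4\<close>, while \<open>Y\<^sup>2\<close> grows at most like \<open>(1 + s)\<^sup>-\<^sup>2\<close> as \<open>s\<close> tends to \<open>-1\<close>.\<close>
        define D where "D = (C / \<nu> k)\<^sup>2 * exp (- (w * l t))"
        have step: "(Y k t)\<^sup>2 \<le> (M / h0)\<^sup>2 + D * (1 + s)\<^sup>2" if s: "-1 < s" "s < min t 0" for s
        proof -
          have ln1: "ln (1 - s) \<ge> 0" "ln (1 + s) \<le> 0" using s by auto
          have "l s * w \<le> l s * 4" using ln1 w4 by (intro mult_left_mono_neg) (auto simp: l_def)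
          also have "\<dots> \<le> ln (1 + s) * 4" using ln1 by (simp add: l_def)
          finally have "exp (w * l s) \<le> exp (4 * ln (1 + s))" by (simp add: mult.commute)
          also have "\<dots> = (1 + s) ^ 4" using s exp_of_nat_mult[of 4 "ln (1 + s)"] by simp
          finally have E: "exp (w * l s) \<le> (1 + s) ^ 4" .
          have "1 - s\<^sup>2 = (1 + s) * (1 - s)" by (simp add: power2_eq_square algebra_simps)
          moreover have "(1 + s) * 1 \<le> (1 + s) * (1 - s)" using s by (intro mult_left_mono) auto
          ultimately have as: "1 + s \<le> 1 - s\<^sup>2" by simp
          have C0: "C \<ge> 0" using C[OF k, of t] t p \<nu>[OF k] one_minus_square_pos[of t] pq
            by (smt (verit) greaterThanLessThan_iff zero_le_mult_iff)
          have "C / (\<nu> k * (1 - s\<^sup>2)) \<le> C / (\<nu> k * (1 + s))"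
            using as s \<nu>[OF k] C0 by (intro divide_left_mono mult_left_mono mult_pos_pos) auto
          moreover have "0 \<le> C / (\<nu> k * (1 - s\<^sup>2))" using C0 as s \<nu>[OF k] by simp
          ultimately have "(C / (\<nu> k * (1 - s\<^sup>2)))\<^sup>2 \<le> (C / (\<nu> k * (1 + s)))\<^sup>2" by (rule power_mono)
          then have "(Y k s)\<^sup>2 \<le> (C / (\<nu> k * (1 + s)))\<^sup>2"
            using aY[OF k, of s] s t p by force
          then have "(Y k s)\<^sup>2 * exp (w * l s) \<le> (C / (\<nu> k * (1 + s)))\<^sup>2 * (1 + s) ^ 4"
            using E by (intro mult_mono) auto
          also have "\<dots> = (C / \<nu> k)\<^sup>2 * (1 + s)\<^sup>2"
          proof -
            have "(C / (\<nu> k * b))\<^sup>2 * b ^ 4 = (C / \<nu> k)\<^sup>2 * b\<^sup>2" if "b > 0" for b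
              using that by (simp add: power_divide power_mult_distrib power4_eq_xxxx power2_eq_square)
            then show ?thesis using s by simp
          qed
          finally have "(Y k s)\<^sup>2 * exp (w * l s) * exp (- (w * l t)) \<le> (C / \<nu> k)\<^sup>2 * (1 + s)\<^sup>2 * exp (- (w * l t))"
            by (intro mult_right_mono) auto
          then have "(Y k s)\<^sup>2 * exp (w * (l s - l t)) \<le> D * (1 + s)\<^sup>2"
            by (simp add: D_def right_diff_distrib exp_diff exp_minus field_simps)
          then show ?thesis using decay[OF k, of s t] s t p by (simp add: w_def)
        qed
        have "((\<lambda>s. (M / h0)\<^sup>2 + D * (1 + s)\<^sup>2) \<longlongrightarrow> (M / h0)\<^sup>2 + D * (1 + -1)\<^sup>2) (at_right (-1))"
          by (intro tendsto_intros)
        then have "((\<lambda>s. (M / h0)\<^sup>2 + D * (1 + s)\<^sup>2) \<longlongrightarrow> (M / h0)\<^sup>2) (at_right (-1))" by simp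
        moreover have "\<forall>\<^sub>F s in at_right (-1). s \<in> {-1<..<min t 0}"
          using t p by (intro eventually_at_right_real) auto
        then have "\<forall>\<^sub>F s in at_right (-1). (Y k t)\<^sup>2 \<le> (M / h0)\<^sup>2 + D * (1 + s)\<^sup>2"
          by eventually_elim (use step in auto)
        ultimately show ?thesis by (rule tendsto_lowerbound) simp
      qed
      then show ?thesis by blast
    qed
  qed
  then obtain B where B: "\<forall>k\<in>K. \<forall>x\<in>{p'<..<q}. (Y k x)\<^sup>2 \<le> B" by blast
  have "\<bar>Y k x\<bar> \<le> sqrt B" if "k \<in> K" "x \<in> {p'<..<q}" for k x
    using B that by (intro real_le_rsqrt) auto
  then show ?thesis by (rule unif_bounded_0I)
qed

lemma linear_derivative:
  assumes I: "open I" "x \<in> I" "I \<subseteq> {-1<..<1}" and \<nu>: "\<nu> > 0"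
    and Y: "\<And>x. x \<in> I \<Longrightarrow> (Y has_real_derivative Y' x) (at x)"
    and H: "\<And>x. x \<in> I \<Longrightarrow> (H has_real_derivative H' x) (at x)"
    and F: "\<And>x. x \<in> I \<Longrightarrow> (F has_real_derivative F' x) (at x)"
    and eq: "\<And>x. x \<in> I \<Longrightarrow> \<nu> * (1 - x\<^sup>2) * Y' x + H x * Y x = F x"
  shows "(Y' has_real_derivative (F' x - H' x * Y x - (H x - 2 * \<nu> * x) * Y' x) / (\<nu> * (1 - x\<^sup>2))) (at x)"
proof -
  have a: "\<nu> * (1 - y\<^sup>2) > 0" if "y \<in> I" for y using \<nu> one_minus_square_pos[of y] I(3) that by auto
  have Y'_eq: "Y' y = (F y - H y * Y y) / (\<nu> * (1 - y\<^sup>2))" if "y \<in> I" for y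
  proof -
    have "F y - H y * Y y = \<nu> * (1 - y\<^sup>2) * Y' y" using eq[OF that] by simp
    then show ?thesis by (simp only: nonzero_mult_div_cancel_left[OF a[OF that, THEN less_imp_neq, THEN not_sym]])
  qed
  define b where "b = \<nu> * (1 - x\<^sup>2)"
  have b: "b > 0" using a[OF I(2)] by (simp add: b_def)
  have N: "F x - H x * Y x = b * Y' x" using eq[OF I(2)] by (simp add: b_def)
  have "((\<lambda>y. F y - H y * Y y) has_real_derivative F' x - (H' x * Y x + Y' x * H x)) (at x)"
    by (intro DERIV_diff DERIV_mult F H Y I(2))
  moreover have "((\<lambda>y. \<nu> * (1 - y\<^sup>2)) has_real_derivative - 2 * \<nu> * x) (at x)"
    by (auto intro!: derivative_eq_intros)
  moreover have "\<nu> * (1 - x\<^sup>2) \<noteq> 0" by (rule less_imp_neq[OF a[OF I(2)], THEN not_sym])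
  ultimately have "((\<lambda>y. (F y - H y * Y y) / (\<nu> * (1 - y\<^sup>2))) has_real_derivative
      ((F' x - (H' x * Y x + Y' x * H x)) * b - b * Y' x * (- 2 * \<nu> * x)) / (b * b)) (at x)"
    unfolding b_def N[symmetric, unfolded b_def] by (rule DERIV_divide)
  also have "(F' x - (H' x * Y x + Y' x * H x)) * b - b * Y' x * (- 2 * \<nu> * x)
      = b * (F' x - H' x * Y x - (H x - 2 * \<nu> * x) * Y' x)" by (simp add: algebra_simps)
  also have "\<dots> / (b * b) = (F' x - H' x * Y x - (H x - 2 * \<nu> * x) * Y' x) / b" using b by simp
  finally show ?thesis
    unfolding b_def by (rule has_field_derivative_transform_within_open[OF _ I(1,2)]) (simp add: Y'_eq)
qed

text \<open>Differentiating the equation for \<open>Y\<close> gives an equation of the same form for \<open>Y'\<close>, with \<open>H - 2\<nu>x\<close> in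
  place of \<open>H\<close>. This costs \<open>2\<nu>\<close> in the lower bound for \<open>H\<close>, hence the hypothesis on \<open>H\<close>.\<close>

lemma linear_unif_bounded:
  fixes Y :: "'k \<Rightarrow> real \<Rightarrow> real"
  assumes q: "q \<le> 1" and h0: "0 < h0" and \<nu>: "\<And>k. k \<in> K \<Longrightarrow> 0 < \<nu> k \<and> \<nu> k \<le> h0 / 8"
  shows "-1 \<le> p \<Longrightarrow> (\<And>k x. k \<in> K \<Longrightarrow> x \<in> {p<..<q} \<Longrightarrow> (Y k has_real_derivative Y' k x) (at x)) \<Longrightarrow>
    (\<And>k x. k \<in> K \<Longrightarrow> x \<in> {p<..<q} \<Longrightarrow> \<nu> k * (1 - x\<^sup>2) * Y' k x + H k x * Y k x = F k x) \<Longrightarrow>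
    (\<And>k x. k \<in> K \<Longrightarrow> x \<in> {p<..<q} \<Longrightarrow> H k x \<ge> h0 + 2 * real n * \<nu> k) \<Longrightarrow>
    unif_bounded n K {p<..<q} H \<Longrightarrow> unif_bounded n K {p<..<q} F \<Longrightarrow>
    (\<And>k x. k \<in> K \<Longrightarrow> x \<in> {p<..<q} \<Longrightarrow> \<bar>Y k x\<bar> * (\<nu> k * (1 - x\<^sup>2)) \<le> C) \<Longrightarrow>
    starts_before p p' \<Longrightarrow> unif_bounded n K {p'<..<q} Y"
proof (induction n arbitrary: p p' Y Y' H F C)
  case 0
  obtain M where M: "\<forall>k\<in>K. \<forall>x\<in>{p<..<q}. \<bar>F k x\<bar> \<le> M" using unif_bounded_bound[OF 0(6)] by metis
  have H: "H k x \<ge> h0" if "k \<in> K" "x \<in> {p<..<q}" for k x using 0(4)[OF that] by simp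
  show ?case
    by (rule linear_bound[OF 0(1) q h0 \<nu> 0(2,3) H M[rule_format] 0(7,8)])
next
  case (Suc n)
  note p = Suc.prems(1) and Y = Suc.prems(2) and eq = Suc.prems(3) and H = Suc.prems(4)
    and ubH = Suc.prems(5) and ubF = Suc.prems(6) and C = Suc.prems(7)
  obtain p2 where p2: "starts_before p p2" "starts_before p2 p'"
    using starts_before_dense[OF Suc.prems(8)] by metis
  have sub: "{p2<..<q} \<subseteq> {p<..<q}" and sub': "{p'<..<q} \<subseteq> {p2<..<q}"
    using starts_before_le[OF p2(1)] starts_before_le[OF p2(2)] by auto
  have Hn: "H k x \<ge> h0 + 2 * real n * \<nu> k" if "k \<in> K" "x \<in> {p<..<q}" for k x
    using H[OF that] \<nu>[OF that(1)] by (simp add: distrib_right distrib_left)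
  have ubY: "unif_bounded n K {p2<..<q} Y"
    by (rule Suc.IH[OF p Y eq Hn unif_bounded_pred[OF ubH] unif_bounded_pred[OF ubF] C p2(1)])
  obtain H' where H': "\<forall>k\<in>K. \<forall>x\<in>{p<..<q}. (H k has_real_derivative H' k x) (at x)" "unif_bounded n K {p<..<q} H'"
    using unif_bounded_SucE[OF ubH] by metis
  obtain F' where F': "\<forall>k\<in>K. \<forall>x\<in>{p<..<q}. (F k has_real_derivative F' k x) (at x)" "unif_bounded n K {p<..<q} F'"
    using unif_bounded_SucE[OF ubF] by metis
  have sub1: "{p<..<q} \<subseteq> {-1<..<1}" using p q by auto
  have pos: "\<nu> k * (1 - x\<^sup>2) > 0" if "k \<in> K" "x \<in> {p<..<q}" for k x
    using \<nu>[OF that(1)] one_minus_square_pos[of x] sub1 that(2) by auto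
  define Y'' where "Y'' k x = (F' k x - H' k x * Y k x - (H k x - 2 * \<nu> k * x) * Y' k x) / (\<nu> k * (1 - x\<^sup>2))" for k x
  have dY': "(Y' k has_real_derivative Y'' k x) (at x)" if "k \<in> K" "x \<in> {p<..<q}" for k x
    unfolding Y''_def
    by (rule linear_derivative[where I = "{p<..<q}" and H = "H k" and F = "F k"])
       (use that sub1 \<nu> Y eq H'(1) F'(1) in auto)
  have eq': "\<nu> k * (1 - x\<^sup>2) * Y'' k x + (H k x - 2 * \<nu> k * x) * Y' k x = F' k x - H' k x * Y k x"
    if "k \<in> K" "x \<in> {p<..<q}" for k x
  proof -
    have "\<nu> k * (1 - x\<^sup>2) * Y'' k x = F' k x - H' k x * Y k x - (H k x - 2 * \<nu> k * x) * Y' k x"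
      unfolding Y''_def times_divide_eq_right
      by (rule nonzero_mult_div_cancel_left[OF pos[OF that, THEN less_imp_neq, THEN not_sym]])
    then show ?thesis by simp
  qed
  have n: "unif_bounded n K {p2<..<q} H'" "unif_bounded n K {p2<..<q} F'" "unif_bounded n K {p2<..<q} H"
    "unif_bounded n K {p2<..<q} F"
    by (rule unif_bounded_subset[OF _ sub], rule H' F' unif_bounded_pred[OF ubH] unif_bounded_pred[OF ubF])+
  have "unif_bounded n K {p2<..<q} (\<lambda>k x. F k x - H k x * Y k x)"
    by (intro unif_bounded_diff unif_bounded_mult n ubY)
  then obtain C' where C': "\<forall>k\<in>K. \<forall>x\<in>{p2<..<q}. \<bar>F k x - H k x * Y k x\<bar> \<le> C'"
    by (rule unif_bounded_bound)
  have ubY': "unif_bounded n K {p'<..<q} Y'"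
  proof (rule Suc.IH[where H = "\<lambda>k x. H k x - 2 * \<nu> k * x" and F = "\<lambda>k x. F' k x - H' k x * Y k x"
        and p = p2 and Y' = Y'' and C = C'])
    show "-1 \<le> p2" using p starts_before_le[OF p2(1)] by simp
    show "(Y' k has_real_derivative Y'' k x) (at x)" if "k \<in> K" "x \<in> {p2<..<q}" for k x
      using dY' that sub by blast
    show "\<nu> k * (1 - x\<^sup>2) * Y'' k x + (H k x - 2 * \<nu> k * x) * Y' k x = F' k x - H' k x * Y k x"
      if "k \<in> K" "x \<in> {p2<..<q}" for k x
      using eq' that sub by blast
    show "h0 + 2 * real n * \<nu> k \<le> H k x - 2 * \<nu> k * x" if "k \<in> K" "x \<in> {p2<..<q}" for k x
    proof -
      have x: "x \<in> {p<..<q}" using that sub by blast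
      have "\<nu> k * x \<le> \<nu> k * 1" using \<nu>[OF that(1)] x sub1 by (intro mult_left_mono) auto
      then show ?thesis using H[OF that(1) x] by (simp add: distrib_right distrib_left mult.assoc)
    qed
    have "unif_bounded n K {p2<..<q} (\<lambda>k x. 2 * \<nu> k)"
    proof (rule unif_bounded_const[where M = "h0"])
      show "\<bar>2 * \<nu> k\<bar> \<le> h0" if "k \<in> K" for k using \<nu>[OF that] h0 by simp
    qed
    moreover have "unif_bounded n K {p2<..<q} (\<lambda>k x. x)" using sub sub1 by (intro unif_bounded_ident) auto
    ultimately show "unif_bounded n K {p2<..<q} (\<lambda>k x. H k x - 2 * \<nu> k * x)"
      by (rule unif_bounded_diff[OF n(3) unif_bounded_mult])
    show "unif_bounded n K {p2<..<q} (\<lambda>k x. F' k x - H' k x * Y k x)"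
      by (intro unif_bounded_diff unif_bounded_mult n ubY)
    show "\<bar>Y' k x\<bar> * (\<nu> k * (1 - x\<^sup>2)) \<le> C'" if "k \<in> K" "x \<in> {p2<..<q}" for k x
    proof -
      have x: "x \<in> {p<..<q}" using that sub by blast
      have "F k x - H k x * Y k x = \<nu> k * (1 - x\<^sup>2) * Y' k x" using eq[OF that(1) x] by simp
      then have "\<bar>F k x - H k x * Y k x\<bar> = \<bar>Y' k x\<bar> * (\<nu> k * (1 - x\<^sup>2))"
        by (simp only: mult.commute[of _ "Y' k x"] abs_mult[of "Y' k x"] abs_of_pos[OF pos[OF that(1) x]])
      then show ?thesis using bspec[OF bspec[OF C' that(1)] that(2)] by linarith
    qed
    show "starts_before p2 p'" by (rule p2)
  qed
  show ?case
  proof (rule unif_bounded_SucI)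
    show "unif_bounded 0 K {p'<..<q} Y"
      by (rule unif_bounded_0[OF unif_bounded_subset[OF ubY sub']])
    show "(Y k has_real_derivative Y' k x) (at x)" if "k \<in> K" "x \<in> {p'<..<q}" for k x
      using Y that sub sub' by blast
  qed (rule ubY')
qed

section \<open>Interior and one-sided boundary regularity\<close>

text \<open>The equation is written in terms of the rescaled error \<open>V = (U - g)/\<nu>\<close>, \<open>g = \<surd>(2P)\<close>. It is linear
  in \<open>V\<close> if one factor \<open>U + g\<close> of the nonlinearity is treated as a coefficient. Differentiation turns
  this coefficient into \<open>U = g + \<nu> V\<close>, which is as regular as \<open>V\<close>, so that \<open>V'\<close> is as regular as \<open>V\<close>.\<close>

lemma riccati_unif_bounded:
  fixes U g :: "'k \<Rightarrow> real \<Rightarrow> real"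
  assumes pq: "-1 \<le> p" "q \<le> 1" and h0: "0 < h0" and \<nu>: "\<And>k. k \<in> K \<Longrightarrow> 0 < \<nu> k \<and> \<nu> k \<le> h0 / 8"
    and U: "\<And>k x. k \<in> K \<Longrightarrow> x \<in> {p<..<q} \<Longrightarrow> (U k has_real_derivative U' k x) (at x)"
    and eq: "\<And>k x. k \<in> K \<Longrightarrow> x \<in> {p<..<q} \<Longrightarrow>
      \<nu> k * (1 - x\<^sup>2) * U' k x + 2 * \<nu> k * x * U k x + (1/2) * (U k x)\<^sup>2 = (1/2) * (g k x)\<^sup>2"
    and g: "\<And>k x. k \<in> K \<Longrightarrow> x \<in> {p<..<q} \<Longrightarrow> (g k has_real_derivative g1 k x) (at x)"
    and g1: "\<And>k x. k \<in> K \<Longrightarrow> x \<in> {p<..<q} \<Longrightarrow> (g1 k has_real_derivative g2 k x) (at x)"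
    and ub: "\<And>n. unif_bounded n K {p<..<q} g" "\<And>n. unif_bounded n K {p<..<q} g1" "\<And>n. unif_bounded n K {p<..<q} g2"
    and low: "\<And>k x. k \<in> K \<Longrightarrow> x \<in> {p<..<q} \<Longrightarrow> U k x \<ge> h0 + 2 * real m * \<nu> k"
      "\<And>k x. k \<in> K \<Longrightarrow> x \<in> {p<..<q} \<Longrightarrow> (1/2) * (U k x + g k x) + 2 * \<nu> k * x \<ge> h0"
    and C: "\<And>k x. k \<in> K \<Longrightarrow> x \<in> {p<..<q} \<Longrightarrow> \<bar>U k x - g k x\<bar> \<le> C"
    and n: "n \<le> Suc m" and p': "starts_before p p'"
  shows "unif_bounded n K {p'<..<q} (\<lambda>k x. (U k x - g k x) / \<nu> k)"
proof -
  have sub1: "{p<..<q} \<subseteq> {-1<..<1}" using pq by auto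
  have pos: "\<nu> k * (1 - x\<^sup>2) > 0" "0 < 1 - x\<^sup>2" "1 - x\<^sup>2 \<le> 1" if "k \<in> K" "x \<in> {p<..<q}" for k x
    using \<nu>[OF that(1)] one_minus_square_pos[of x] sub1 that(2) by auto
  define V where "V k x = (U k x - g k x) / \<nu> k" for k x
  define V' where "V' k x = (U' k x - g1 k x) / \<nu> k" for k x
  define H where "H k x = (1/2) * (U k x + g k x) + 2 * \<nu> k * x" for k x
  define F where "F k x = - ((1 - x\<^sup>2) * g1 k x + 2 * x * g k x)" for k x
  have U_eq: "U k x = g k x + \<nu> k * V k x" and U'_eq: "U' k x = g1 k x + \<nu> k * V' k x" if "k \<in> K" for k x
    using \<nu>[OF that] by (auto simp: V_def V'_def)
  have dV: "(V k has_real_derivative V' k x) (at x)" if "k \<in> K" "x \<in> {p<..<q}" for k x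
    unfolding V_def V'_def by (intro DERIV_cdivide DERIV_diff U g that)
  have eqV: "\<nu> k * (1 - x\<^sup>2) * V' k x + H k x * V k x = F k x" if "k \<in> K" "x \<in> {p<..<q}" for k x
  proof -
    have "\<nu> k * (\<nu> k * (1 - x\<^sup>2) * V' k x + H k x * V k x - F k x) =
      \<nu> k * (1 - x\<^sup>2) * (g1 k x + \<nu> k * V' k x) + 2 * \<nu> k * x * (g k x + \<nu> k * V k x)
        + (1/2) * (g k x + \<nu> k * V k x)\<^sup>2 - (1/2) * (g k x)\<^sup>2"
      unfolding H_def F_def U_eq[OF that(1)] by (simp add: power2_eq_square field_simps)
    also have "\<dots> = 0" using eq[OF that] by (simp only: U_eq[OF that(1)] U'_eq[OF that(1)])
    finally show ?thesis using \<nu>[OF that(1)] by simp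
  qed
  have id: "unif_bounded n K {p<..<q} (\<lambda>k x. x)" for n using sub1 by (intro unif_bounded_ident) auto
  have \<nu>_ub: "unif_bounded n K I (\<lambda>k x. a * \<nu> k)" for n I a
  proof (intro unif_bounded_cmult unif_bounded_const)
    show "\<bar>\<nu> k\<bar> \<le> h0 / 8" if "k \<in> K" for k using \<nu>[OF that] by simp
  qed
  have one: "unif_bounded n K {p<..<q} (\<lambda>k x. 1 - x\<^sup>2)" for n
    unfolding power2_eq_square by (intro unif_bounded_diff unif_bounded_mult[OF id id] unif_bounded_const[where M = 1]) simp
  have ubF: "unif_bounded n K {p<..<q} F" for n
    unfolding F_def mult.assoc
    by (intro unif_bounded_minus unif_bounded_add unif_bounded_mult[OF one ub(2)] unif_bounded_cmult unif_bounded_mult[OF id ub(1)])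
  have aV: "\<bar>V k x\<bar> * (\<nu> k * (1 - x\<^sup>2)) \<le> C" if "k \<in> K" "x \<in> {p<..<q}" for k x
  proof -
    have "\<bar>V k x\<bar> * (\<nu> k * (1 - x\<^sup>2)) = \<bar>U k x - g k x\<bar> * (1 - x\<^sup>2)"
      using \<nu>[OF that(1)] by (simp add: V_def abs_divide)
    also have "\<dots> \<le> \<bar>U k x - g k x\<bar> * 1" using pos[OF that] by (intro mult_left_mono) auto
    finally show ?thesis using C[OF that] by simp
  qed
  have "unif_bounded n K {p'<..<q} V"
    using n p'
  proof (induction n arbitrary: p')
    case 0
    obtain M where M: "\<forall>k\<in>K. \<forall>x\<in>{p<..<q}. \<bar>F k x\<bar> \<le> M" by (rule unif_bounded_bound[OF ubF[of 0]])
    show ?case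
      by (rule linear_bound[OF pq h0 \<nu> dV eqV low(2)[folded H_def] M[rule_format] aV 0(2)])
  next
    case (Suc n)
    obtain p2 where p2: "starts_before p p2" "starts_before p2 p'"
      using starts_before_dense[OF Suc.prems(2)] by metis
    have sub: "{p2<..<q} \<subseteq> {p<..<q}" and sub': "{p'<..<q} \<subseteq> {p2<..<q}"
      using starts_before_le[OF p2(1)] starts_before_le[OF p2(2)] by auto
    have ubV: "unif_bounded n K {p2<..<q} V" using Suc.IH[OF _ p2(1)] Suc.prems(1) by simp
    define F' where "F' k x = - ((1 - x\<^sup>2) * g2 k x + 2 * g k x)" for k x
    define H' where "H' k x = (1/2) * (U' k x + g1 k x) + 2 * \<nu> k" for k x
    define V'' where "V'' k x = (F' k x - H' k x * V k x - (H k x - 2 * \<nu> k * x) * V' k x) / (\<nu> k * (1 - x\<^sup>2))" for k x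
    have dV': "(V' k has_real_derivative V'' k x) (at x)" if "k \<in> K" "x \<in> {p<..<q}" for k x
      unfolding V''_def
    proof (rule linear_derivative[where I = "{p<..<q}" and H = "H k" and F = "F k" and Y = "V k"])
      show "(H k has_real_derivative H' k y) (at y)" if "y \<in> {p<..<q}" for y
        unfolding H_def H'_def using U[OF \<open>k \<in> K\<close> that] g[OF \<open>k \<in> K\<close> that]
        by (auto intro!: derivative_eq_intros)
      show "(F k has_real_derivative F' k y) (at y)" if "y \<in> {p<..<q}" for y
        unfolding F_def F'_def using g1[OF \<open>k \<in> K\<close> that] g[OF \<open>k \<in> K\<close> that]
        by (auto intro!: derivative_eq_intros)
    qed (use that sub1 \<nu> dV eqV in auto)
    have eq': "\<nu> k * (1 - x\<^sup>2) * V'' k x + U k x * V' k x = F' k x - (g1 k x + 2 * \<nu> k) * V k x"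
      if "k \<in> K" "x \<in> {p<..<q}" for k x
    proof -
      have "\<nu> k * (1 - x\<^sup>2) * V'' k x = F' k x - H' k x * V k x - (H k x - 2 * \<nu> k * x) * V' k x"
        unfolding V''_def times_divide_eq_right
        by (rule nonzero_mult_div_cancel_left[OF pos(1)[OF that, THEN less_imp_neq, THEN not_sym]])
      moreover have "H' k x * V k x + (H k x - 2 * \<nu> k * x) * V' k x
          = (g1 k x + 2 * \<nu> k) * V k x + U k x * V' k x"
        unfolding H'_def H_def U'_eq[OF that(1)] U_eq[OF that(1)] by (simp add: field_simps)
      ultimately show ?thesis by simp
    qed
    note subset = unif_bounded_subset[OF _ sub]
    have ubU: "unif_bounded n K {p2<..<q} U"
    proof (rule unif_bounded_cong)
      show "unif_bounded n K {p2<..<q} (\<lambda>k x. g k x + 1 * \<nu> k * V k x)"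
        by (intro unif_bounded_add unif_bounded_mult[OF \<nu>_ub ubV] subset[OF ub(1)])
    qed (use U_eq in auto)
    have ubF2: "unif_bounded n K {p2<..<q} (\<lambda>k x. F' k x - (g1 k x + 2 * \<nu> k) * V k x)"
      unfolding F'_def
      by (intro unif_bounded_diff unif_bounded_minus unif_bounded_mult[OF _ ubV] unif_bounded_mult[OF subset[OF one] subset[OF ub(3)]]
          unif_bounded_add unif_bounded_cmult[OF subset[OF ub(1)]] subset[OF ub(2)] \<nu>_ub)
    have "unif_bounded n K {p2<..<q} (\<lambda>k x. F k x - (1/2 * (U k x + g k x) + 2 * \<nu> k * x) * V k x)"
      by (intro unif_bounded_diff subset[OF ubF] unif_bounded_mult[OF _ ubV] unif_bounded_add
          unif_bounded_cmult[OF unif_bounded_add[OF ubU subset[OF ub(1)]]] unif_bounded_mult[OF \<nu>_ub subset[OF id]])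
    then obtain C' where C': "\<forall>k\<in>K. \<forall>x\<in>{p2<..<q}. \<bar>F k x - (1/2 * (U k x + g k x) + 2 * \<nu> k * x) * V k x\<bar> \<le> C'"
      by (rule unif_bounded_bound)
    have ubV': "unif_bounded n K {p'<..<q} V'"
    proof (rule linear_unif_bounded[OF pq(2) h0 \<nu>, where p = p2 and Y' = V'' and H = U and C = C'
          and F = "\<lambda>k x. F' k x - (g1 k x + 2 * \<nu> k) * V k x"])
      show "-1 \<le> p2" using pq starts_before_le[OF p2(1)] by simp
      show "(V' k has_real_derivative V'' k x) (at x)" if "k \<in> K" "x \<in> {p2<..<q}" for k x
        using dV' that sub by blast
      show "\<nu> k * (1 - x\<^sup>2) * V'' k x + U k x * V' k x = F' k x - (g1 k x + 2 * \<nu> k) * V k x"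
        if "k \<in> K" "x \<in> {p2<..<q}" for k x
        using eq' that sub by blast
      show "h0 + 2 * real n * \<nu> k \<le> U k x" if "k \<in> K" "x \<in> {p2<..<q}" for k x
      proof -
        have "real n * \<nu> k \<le> real m * \<nu> k" using Suc.prems(1) \<nu>[OF that(1)] by (intro mult_right_mono) auto
        moreover have "x \<in> {p<..<q}" using that sub by blast
        ultimately show ?thesis using low(1)[OF that(1), of x] by (simp add: mult.assoc)
      qed
      show "\<bar>V' k x\<bar> * (\<nu> k * (1 - x\<^sup>2)) \<le> C'" if "k \<in> K" "x \<in> {p2<..<q}" for k x
      proof -
        have x: "x \<in> {p<..<q}" using that sub by blast
        have "F k x - (1/2 * (U k x + g k x) + 2 * \<nu> k * x) * V k x = \<nu> k * (1 - x\<^sup>2) * V' k x"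
          using eqV[OF that(1) x] unfolding H_def by linarith
        then have "\<bar>F k x - (1/2 * (U k x + g k x) + 2 * \<nu> k * x) * V k x\<bar> = \<bar>V' k x\<bar> * (\<nu> k * (1 - x\<^sup>2))"
          using \<nu>[OF that(1)] pos[OF that(1) x] by (simp only: abs_mult) simp
        then show ?thesis using bspec[OF bspec[OF C' that(1)] that(2)] by linarith
      qed
    qed (rule ubU ubF2 p2 | assumption)+
    show ?case
    proof (rule unif_bounded_SucI)
      show "unif_bounded 0 K {p'<..<q} V"
        by (rule unif_bounded_0[OF unif_bounded_subset[OF ubV sub']])
      show "(V k has_real_derivative V' k x) (at x)" if "k \<in> K" "x \<in> {p'<..<q}" for k x
        using dV that sub sub' by blast
    qed (rule ubV')
  qed
  then show ?thesis by (simp add: V_def[abs_def])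
qed

lemma unif_bounded_P:
  assumes "\<And>k i. k \<in> K \<Longrightarrow> \<bar>c k $ i\<bar> \<le> M" "I \<subseteq> {-1..1}"
  shows "unif_bounded n K I (\<lambda>k. P (c k))" "unif_bounded n K I (\<lambda>k. dP (c k))"
proof -
  have c: "unif_bounded n K I (\<lambda>k x. c k $ i)" for i by (rule unif_bounded_const) (rule assms(1))
  have one: "unif_bounded n K I (\<lambda>k x. 1)" by (rule unif_bounded_const[where M = 1]) simp
  note id = unif_bounded_ident[OF assms(2)]
  have "unif_bounded n K I (\<lambda>k x. c k $ 1 * (1 - x) + c k $ 2 * (1 + x) + c k $ 3 * (1 - x * x))"
    by (intro unif_bounded_add unif_bounded_mult[OF c] unif_bounded_diff[OF one] unif_bounded_mult[OF id] one id)
  then show "unif_bounded n K I (\<lambda>k. P (c k))" by (simp add: P_def[abs_def] power2_eq_square)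
  have "unif_bounded n K I (\<lambda>k x. - c k $ 1 + c k $ 2 - 2 * c k $ 3 * x)"
    by (intro unif_bounded_add unif_bounded_diff unif_bounded_minus[OF c] c unif_bounded_mult[OF _ id] unif_bounded_cmult[OF c])
  then show "unif_bounded n K I (\<lambda>k. dP (c k))" by (simp add: dP_def[abs_def])
qed

lemma P_limit_eq:
  assumes c: "c$1 \<ge> 0" "c$2 \<ge> 0" "c$3 = c3_star (c$1) (c$2)" "sqrt (c$1) + sqrt (c$2) > 0"
  shows "P c x = (1/2) * ((sqrt (c$1) + sqrt (c$2)) * (x - x_bar c))\<^sup>2"
proof -
  have "(sqrt (c$1) + sqrt (c$2)) * (x - x_bar c) = (sqrt (c$1) + sqrt (c$2)) * x - (sqrt (c$1) - sqrt (c$2))"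
    unfolding x_bar_def right_diff_distrib times_divide_eq_right
    by (simp only: nonzero_mult_div_cancel_left[OF c(4)[THEN less_imp_neq, THEN not_sym]] right_diff_distrib[symmetric])
  also have "\<dots> = sqrt (c$2) * (1 + x) - sqrt (c$1) * (1 - x)" by (simp add: algebra_simps)
  finally show ?thesis using P_square[OF c(1,2), of x] c(3) by simp
qed

text \<open>Away from the zero \<open>x_bar c\<close> of the limit both \<open>\<surd>(2P)\<close> and \<open>U\<close> are bounded below, uniformly for nearby
  parameters. This is the lower bound that the linear theory needs for its coefficients.\<close>

lemma rescaled_error_bounded:
  fixes c :: "real^3"
  assumes c: "c$1 \<ge> 0" "c$2 \<ge> 0" "c$3 = c3_star (c$1) (c$2)" "sqrt (c$1) + sqrt (c$2) > 0"
    and \<epsilon>: "\<epsilon> > 0" "\<And>x. x \<in> {p<..<q} \<Longrightarrow> \<epsilon> \<le> \<bar>x - x_bar c\<bar>" and pq: "-1 \<le> p" "q \<le> 1" and p': "starts_before p p'"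
  obtains \<eta> where "\<eta> > 0"
    "unif_bounded (Suc m) {(\<nu>, c', U). 0 < \<nu> \<and> \<nu> < \<eta> \<and> norm (c' - c) < \<eta> \<and> c' \<in> J 0 \<and> upper_solution \<nu> c' U}
      {p'<..<q} (\<lambda>(\<nu>, c', U) x. (U x - sqrt (2 * P c' x)) / \<nu>)"
proof -
  define S where "S = sqrt (c$1) + sqrt (c$2)"
  define \<delta> where "\<delta> = S\<^sup>2 * \<epsilon>\<^sup>2 / 4"
  have \<delta>: "\<delta> > 0" using c(4) \<epsilon> by (simp add: \<delta>_def S_def)
  define M where "M = norm c + 1"
  have Cpos: "defect_const M > 0"
    unfolding defect_const_def M_def by (intro add_pos_nonneg) auto
  define \<theta> where "\<theta> = sqrt (\<delta> / (2 * defect_const M))"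
  have \<theta>: "\<theta> > 0" using \<delta> Cpos by (simp add: \<theta>_def)
  define d where "d = sqrt \<delta>"
  have d: "d > 0" "d\<^sup>2 = \<delta>" using \<delta> by (simp_all add: d_def)
  define h0 where "h0 = d / 2"
  have h0: "h0 > 0" using d by (simp add: h0_def)
  \<comment> \<open>\<open>\<delta>/5\<close> gives \<open>P \<ge> \<delta>\<close>, \<open>\<theta>\<^sup>3\<close> makes the defect at most \<open>\<delta>/2\<close>, and the last two make the terms of order \<open>\<nu>\<close> in the coefficients harmless.\<close>
  define \<eta> where "\<eta> = Min {1/8, \<delta> / 5, \<theta> ^ 3, h0 / 8, h0 / (2 * real m + 2)}"
  have \<eta>: "\<eta> > 0" using \<delta> \<theta> h0 by (simp add: \<eta>_def)
  have \<eta>_le: "\<eta> \<le> 1/8" "\<eta> \<le> \<delta> / 5" "\<eta> \<le> \<theta> ^ 3" "\<eta> \<le> h0 / 8" "\<eta> \<le> h0 / (2 * real m + 2)"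
    unfolding \<eta>_def by (intro Min_le; simp)+
  define K where "K = {(\<nu>::real, c', U). 0 < \<nu> \<and> \<nu> < \<eta> \<and> norm (c' - c) < \<eta> \<and> c' \<in> J 0 \<and> upper_solution \<nu> c' U}"
  define \<nu> :: "real \<times> (real^3) \<times> (real \<Rightarrow> real) \<Rightarrow> real" where "\<nu> = fst"
  define cc :: "real \<times> (real^3) \<times> (real \<Rightarrow> real) \<Rightarrow> real^3" where "cc k = fst (snd k)" for k
  define U :: "real \<times> (real^3) \<times> (real \<Rightarrow> real) \<Rightarrow> real \<Rightarrow> real" where "U k = snd (snd k)" for k
  have K: "0 < \<nu> k" "\<nu> k < \<eta>" "norm (cc k - c) < \<eta>" "cc k \<in> J 0" "upper_solution (\<nu> k) (cc k) (U k)"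
    if "k \<in> K" for k using that by (auto simp: K_def \<nu>_def cc_def U_def)
  have M: "\<bar>cc k $ i\<bar> \<le> M" if "k \<in> K" for k i
    using component_bound[of "cc k" c i] K(3)[OF that] \<eta>_le(1) by (simp add: M_def)
  define g where "g k x = sqrt (2 * P (cc k) x)" for k x
  define g1 where "g1 k x = dP (cc k) x * inverse (g k x)" for k x
  define g2 where "g2 k x = (- 2 * cc k $ 3 - g1 k x * g1 k x) * inverse (g k x)" for k x
  have sub1: "{p<..<q} \<subseteq> {-1<..<1}" using pq by auto
  have P: "P (cc k) x \<ge> \<delta>" if "k \<in> K" "x \<in> {p<..<q}" for k x
  proof -
    have "\<epsilon>\<^sup>2 \<le> \<bar>x - x_bar c\<bar>\<^sup>2" using \<epsilon> that(2) by (intro power_mono) auto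
    then have "S\<^sup>2 * \<epsilon>\<^sup>2 \<le> S\<^sup>2 * (x - x_bar c)\<^sup>2" by (intro mult_left_mono) auto
    then have "P c x \<ge> 2 * \<delta>" unfolding P_limit_eq[OF c] S_def[symmetric] \<delta>_def by (simp add: power_mult_distrib)
    moreover have "\<bar>P (cc k) x - P c x\<bar> \<le> 5 * norm (cc k - c)" using that(2) sub1 by (intro abs_P_diff_le) force
    ultimately show ?thesis using K(3)[OF that(1)] \<eta>_le(2) by linarith
  qed
  have g_ge: "g k x \<ge> d" and g_sq: "(g k x)\<^sup>2 = 2 * P (cc k) x" if "k \<in> K" "x \<in> {p<..<q}" for k x
    using P[OF that] \<delta> by (auto simp: g_def d_def)
  have defect: "\<bar>defect (cc k) (U k) x\<bar> \<le> \<delta> / 2" if "k \<in> K" "x \<in> {p<..<q}" for k x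
  proof -
    have \<nu>0: "0 < \<nu> k" "\<nu> k \<le> 1/8" using K(1,2)[OF that(1)] \<eta>_le(1) by simp_all
    obtain e where e: "0 < e" "e \<le> 1/2" "\<nu> k = e ^ 3" using cube_root_scale[OF \<nu>0] by metis
    have "e ^ 3 \<le> \<theta> ^ 3" using K(2)[OF that(1)] \<eta>_le(3) e by simp
    then have "e \<le> \<theta>" using \<theta> by (intro power_le_imp_le_base[of e 2 \<theta>]) (auto simp: numeral_3_eq_3 numeral_2_eq_2)
    then have "e\<^sup>2 \<le> \<theta>\<^sup>2" using e by (intro power_mono) auto
    then have "defect_const M * e\<^sup>2 \<le> defect_const M * \<theta>\<^sup>2" using Cpos by (intro mult_left_mono) auto
    also have "\<dots> = \<delta> / 2" using Cpos \<delta> by (simp add: \<theta>_def)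
    finally show ?thesis
      using nondegenerate_defect[OF K(5)[OF that(1)] K(4)[OF that(1)] e(3,1,2) M[OF that(1)], of x] that(2) sub1 by force
  qed
  have U_ge: "U k x \<ge> d" if "k \<in> K" "x \<in> {p<..<q}" for k x
  proof -
    have "(U k x)\<^sup>2 \<ge> d\<^sup>2" using defect[OF that] P[OF that] \<delta> unfolding d(2) by linarith
    moreover have "U k x > 0"
      using P_nonneg[OF K(4)[OF that(1)]] that(2) sub1
      by (intro upper_solution_pos[OF K(5)[OF that(1)] K(1)[OF that(1)], of x]) force+
    ultimately show ?thesis using d power2_le_imp_le less_imp_le by blast
  qed
  have close: "\<bar>U k x - g k x\<bar> \<le> d" if "k \<in> K" "x \<in> {p<..<q}" for k x
  proof -
    have "\<bar>U k x - g k x\<bar> * d \<le> \<bar>U k x - g k x\<bar> * (U k x + g k x)"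
      using U_ge[OF that] g_ge[OF that] d by (intro mult_left_mono) auto
    also have "\<dots> = \<bar>(U k x - g k x) * (U k x + g k x)\<bar>"
      using U_ge[OF that] g_ge[OF that] d by (simp add: abs_mult)
    also have "(U k x - g k x) * (U k x + g k x) = 2 * (defect (cc k) (U k) x)"
      using g_sq[OF that] by (simp add: power2_eq_square algebra_simps)
    also have "\<bar>\<dots>\<bar> \<le> d * d"
    proof -
      have "\<bar>2 * y\<bar> \<le> d * d" if "\<bar>y\<bar> \<le> \<delta> / 2" for y
        using that d(2) by (simp add: power2_eq_square abs_mult)
      then show ?thesis using defect[OF that] .
    qed
    finally show ?thesis using d by simp
  qed
  have dg: "(g k has_real_derivative g1 k x) (at x)" if "k \<in> K" "x \<in> {p<..<q}" for k x
  proof -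
    have "((\<lambda>y. sqrt (2 * P (cc k) y)) has_real_derivative (inverse (sqrt (2 * P (cc k) x)) / 2) * (2 * dP (cc k) x)) (at x)"
      using P[OF that] \<delta> by (intro DERIV_chain2[OF DERIV_real_sqrt] DERIV_cmult P_has_derivative) auto
    then show ?thesis by (simp add: g_def[abs_def] g1_def mult.commute)
  qed
  have dg1: "(g1 k has_real_derivative g2 k x) (at x)" if "k \<in> K" "x \<in> {p<..<q}" for k x
  proof -
    have a: "(dP (cc k) has_real_derivative - 2 * cc k $ 3) (at x)"
      unfolding dP_def by (auto intro!: derivative_eq_intros)
    have b: "((\<lambda>y. inverse (g k y)) has_real_derivative - (inverse (g k x) * g1 k x * inverse (g k x))) (at x)"
      using g_ge[OF that] d by (intro DERIV_inverse' dg that) auto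
    have eq: "g1 k = (\<lambda>y. dP (cc k) y * inverse (g k y))" by (rule ext) (simp only: g1_def)
    have "- 2 * cc k $ 3 * inverse (g k x) + - (inverse (g k x) * g1 k x * inverse (g k x)) * dP (cc k) x = g2 k x"
      unfolding g2_def g1_def by (simp add: algebra_simps)
    then show ?thesis using DERIV_mult[OF a b] by (simp only: eq)
  qed
  have ubP: "unif_bounded n K {p<..<q} (\<lambda>k. P (cc k))" "unif_bounded n K {p<..<q} (\<lambda>k. dP (cc k))" for n
    using sub1 by (intro unif_bounded_P[OF M]; force)+
  have ubg: "unif_bounded n K {p<..<q} g" for n
    unfolding g_def
    by (rule unif_bounded_sqrt[OF unif_bounded_cmult[OF ubP(1)], of "2 * \<delta>"]) (use P \<delta> in auto)
  have ubi: "unif_bounded n K {p<..<q} (\<lambda>k x. inverse (g k x))" for n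
    by (rule unif_bounded_inverse[OF ubg d(1) g_ge])
  have ubg1: "unif_bounded n K {p<..<q} g1" for n
    unfolding g1_def by (rule unif_bounded_mult[OF ubP(2) ubi])
  have c3: "unif_bounded n K {p<..<q} (\<lambda>k x. cc k $ 3)" for n by (rule unif_bounded_const) (rule M)
  have ubg2: "unif_bounded n K {p<..<q} g2" for n
    unfolding g2_def
    by (intro unif_bounded_mult[OF _ ubi] unif_bounded_diff unif_bounded_mult[OF ubg1 ubg1] unif_bounded_cmult[OF c3])
  have "unif_bounded (Suc m) K {p'<..<q} (\<lambda>k x. (U k x - g k x) / \<nu> k)"
  proof (rule riccati_unif_bounded[OF pq h0 _ _ _ dg dg1 ubg ubg1 ubg2 _ _ close order_refl p', where U' = "\<lambda>k x. deriv (U k) x"])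
    show "0 < \<nu> k \<and> \<nu> k \<le> h0 / 8" if "k \<in> K" for k using K(1,2)[OF that] \<eta>_le(4) by simp
    fix k x assume k: "k \<in> K" and x: "x \<in> {p<..<q}"
    have x1: "-1 < x" "x < 1" using x sub1 by auto
    have sol: "ode_solution (\<nu> k) (cc k) (U k)" using K(5)[OF k] by (simp add: upper_solution_def)
    show "(U k has_real_derivative deriv (U k) x) (at x)" by (rule ode_solution_deriv[OF sol x1])
    show "\<nu> k * (1 - x\<^sup>2) * deriv (U k) x + 2 * \<nu> k * x * U k x + 1/2 * (U k x)\<^sup>2 = 1/2 * (g k x)\<^sup>2"
      unfolding ode_solution_eq[OF sol x1] g_sq[OF k x] by simp
    have "\<nu> k * (2 * real m + 2) \<le> \<eta> * (2 * real m + 2)" using K(2)[OF k] by (intro mult_right_mono) auto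
    also have "\<dots> \<le> h0" using \<eta>_le(5) by (simp add: pos_le_divide_eq)
    finally have "\<nu> k * (2 * real m + 2) \<le> h0" .
    then show "h0 + 2 * real m * \<nu> k \<le> U k x"
      using U_ge[OF k x] K(1)[OF k] unfolding h0_def by (simp add: algebra_simps)
    have "\<nu> k * (- x) \<le> \<nu> k * 1" using x1 K(1)[OF k] by (intro mult_left_mono) auto
    moreover have "2 * \<nu> k \<le> h0" using K(2)[OF k] \<eta>_le(4) h0 by simp
    ultimately show "h0 \<le> 1/2 * (U k x + g k x) + 2 * \<nu> k * x"
      using U_ge[OF k x] g_ge[OF k x] unfolding h0_def by (simp add: algebra_simps)
  qed
  moreover have "(\<lambda>k x. (U k x - g k x) / \<nu> k) = (\<lambda>(\<nu>, c', U) x. (U x - sqrt (2 * P c' x)) / \<nu>)"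
    by (auto simp: U_def g_def \<nu>_def cc_def)
  ultimately show ?thesis using that[OF \<eta>] unfolding K_def by simp
qed

section \<open>Norms of functions with continuous derivatives\<close>

lemma vector_derivative_within_eq:
  assumes "(f has_real_derivative d) (at x within S)" "at x within S \<noteq> bot"
  shows "vector_derivative f (at x within S) = d"
  using assms by (simp add: vector_derivative_within has_real_derivative_iff_has_vector_derivative)

text \<open>The derivatives within \<open>S\<close> are unambiguous as \<open>S\<close> has no isolated points.\<close>

lemma deriv_within_eq:
  assumes D: "\<And>i x. i < m \<Longrightarrow> x \<in> S \<Longrightarrow> (D i has_real_derivative D (Suc i) x) (at x within S)"
    and S: "\<And>x. x \<in> S \<Longrightarrow> at x within S \<noteq> bot" and f: "\<And>x. x \<in> S \<Longrightarrow> f x = D 0 x"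
  shows "i \<le> m \<Longrightarrow> x \<in> S \<Longrightarrow> deriv_within S i f x = D i x"
proof (induction i arbitrary: x)
  case 0
  then show ?case by (simp add: deriv_within_def f)
next
  case (Suc i)
  have "(deriv_within S i f has_real_derivative D (Suc i) x) (at x within S)"
  proof (rule has_field_derivative_transform_within[OF D zero_less_one])
    show "D i y = deriv_within S i f y" if "y \<in> S" for y
      using Suc.IH[OF _ that] Suc.prems(1) by simp
  qed (use Suc.prems in auto)
  from vector_derivative_within_eq[OF this S[OF Suc.prems(2)]] show ?case
    by (simp add: deriv_within_def)
qed

lemma Cm_norm_le:
  assumes D: "\<And>i x. i < m \<Longrightarrow> x \<in> S \<Longrightarrow> (D i has_real_derivative D (Suc i) x) (at x within S)"
    and S: "\<And>x. x \<in> S \<Longrightarrow> at x within S \<noteq> bot" and f: "\<And>x. x \<in> S \<Longrightarrow> f x = D 0 x"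
    and cont: "continuous_on S (D m)" and B: "\<And>i x. i \<le> m \<Longrightarrow> x \<in> S \<Longrightarrow> \<bar>D i x\<bar> \<le> B" and B0: "B \<ge> 0"
  shows "Cm_norm m S f \<le> ennreal (real (Suc m) * B)"
proof -
  have eq: "deriv_within S i f x = D i x" if "i \<le> m" "x \<in> S" for i x
    by (rule deriv_within_eq[of m S D f]) (use D S f that in auto)
  have "Cm_on m S f" unfolding Cm_on_def
  proof (intro conjI allI impI)
    show "continuous_on S (deriv_within S m f)"
      by (rule continuous_on_eq[OF cont]) (simp add: eq)
    fix i assume i: "i < m"
    show "deriv_within S i f differentiable_on S" unfolding differentiable_on_def
    proof
      fix x assume x: "x \<in> S"
      have "(deriv_within S i f has_real_derivative D (Suc i) x) (at x within S)"
      proof (rule has_field_derivative_transform_within[OF D[OF i x] zero_less_one x])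
        show "D i y = deriv_within S i f y" if "y \<in> S" for y using eq[OF less_imp_le[OF i] that] by simp
      qed
      then show "deriv_within S i f differentiable (at x within S)"
        using real_differentiable_def by blast
    qed
  qed
  then have "Cm_norm m S f = (\<Sum>i\<le>m. sup_norm S (deriv_within S i f))" by (simp add: Cm_norm_def)
  also have "\<dots> \<le> (\<Sum>i\<le>m. ennreal B)"
  proof (intro sum_mono)
    fix i assume i: "i \<in> {..m}"
    show "sup_norm S (deriv_within S i f) \<le> ennreal B"
      unfolding sup_norm_def
    proof (intro SUP_least ennreal_leI)
      fix x assume x: "x \<in> S"
      show "\<bar>deriv_within S i f x\<bar> \<le> B" using eq[OF _ x, of i] B[of i x] i x by simp
    qed
  qed
  also have "\<dots> = ennreal (\<Sum>i\<le>m. B)" using B0 by (subst sum_ennreal) auto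
  finally show ?thesis by simp
qed

text \<open>Bounded derivatives up to order \<open>m + 1\<close> on an open interval give one-sided derivatives up to order
  \<open>m\<close> at its left endpoint: they are Lipschitz, hence have limits there, and l'Hopital's rule
  identifies these with one-sided derivatives.\<close>

lemma extend_derivatives_left:
  fixes D :: "nat \<Rightarrow> real \<Rightarrow> real"
  assumes ab: "a < b" and D: "\<And>i x. i \<le> m \<Longrightarrow> a < x \<Longrightarrow> x < b \<Longrightarrow> (D i has_real_derivative D (Suc i) x) (at x)"
    and B: "\<And>i x. i \<le> Suc m \<Longrightarrow> a < x \<Longrightarrow> x < b \<Longrightarrow> \<bar>D i x\<bar> \<le> B"
    and lim0: "(D 0 \<longlongrightarrow> D 0 a) (at_right a)"
  shows "\<exists>E. E 0 = D 0 \<and> (\<forall>i x. x \<noteq> a \<longrightarrow> E i x = D i x) \<and>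
    (\<forall>i\<le>m. (E i \<longlongrightarrow> E i a) (at_right a) \<and> \<bar>E i a\<bar> \<le> B) \<and>
    (\<forall>i<m. (E i has_real_derivative E (Suc i) a) (at a within {a..}))"
proof -
  have near: "\<forall>\<^sub>F x in at_right a. x \<in> {a<..<b}" by (rule eventually_at_right_real[OF ab])
  have "\<exists>l. (D i \<longlongrightarrow> l) (at_right a)" if i: "i \<le> m" for i
  proof -
    have B0: "B \<ge> 0" using B[of 0 "(a + b) / 2"] ab by auto
    have lip: "\<bar>D i x - D i y\<bar> \<le> B * \<bar>x - y\<bar>" if "x \<in> {a<..<b}" "y \<in> {a<..<b}" for x y
    proof -
      have "norm (D i x - D i y) \<le> B * norm (x - y)"
      proof (rule field_differentiable_bound[where f' = "D (Suc i)" and S = "{a<..<b}"])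
        fix z assume z: "z \<in> {a<..<b}"
        show "(D i has_real_derivative D (Suc i) z) (at z within {a<..<b})"
          using D[OF i] z by (auto intro: has_field_derivative_at_within)
        show "norm (D (Suc i) z) \<le> B" using B[of "Suc i" z] i z by auto
      qed (use that in auto)
      then show ?thesis by simp
    qed
    have "uniformly_continuous_on {a<..<b} (D i)"
      unfolding uniformly_continuous_on_def
    proof (intro allI impI)
      fix e :: real assume e: "e > 0"
      show "\<exists>d>0. \<forall>x\<in>{a<..<b}. \<forall>x'\<in>{a<..<b}. dist x' x < d \<longrightarrow> dist (D i x') (D i x) < e"
      proof (intro exI[of _ "e / (B + 1)"] conjI ballI impI)
        show "e / (B + 1) > 0" using e B0 by simp
        fix x x' assume x: "x \<in> {a<..<b}" "x' \<in> {a<..<b}" and d: "dist x' x < e / (B + 1)"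
        have "dist (D i x') (D i x) \<le> B * \<bar>x' - x\<bar>" using lip[OF x(2,1)] by (simp add: dist_real_def)
        also have "\<dots> \<le> (B + 1) * \<bar>x' - x\<bar>" by (intro mult_right_mono) auto
        also have "\<dots> < e" using d B0 by (simp add: dist_real_def pos_less_divide_eq mult.commute)
        finally show "dist (D i x') (D i x) < e" .
      qed
    qed
    moreover have "a \<in> closure {a<..<b}" using ab by simp
    ultimately obtain l where "(D i \<longlongrightarrow> l) (at a within {a<..<b})"
      by (rule uniformly_continuous_on_extension_at_closure)
    moreover have "at a within {a<..<b} = at_right a"
      by (rule at_within_nhd[of _ "{..<b}"]) (use ab in auto)
    ultimately show ?thesis by auto
  qed
  then obtain L where L: "\<And>i. i \<le> m \<Longrightarrow> (D i \<longlongrightarrow> L i) (at_right a)" by metis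
  define E where "E i = (if i = 0 then D 0 else (D i)(a := L i))" for i
  have E0: "E 0 = D 0" by (simp add: E_def)
  have Ene: "E i x = D i x" if "x \<noteq> a" for i x using that by (simp add: E_def)
  have E_lim: "(E i \<longlongrightarrow> E i a) (at_right a)" if i: "i \<le> m" for i
  proof (cases "i = 0")
    case False
    have "\<forall>\<^sub>F x in at_right a. D i x = E i x" using near by eventually_elim (simp add: Ene)
    from Lim_transform_eventually[OF L[OF i] this] show ?thesis using False by (simp add: E_def fun_upd_def)
  qed (use lim0 in \<open>simp add: E_def\<close>)
  have E_bound: "\<bar>E i a\<bar> \<le> B" if i: "i \<le> m" for i
  proof (rule tendsto_upperbound[OF tendsto_rabs[OF E_lim[OF i]]])
    show "\<forall>\<^sub>F x in at_right a. \<bar>E i x\<bar> \<le> B" using near by eventually_elim (use B i Ene in auto)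
  qed simp
  have E_der: "(E i has_real_derivative E (Suc i) a) (at a within {a..})" if i: "i < m" for i
  proof -
    have "((\<lambda>x. (E i x - E i a) / (x - a)) \<longlongrightarrow> E (Suc i) a) (at_right a)"
    proof (rule lhopital_right[where f' = "E (Suc i)" and g' = "\<lambda>_. 1"])
      show "((\<lambda>x. E i x - E i a) \<longlongrightarrow> 0) (at_right a)"
        using tendsto_diff[OF E_lim[of i] tendsto_const[of "E i a"]] i by simp
      show "((\<lambda>x. x - a) \<longlongrightarrow> 0) (at_right a)"
        using tendsto_diff[OF tendsto_ident_at[of a "{a<..}"] tendsto_const[of a]] by simp
      show "\<forall>\<^sub>F x in at_right a. x - a \<noteq> 0" using near by eventually_elim auto
      show "\<forall>\<^sub>F x in at_right a. ((\<lambda>x. E i x - E i a) has_real_derivative E (Suc i) x) (at x)"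
        using near
      proof eventually_elim
        case (elim x)
        have "(D i has_real_derivative E (Suc i) x) (at x)" using D[of i x] i elim Ene[of x "Suc i"] by auto
        then have "(E i has_real_derivative E (Suc i) x) (at x)"
          by (rule has_field_derivative_transform_within_open[OF _ open_greaterThanLessThan[of a b] elim]) (simp add: Ene)
        from DERIV_diff[OF this DERIV_const[of "E i a"]] show ?case by simp
      qed
      show "\<forall>\<^sub>F x in at_right a. ((\<lambda>x. x - a) has_real_derivative 1) (at x)"
        by (intro always_eventually allI) (auto intro!: derivative_eq_intros)
      show "((\<lambda>x. E (Suc i) x / 1) \<longlongrightarrow> E (Suc i) a) (at_right a)" using E_lim[of "Suc i"] i by simp
    qed simp
    moreover have "at a within {a..} = at_right a" by (rule at_within_nhd[of _ UNIV]) auto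
    ultimately show ?thesis unfolding has_field_derivative_iff by simp
  qed
  show ?thesis by (rule exI[of _ E]) (use E0 Ene E_lim E_bound E_der in blast)
qed

text \<open>The derivatives are given explicitly, as they are transformed more easily under reflection and
  gluing than iterated derivatives.\<close>

definition Cm_bounded :: "nat \<Rightarrow> real set \<Rightarrow> (real \<Rightarrow> real) \<Rightarrow> real \<Rightarrow> bool" where
  "Cm_bounded m S f B \<longleftrightarrow> (\<exists>D. (\<forall>x\<in>S. f x = D 0 x) \<and>
     (\<forall>i<m. \<forall>x\<in>S. (D i has_real_derivative D (Suc i) x) (at x within S)) \<and>
     continuous_on S (D m) \<and> (\<forall>i\<le>m. \<forall>x\<in>S. \<bar>D i x\<bar> \<le> B))"

lemma Cm_bounded_norm:
  assumes "Cm_bounded m S f B" "\<And>x. x \<in> S \<Longrightarrow> at x within S \<noteq> bot" "B \<ge> 0"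
  shows "Cm_norm m S f \<le> ennreal (real (Suc m) * B)"
proof -
  obtain D where D: "\<forall>x\<in>S. f x = D 0 x"
    "\<forall>i<m. \<forall>x\<in>S. (D i has_real_derivative D (Suc i) x) (at x within S)"
    "continuous_on S (D m)" "\<forall>i\<le>m. \<forall>x\<in>S. \<bar>D i x\<bar> \<le> B"
    using assms(1) unfolding Cm_bounded_def by metis
  show ?thesis
    by (rule Cm_norm_le[where D = D]) (use D assms(2,3) in auto)
qed

lemma Cm_bounded_reflect:
  assumes "Cm_bounded m S f B"
  shows "Cm_bounded m (uminus ` S) (\<lambda>x. - f (- x)) B"
proof -
  obtain D where D: "\<forall>x\<in>S. f x = D 0 x"
    "\<forall>i<m. \<forall>x\<in>S. (D i has_real_derivative D (Suc i) x) (at x within S)"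
    "continuous_on S (D m)" "\<forall>i\<le>m. \<forall>x\<in>S. \<bar>D i x\<bar> \<le> B"
    using assms(1) unfolding Cm_bounded_def by metis
  define E where "E i x = (-1) ^ Suc i * D i (- x)" for i and x :: real
  have img: "uminus ` uminus ` S = S" by (simp add: image_image)
  have "(E i has_real_derivative E (Suc i) x) (at x within uminus ` S)" if i: "i < m" and x: "x \<in> uminus ` S" for i x
  proof -
    have "- x \<in> S" using x by auto
    then have "(D i has_real_derivative D (Suc i) (- x)) (at (- x) within S)" using D(2) i by blast
    then have "(D i has_real_derivative D (Suc i) (- x)) (at (- x) within uminus ` uminus ` S)" by (simp only: img)
    moreover have "(uminus has_real_derivative -1) (at x within uminus ` S)"
      by (auto intro!: derivative_eq_intros)
    ultimately have "(D i \<circ> uminus has_real_derivative D (Suc i) (- x) * -1) (at x within uminus ` S)"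
      by (rule DERIV_image_chain)
    from DERIV_cmult[OF this, of "(-1) ^ Suc i"] show ?thesis
      by (simp add: E_def[abs_def] o_def)
  qed
  moreover have "continuous_on (uminus ` S) (E m)"
  proof -
    have "continuous_on (uminus ` S) (uminus :: real \<Rightarrow> real)" by (intro continuous_intros)
    then have "continuous_on (uminus ` S) (\<lambda>x. D m (- x))"
      by (rule continuous_on_compose2[OF D(3)]) auto
    then show ?thesis unfolding E_def by (intro continuous_on_mult_left)
  qed
  moreover have "\<bar>E i x\<bar> \<le> B" if "i \<le> m" "x \<in> uminus ` S" for i x
    using D(4) that by (auto simp: E_def abs_mult power_abs)
  moreover have "- f (- x) = E 0 x" if "x \<in> uminus ` S" for x
    using D(1) that by (auto simp: E_def)
  ultimately show ?thesis unfolding Cm_bounded_def by (intro exI[of _ E]) blast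
qed

definition outer_set :: "real \<Rightarrow> real \<Rightarrow> real set" where
  "outer_set \<epsilon> b = {-1..1-\<epsilon>} - {b - \<epsilon>..b + \<epsilon>}"

lemma outer_set_cases:
  assumes "x \<in> outer_set \<epsilon> b" "-1 \<le> b" "b \<le> 1" "\<epsilon> > 0"
  shows "(-1 \<le> x \<and> x < b - \<epsilon>) \<or> (b + \<epsilon> < x \<and> x \<le> 1 - \<epsilon>)"
  using assms by (auto simp: outer_set_def)

lemma outer_set_no_isolated:
  assumes "x \<in> outer_set \<epsilon> b" "-1 \<le> b" "b \<le> 1" "\<epsilon> > 0"
  shows "at x within outer_set \<epsilon> b \<noteq> bot"
proof -
  have "x islimpt outer_set \<epsilon> b"
    using outer_set_cases[OF assms]
  proof
    assume x: "-1 \<le> x \<and> x < b - \<epsilon>"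
    then have "x islimpt {x<..<b - \<epsilon>}" by (intro islimpt_greaterThanLessThan1) simp
    moreover have "{x<..<b - \<epsilon>} \<subseteq> outer_set \<epsilon> b" using x assms by (auto simp: outer_set_def)
    ultimately show ?thesis by (rule islimpt_subset)
  next
    assume x: "b + \<epsilon> < x \<and> x \<le> 1 - \<epsilon>"
    then have "x islimpt {b + \<epsilon><..<x}" by (intro islimpt_greaterThanLessThan2) simp
    moreover have "{b + \<epsilon><..<x} \<subseteq> outer_set \<epsilon> b" using x assms by (auto simp: outer_set_def)
    ultimately show ?thesis by (rule islimpt_subset)
  qed
  then show ?thesis by (simp add: trivial_limit_within)
qed

text \<open>The two components of the set are handled separately; only the left one contains an endpoint at
  which the equation is singular.\<close>

lemma outer_set_bounded:
  fixes D1 D2 :: "nat \<Rightarrow> real \<Rightarrow> real"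
  assumes b: "-1 \<le> b" "b \<le> 1" and \<epsilon>: "\<epsilon> > 0" and D0: "D1 0 = f" "D2 0 = f"
    and D1: "\<And>i x. i \<le> m \<Longrightarrow> -1 < x \<Longrightarrow> x < b - \<epsilon> \<Longrightarrow> (D1 i has_real_derivative D1 (Suc i) x) (at x)"
    and B1: "\<And>i x. i \<le> Suc m \<Longrightarrow> -1 < x \<Longrightarrow> x < b - \<epsilon> \<Longrightarrow> \<bar>D1 i x\<bar> \<le> B"
    and D2: "\<And>i x. i \<le> m \<Longrightarrow> b + \<epsilon> < x \<Longrightarrow> x < 1 \<Longrightarrow> (D2 i has_real_derivative D2 (Suc i) x) (at x)"
    and B2: "\<And>i x. i \<le> Suc m \<Longrightarrow> b + \<epsilon> < x \<Longrightarrow> x < 1 \<Longrightarrow> \<bar>D2 i x\<bar> \<le> B"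
    and lim: "(f \<longlongrightarrow> f (-1)) (at_right (-1))"
  shows "Cm_bounded m (outer_set \<epsilon> b) f B"
proof -
  define S where "S = outer_set \<epsilon> b"
  have "\<exists>E. E 0 = f \<and> (\<forall>i x. -1 < x \<longrightarrow> x < b - \<epsilon> \<longrightarrow> E i x = D1 i x) \<and>
      (-1 < b - \<epsilon> \<longrightarrow> (\<forall>i\<le>m. (E i \<longlongrightarrow> E i (-1)) (at_right (-1)) \<and> \<bar>E i (-1)\<bar> \<le> B) \<and>
        (\<forall>i<m. (E i has_real_derivative E (Suc i) (-1)) (at (-1) within {-1..})))"
  proof (cases "-1 < b - \<epsilon>")
    case True
    have l: "(D1 0 \<longlongrightarrow> D1 0 (-1)) (at_right (-1))" using lim by (simp add: D0)
    have "\<exists>E. E 0 = D1 0 \<and> (\<forall>i x. x \<noteq> -1 \<longrightarrow> E i x = D1 i x) \<and>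
      (\<forall>i\<le>m. (E i \<longlongrightarrow> E i (-1)) (at_right (-1)) \<and> \<bar>E i (-1)\<bar> \<le> B) \<and>
      (\<forall>i<m. (E i has_real_derivative E (Suc i) (-1)) (at (-1) within {-1..}))"
      by (rule extend_derivatives_left[OF True D1 B1 l])
    then obtain E where E: "E 0 = D1 0" "\<forall>i x. x \<noteq> -1 \<longrightarrow> E i x = D1 i x"
      "\<forall>i\<le>m. (E i \<longlongrightarrow> E i (-1)) (at_right (-1)) \<and> \<bar>E i (-1)\<bar> \<le> B"
      "\<forall>i<m. (E i has_real_derivative E (Suc i) (-1)) (at (-1) within {-1..})"
      by (elim exE conjE)
    show ?thesis by (rule exI[of _ E]) (auto simp: D0 E)
  qed (auto intro!: exI[of _ D1] simp: D0)
  then obtain E where E0: "E 0 = f" and E_eq: "\<And>i x. -1 < x \<Longrightarrow> x < b - \<epsilon> \<Longrightarrow> E i x = D1 i x"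
    and E_lim: "\<And>i. -1 < b - \<epsilon> \<Longrightarrow> i \<le> m \<Longrightarrow> (E i \<longlongrightarrow> E i (-1)) (at_right (-1)) \<and> \<bar>E i (-1)\<bar> \<le> B"
    and E_der: "\<And>i. -1 < b - \<epsilon> \<Longrightarrow> i < m \<Longrightarrow> (E i has_real_derivative E (Suc i) (-1)) (at (-1) within {-1..})"
    by metis
  define D where "D i x = (if x < b then E i x else D2 i x)" for i x
  have S_sub: "S \<subseteq> {-1..}" by (auto simp: S_def outer_set_def)
  have cases: "(-1 \<le> x \<and> x < b - \<epsilon>) \<or> (b + \<epsilon> < x \<and> x \<le> 1 - \<epsilon>)" if "x \<in> S" for x
    using outer_set_cases[of x \<epsilon> b] that b \<epsilon> by (simp add: S_def)
  have D1E: "(E i has_real_derivative E (Suc i) x) (at x)" if "i \<le> m" "-1 < x" "x < b - \<epsilon>" for i x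
    unfolding E_eq[OF that(2,3)]
    by (rule has_field_derivative_transform_within_open[OF D1[OF that] open_greaterThanLessThan[of "-1" "b - \<epsilon>"]])
       (use that E_eq in auto)
  have E1: "(E i has_real_derivative E (Suc i) x) (at x within S)" if "i < m" "-1 \<le> x" "x < b - \<epsilon>" for i x
  proof (cases "x = -1")
    case True
    then show ?thesis using E_der[of i] that S_sub by (auto intro: has_field_derivative_subset)
  next
    case False
    then show ?thesis using D1E[of i x] that by (auto intro: has_field_derivative_at_within)
  qed
  have C1: "continuous (at x within S) (E m)" if "-1 \<le> x" "x < b - \<epsilon>" for x
  proof (cases "x = -1")
    case True
    have "at (-1) within {-1..} = at_right (-1::real)" by (rule at_within_nhd[of _ UNIV]) auto
    then have "continuous (at x within {-1..}) (E m)"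
      using E_lim[of m] that True by (simp add: continuous_within)
    then show ?thesis using S_sub continuous_within_subset by blast
  next
    case False
    then have "isCont (E m) x" using D1E[of m x] that by (auto intro: DERIV_isCont)
    then show ?thesis by (rule continuous_at_imp_continuous_at_within)
  qed
  have near1: "E i y = D i y" if "dist y x < b - \<epsilon> - x" for i x y
    using that \<epsilon> by (auto simp: D_def dist_real_def)
  have near2: "D2 i y = D i y" if "dist y x < x - (b + \<epsilon>)" for i x y
    using that \<epsilon> by (auto simp: D_def dist_real_def)
  have der: "(D i has_real_derivative D (Suc i) x) (at x within S)" if i: "i < m" and x: "x \<in> S" for i x
    using cases[OF x]
  proof
    assume x1: "-1 \<le> x \<and> x < b - \<epsilon>"
    have "(E i has_real_derivative D (Suc i) x) (at x within S)"
      using E1[OF i, of x] x1 near1[of x x "Suc i"] by simp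
    then show ?thesis
      by (rule has_field_derivative_transform_within[where d = "b - \<epsilon> - x"]) (use x x1 near1 in auto)
  next
    assume x2: "b + \<epsilon> < x \<and> x \<le> 1 - \<epsilon>"
    have "(D2 i has_real_derivative D (Suc i) x) (at x within S)"
      using D2[of i x] i x2 \<epsilon> near2[of x x "Suc i"] by (auto intro: has_field_derivative_at_within)
    then show ?thesis
      by (rule has_field_derivative_transform_within[where d = "x - (b + \<epsilon>)"]) (use x x2 near2 in auto)
  qed
  have cont: "continuous_on S (D m)"
    unfolding continuous_on_eq_continuous_within
  proof
    fix x assume x: "x \<in> S"
    show "continuous (at x within S) (D m)"
      using cases[OF x]
    proof
      assume x1: "-1 \<le> x \<and> x < b - \<epsilon>"
      show ?thesis
        by (rule continuous_transform_within[OF C1, of x "b - \<epsilon> - x"]) (use x x1 near1 in auto)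
    next
      assume x2: "b + \<epsilon> < x \<and> x \<le> 1 - \<epsilon>"
      have "isCont (D2 m) x" using D2[of m x] x2 \<epsilon> by (auto intro: DERIV_isCont)
      then have "continuous (at x within S) (D2 m)" by (rule continuous_at_imp_continuous_at_within)
      then show ?thesis
        by (rule continuous_transform_within[of x S _ "x - (b + \<epsilon>)"]) (use x x2 near2 in auto)
    qed
  qed
  have bound: "\<bar>D i x\<bar> \<le> B" if i: "i \<le> m" and x: "x \<in> S" for i x
    using cases[OF x]
  proof
    assume x1: "-1 \<le> x \<and> x < b - \<epsilon>"
    have "\<bar>E i x\<bar> \<le> B"
    proof (cases "x = -1")
      case True
      then show ?thesis using E_lim[of i] i x1 by simp
    next
      case False
      then show ?thesis using E_eq[of x i] B1[of i x] i x1 by simp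
    qed
    then show ?thesis using near1[of x x i] x1 by simp
  next
    assume x2: "b + \<epsilon> < x \<and> x \<le> 1 - \<epsilon>"
    then show ?thesis using near2[of x x i] B2[of i x] i \<epsilon> by simp
  qed
  have "f x = D 0 x" for x by (simp add: D_def E0 D0)
  then show ?thesis unfolding Cm_bounded_def S_def[symmetric]
    using der cont bound by (intro exI[of _ D]) blast
qed

lemma x_bar_range:
  assumes "c$1 \<ge> 0" "c$2 \<ge> 0"
  shows "-1 \<le> x_bar c" "x_bar c \<le> 1"
proof -
  have s: "sqrt (c$1) \<ge> 0" "sqrt (c$2) \<ge> 0" using assms by simp_all
  have "\<bar>x_bar c\<bar> \<le> 1"
    unfolding x_bar_def abs_divide using s
    by (cases "sqrt (c$1) + sqrt (c$2) = 0") (auto simp: divide_le_eq_1 abs_le_iff)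
  then show "-1 \<le> x_bar c" "x_bar c \<le> 1" by (auto simp: abs_le_iff)
qed

lemma Cm_estimate_upper:
  fixes c :: "real^3"
  assumes c: "c$1 \<ge> 0" "c$2 \<ge> 0" "c$3 = c3_star (c$1) (c$2)" "sqrt (c$1) + sqrt (c$2) > 0" and \<epsilon>: "\<epsilon> > 0"
  obtains \<eta> C where "\<eta> > 0" "C \<ge> 0"
    "\<forall>\<nu> c' U. 0 < \<nu> \<and> \<nu> < \<eta> \<and> norm (c' - c) < \<eta> \<and> c' \<in> J 0 \<and> upper_solution \<nu> c' U \<longrightarrow>
      Cm_bounded m (outer_set \<epsilon> (x_bar c)) (\<lambda>x. U x - sqrt (2 * P c' x)) (C * \<nu>)"
proof -
  define b where "b = x_bar c"
  have b: "-1 \<le> b" "b \<le> 1" using x_bar_range[OF c(1,2)] by (simp_all add: b_def)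
  define K where "K \<eta> = {(\<nu>, c', U). 0 < \<nu> \<and> \<nu> < \<eta> \<and> norm (c' - c) < \<eta> \<and> c' \<in> J 0 \<and> upper_solution \<nu> c' U}"
    for \<eta> :: real
  define V where "V = (\<lambda>(\<nu>::real, c', U) x. (U x - sqrt (2 * P c' x)) / \<nu>)"
  obtain \<eta>1 where e1: "\<eta>1 > 0" "unif_bounded (Suc m) (K \<eta>1) {-1<..<b - \<epsilon>} V"
    unfolding K_def V_def
    by (rule rescaled_error_bounded[OF c, of \<epsilon> "-1" "b - \<epsilon>" "-1" m])
       (use \<epsilon> b in \<open>auto simp: b_def starts_before_def\<close>)
  obtain \<eta>2 where e2: "\<eta>2 > 0" "unif_bounded (Suc m) (K \<eta>2) {b + \<epsilon><..<1} V"
    unfolding K_def V_def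
    by (rule rescaled_error_bounded[OF c, of "\<epsilon>/2" "b + \<epsilon>/2" 1 "b + \<epsilon>" m])
       (use \<epsilon> b in \<open>auto simp: b_def starts_before_def\<close>)
  obtain D1 B1 where D1: "D1 0 = V"
    "\<forall>i k x. i < Suc m \<longrightarrow> k \<in> K \<eta>1 \<longrightarrow> x \<in> {-1<..<b - \<epsilon>} \<longrightarrow> (D1 i k has_real_derivative D1 (Suc i) k x) (at x)"
    "\<forall>i k x. i \<le> Suc m \<longrightarrow> k \<in> K \<eta>1 \<longrightarrow> x \<in> {-1<..<b - \<epsilon>} \<longrightarrow> \<bar>D1 i k x\<bar> \<le> B1"
    by (rule unif_bounded_derivatives[OF e1(2)])
  obtain D2 B2 where D2: "D2 0 = V"
    "\<forall>i k x. i < Suc m \<longrightarrow> k \<in> K \<eta>2 \<longrightarrow> x \<in> {b + \<epsilon><..<1} \<longrightarrow> (D2 i k has_real_derivative D2 (Suc i) k x) (at x)"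
    "\<forall>i k x. i \<le> Suc m \<longrightarrow> k \<in> K \<eta>2 \<longrightarrow> x \<in> {b + \<epsilon><..<1} \<longrightarrow> \<bar>D2 i k x\<bar> \<le> B2"
    by (rule unif_bounded_derivatives[OF e2(2)])
  define \<eta> where "\<eta> = min \<eta>1 \<eta>2"
  define C where "C = max 0 (max B1 B2)"
  have "Cm_bounded m (outer_set \<epsilon> b) (\<lambda>x. U x - sqrt (2 * P c' x)) (C * \<nu>)"
    if h: "0 < \<nu>" "\<nu> < \<eta>" "norm (c' - c) < \<eta>" "c' \<in> J 0" "upper_solution \<nu> c' U" for \<nu> c' U
  proof -
    define k where "k = (\<nu>, c', U)"
    have k: "k \<in> K \<eta>1" "k \<in> K \<eta>2" using h by (auto simp: k_def K_def \<eta>_def)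
    define f where "f x = U x - sqrt (2 * P c' x)" for x
    have V: "\<nu> * V k x = f x" for x using h(1) by (simp add: V_def k_def f_def)
    have BC: "\<bar>\<nu> * z\<bar> \<le> C * \<nu>" if "\<bar>z\<bar> \<le> B1 \<or> \<bar>z\<bar> \<le> B2" for z
    proof -
      have "\<bar>z\<bar> \<le> C" using that by (auto simp: C_def)
      then have "\<nu> * \<bar>z\<bar> \<le> \<nu> * C" using h(1) by (intro mult_left_mono) auto
      then show ?thesis using h(1) by (simp add: abs_mult mult.commute)
    qed
    have cU: "continuous_on {-1..1} U" using h(5) by (simp add: upper_solution_def)
    have "continuous_on {-1..1} f" unfolding f_def by (intro continuous_intros cU)
    then have lim: "(f \<longlongrightarrow> f (-1)) (at_right (-1))" by (simp add: continuous_on_Icc_at_rightD)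
    have "Cm_bounded m (outer_set \<epsilon> b) f (C * \<nu>)"
    proof (rule outer_set_bounded[OF b \<epsilon> _ _ _ _ _ _ lim, where ?D1.0 = "\<lambda>i x. \<nu> * D1 i k x" and ?D2.0 = "\<lambda>i x. \<nu> * D2 i k x"])
      show "(\<lambda>x. \<nu> * D1 0 k x) = f" "(\<lambda>x. \<nu> * D2 0 k x) = f" by (auto simp: D1(1) D2(1) V)
      show "((\<lambda>x. \<nu> * D1 i k x) has_real_derivative \<nu> * D1 (Suc i) k x) (at x)"
        if "i \<le> m" "-1 < x" "x < b - \<epsilon>" for i x
        by (intro DERIV_cmult D1(2)[rule_format]) (use k(1) that in simp_all)
      show "((\<lambda>x. \<nu> * D2 i k x) has_real_derivative \<nu> * D2 (Suc i) k x) (at x)"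
        if "i \<le> m" "b + \<epsilon> < x" "x < 1" for i x
        by (intro DERIV_cmult D2(2)[rule_format]) (use k(2) that in simp_all)
      show "\<bar>\<nu> * D1 i k x\<bar> \<le> C * \<nu>" if "i \<le> Suc m" "-1 < x" "x < b - \<epsilon>" for i x
        by (intro BC disjI1 D1(3)[rule_format]) (use k(1) that in simp_all)
      show "\<bar>\<nu> * D2 i k x\<bar> \<le> C * \<nu>" if "i \<le> Suc m" "b + \<epsilon> < x" "x < 1" for i x
        by (intro BC disjI2 D2(3)[rule_format]) (use k(2) that in simp_all)
    qed
    then show ?thesis by (simp add: f_def[abs_def])
  qed
  moreover have "\<eta> > 0" "C \<ge> 0" using e1(1) e2(1) by (auto simp: \<eta>_def C_def)
  ultimately show ?thesis using that[of \<eta> C] unfolding b_def by blast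
qed

section \<open>Sequences of solutions\<close>

lemma vanishing_viscosity_eventually:
  assumes "vanishing_viscosity c \<nu> cs" "\<eta> > 0"
  shows "\<forall>\<^sub>F k in sequentially. 0 < \<nu> k \<and> \<nu> k < \<eta> \<and> norm (cs k - c) < \<eta>"
proof -
  have "\<nu> \<longlonglongrightarrow> 0" "cs \<longlonglongrightarrow> c" and pos: "\<And>k. \<nu> k > 0" using assms(1) by (auto simp: vanishing_viscosity_def)
  then have "\<forall>\<^sub>F k in sequentially. \<nu> k < \<eta>" "\<forall>\<^sub>F k in sequentially. dist (cs k) c < \<eta>"
    using assms(2) by (auto intro: order_tendstoD tendstoD)
  then show ?thesis by eventually_elim (simp add: pos dist_norm)
qed

lemma vanishing_viscosity_limit_nonneg:
  assumes "vanishing_viscosity c \<nu> cs"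
  shows "c$1 \<ge> 0" "c$2 \<ge> 0"
proof -
  have \<nu>: "\<nu> \<longlonglongrightarrow> 0" and cs: "cs \<longlonglongrightarrow> c" and J: "\<And>k. cs k \<in> J (\<nu> k)"
    using assms by (auto simp: vanishing_viscosity_def)
  have l: "(\<lambda>k. cs k $ i + (\<nu> k)\<^sup>2) \<longlonglongrightarrow> c $ i + 0\<^sup>2" for i
    by (intro tendsto_intros tendsto_vec_nth cs \<nu>)
  have "0 \<le> cs k $ 1 + (\<nu> k)\<^sup>2" "0 \<le> cs k $ 2 + (\<nu> k)\<^sup>2" for k using J[of k] by (auto simp: J_def)
  then show "c$1 \<ge> 0" "c$2 \<ge> 0"
    using tendsto_lowerbound[OF l[of 1], of 0] tendsto_lowerbound[OF l[of 2], of 0] by auto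
qed

lemma vanishing_viscosity_swap:
  assumes "vanishing_viscosity c \<nu> cs"
  shows "vanishing_viscosity (swap c) \<nu> (\<lambda>k. swap (cs k))"
proof -
  have "cs \<longlonglongrightarrow> c" using assms by (auto simp: vanishing_viscosity_def)
  then have "(\<lambda>k. swap (cs k)) \<longlonglongrightarrow> swap c"
    unfolding swap_def by (intro tendsto_vec_lambda) (auto intro: tendsto_vec_nth)
  then show ?thesis using assms by (simp add: vanishing_viscosity_def swap_in_J)
qed

lemma c3_star_commute: "c3_star a b = c3_star b a"
  by (simp add: c3_star_def c3_bar_def add.commute)

lemma x_bar_swap: "x_bar (swap c) = - x_bar c"
  by (simp add: x_bar_def add.commute) (metis minus_diff_eq minus_divide_left)

lemma continuous_error:
  assumes "continuous_on {-1..1} U"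
  shows "continuous_on {-1<..<1} (\<lambda>x. U x - sqrt (2 * P c x))" "continuous_on {-1<..<1} (\<lambda>x. U x + sqrt (2 * P c x))"
    "continuous_on {-1<..<1} (\<lambda>x. defect c U x)"
proof -
  have "continuous_on {-1<..<1} U" by (rule solution_continuous[OF assms]) auto
  then show "continuous_on {-1<..<1} (\<lambda>x. U x - sqrt (2 * P c x))" "continuous_on {-1<..<1} (\<lambda>x. U x + sqrt (2 * P c x))"
    "continuous_on {-1<..<1} (\<lambda>x. defect c U x)"
    by (intro continuous_intros; assumption)+
qed

lemma norm_diff_tendsto_0: "cs \<longlonglongrightarrow> c \<Longrightarrow> (\<lambda>k. norm (cs k - c)) \<longlonglongrightarrow> 0"
  by (simp add: tendsto_norm_zero LIM_zero)

lemma powr_tendsto_0: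
  assumes "vanishing_viscosity c \<nu> cs"
  shows "(\<lambda>k. \<nu> k powr (2/3)) \<longlonglongrightarrow> 0"
proof -
  have "\<nu> \<longlonglongrightarrow> 0" "\<And>k. \<nu> k \<ge> 0" using assms by (auto simp: vanishing_viscosity_def less_imp_le)
  then show ?thesis by (intro tendsto_zero_powrI[of _ _ _ "2/3"]) (auto intro: always_eventually)
qed

subsection \<open>The nondegenerate case\<close>

lemma nondegenerate_limit:
  assumes c3: "c$3 = c3_star (c$1) (c$2)" and vv: "vanishing_viscosity c \<nu> cs" and J: "\<And>k. cs k \<in> J 0"
    and up: "\<And>k. upper_solution (\<nu> k) (cs k) (U k)"
  obtains B where "B \<longlonglongrightarrow> 0"
    "\<forall>\<^sub>F k in sequentially. \<forall>x. -1 < x \<longrightarrow> x < 1 \<longrightarrow> \<bar>U k x - sqrt (2 * P c x)\<bar> \<le> B k"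
proof -
  define C where "C = defect_const (norm c + 1)"
  have cs: "cs \<longlonglongrightarrow> c" using vv by (auto simp: vanishing_viscosity_def)
  have cJ: "c \<in> J 0" using vanishing_viscosity_limit_nonneg[OF vv] c3 by (simp add: J_def c3_star_def)
  define B where "B k = 2 * sqrt (2 * (0 + (C * \<nu> k powr (2/3) + 5 * norm (cs k - c))))" for k
  have "(\<lambda>k. 2 * sqrt (2 * (0 + (C * \<nu> k powr (2/3) + 5 * norm (cs k - c))))) \<longlonglongrightarrow> 2 * sqrt (2 * (0 + (C * 0 + 5 * 0)))"
    by (intro tendsto_intros powr_tendsto_0[OF vv] norm_diff_tendsto_0[OF cs])
  then have "B \<longlonglongrightarrow> 0" by (simp add: B_def[abs_def])
  moreover have "\<forall>\<^sub>F k in sequentially. \<forall>x. -1 < x \<longrightarrow> x < 1 \<longrightarrow> \<bar>U k x - sqrt (2 * P c x)\<bar> \<le> B k"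
    using vanishing_viscosity_eventually[OF vv, of "1/8"]
  proof (rule eventually_mono)
    fix k assume "0 < \<nu> k \<and> \<nu> k < 1/8 \<and> norm (cs k - c) < 1/8"
    then have k: "0 < \<nu> k" "\<nu> k \<le> 1/8" "norm (cs k - c) \<le> 1" by auto
    obtain e where e: "0 < e" "e \<le> 1/2" "\<nu> k = e ^ 3" "\<nu> k powr (2/3) = e\<^sup>2"
      using cube_root_scale[OF k(1,2)] by metis
    show "\<forall>x. -1 < x \<longrightarrow> x < 1 \<longrightarrow> \<bar>U k x - sqrt (2 * P c x)\<bar> \<le> B k"
    proof (intro allI impI)
      fix x :: real assume x: "-1 < x" "x < 1"
      have "\<bar>defect (cs k) (U k) x\<bar> \<le> C * e\<^sup>2"
        unfolding C_def
        by (rule nondegenerate_defect[OF up J e(3,1,2) component_bound[OF k(3)]]) (use x in simp)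
      moreover have "\<bar>P (cs k) x - P c x\<bar> \<le> 5 * norm (cs k - c)" using x by (intro abs_P_diff_le) simp
      ultimately have "\<bar>defect c (U k) x\<bar> \<le> C * \<nu> k powr (2/3) + 5 * norm (cs k - c)"
        unfolding e(4) by linarith
      moreover have "U k x > 0"
        using P_nonneg[OF J[of k]] x by (intro upper_solution_pos[OF up k(1), of x]) auto
      ultimately show "\<bar>U k x - sqrt (2 * P c x)\<bar> \<le> B k"
        unfolding B_def using P_nonneg[OF cJ, of x] x by (intro sqrt_close) auto
    qed
  qed simp
  ultimately show ?thesis by (rule that)
qed

text \<open>By the sup bound \<open>B e\<^sup>2\<close> and the Lipschitz bound \<open>O(1/e)\<close>, interpolation at distance \<open>\<nu> = e\<^sup>3\<close> bounds the
  Hoelder seminorm by \<open>O(e\<^sup>2 \<nu>\<^sup>-\<^sup>\<beta>)\<close>.\<close>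

lemma solution_norm_estimate:
  assumes sol: "ode_solution \<nu> c U" and cont: "continuous_on {-1..1} U" and \<nu>: "\<nu> = e ^ 3" and e: "0 < e" "e \<le> 1"
    and M: "\<And>i. \<bar>c$i\<bar> \<le> M" and B: "\<And>x. -1 < x \<Longrightarrow> x < 1 \<Longrightarrow> \<bar>defect c U x\<bar> \<le> B * e\<^sup>2"
    and \<epsilon>: "\<epsilon> > 0" and \<beta>: "0 < \<beta>" "\<beta> < 1" and N: "N = 1 + 5 * M + B"
  shows "Linf_norm {-1<..<1} (\<lambda>x. defect c U x)
      + ennreal (\<nu> powr \<beta>) * holder_norm \<beta> {-1+\<epsilon><..<1-\<epsilon>} (\<lambda>x. defect c U x)
    \<le> ennreal ((4 * B + (N * (B + 2 * N) / \<epsilon> + 4 * M)) * e\<^sup>2)"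
proof -
  have M0: "0 \<le> M" using M[of 1] by linarith
  have "0 \<le> B * e\<^sup>2" using B[of 0] by linarith
  then have B0: "B \<ge> 0" using e by (simp add: zero_le_mult_iff)
  define L where "L = N * (B + 2 * N) / \<epsilon> + 4 * M"
  have L0: "L \<ge> 0" using M0 B0 \<epsilon> by (simp add: L_def N)
  have 1: "Linf_norm {-1<..<1} (\<lambda>x. defect c U x) \<le> ennreal (B * e\<^sup>2)"
    by (rule Linf_norm_le[OF continuous_error(3)[OF cont] B])
  have 2: "ennreal (\<nu> powr \<beta>) * holder_norm \<beta> {-1+\<epsilon><..<1-\<epsilon>} (\<lambda>x. defect c U x)
      \<le> ennreal (3 * (B * e\<^sup>2) + L / e * \<nu>)"
  proof (rule holder_norm_le[OF _ _ \<beta>])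
    show "0 < \<nu>" "\<nu> \<le> 1" using e by (simp_all add: \<nu> power_le_one)
    show "0 \<le> B * e\<^sup>2" "0 \<le> L / e" using B0 L0 e by simp_all
    show "\<bar>defect c U x\<bar> \<le> B * e\<^sup>2" if "x \<in> {-1+\<epsilon><..<1-\<epsilon>}" for x using that \<epsilon> by (intro B) auto
    show "\<bar>defect c U x - defect c U y\<bar> \<le> L / e * \<bar>x - y\<bar>"
      if "x \<in> {-1+\<epsilon><..<1-\<epsilon>}" "y \<in> {-1+\<epsilon><..<1-\<epsilon>}" for x y
      unfolding L_def by (rule defect_lipschitz[OF sol \<nu> e M B \<epsilon> that N])
  qed
  have 3: "L / e * \<nu> = L * e\<^sup>2" using e by (simp add: \<nu> power2_eq_square power3_eq_cube)
  have "Linf_norm {-1<..<1} (\<lambda>x. defect c U x)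
      + ennreal (\<nu> powr \<beta>) * holder_norm \<beta> {-1+\<epsilon><..<1-\<epsilon>} (\<lambda>x. defect c U x)
      \<le> ennreal (B * e\<^sup>2) + ennreal (3 * (B * e\<^sup>2) + L * e\<^sup>2)"
    by (rule add_mono[OF 1 2[unfolded 3]])
  also have "\<dots> = ennreal ((4 * B + L) * e\<^sup>2)"
    using B0 L0 by (simp add: algebra_simps flip: ennreal_plus)
  finally show ?thesis by (simp add: L_def)
qed

lemma nondegenerate_norm_estimate:
  fixes c :: "real^3"
  assumes \<beta>: "0 < \<beta>" "\<beta> < 2/3" and \<epsilon>: "0 < \<epsilon>"
  shows "\<exists>C::real. \<forall>\<nu> cs Up Um. vanishing_viscosity c \<nu> cs \<and> (\<forall>k. cs k \<in> J 0) \<and>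
        (\<forall>k. upper_solution (\<nu> k) (cs k) (Up k)) \<and> (\<forall>k. lower_solution (\<nu> k) (cs k) (Um k)) \<longrightarrow>
        (\<forall>\<^sub>F k in sequentially.
          Linf_norm {-1<..<1} (\<lambda>x. defect (cs k) (Up k) x)
            + ennreal (\<nu> k powr \<beta>) *
              holder_norm \<beta> {-1+\<epsilon><..<1-\<epsilon>} (\<lambda>x. defect (cs k) (Up k) x)
            \<le> ennreal (C * \<nu> k powr (2/3)) \<and>
          Linf_norm {-1<..<1} (\<lambda>x. defect (cs k) (Um k) x)
            + ennreal (\<nu> k powr \<beta>) *
              holder_norm \<beta> {-1+\<epsilon><..<1-\<epsilon>} (\<lambda>x. defect (cs k) (Um k) x)
            \<le> ennreal (C * \<nu> k powr (2/3)))"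
    (is "\<exists>C. \<forall>\<nu> cs Up Um. _ \<longrightarrow> (\<forall>\<^sub>F k in sequentially. ?est C \<nu> cs Up Um k)")
proof -
  define M where "M = norm c + 1"
  define B where "B = defect_const M"
  define N where "N = 1 + 5 * M + B"
  define C where "C = 4 * B + (N * (B + 2 * N) / \<epsilon> + 4 * M)"
  show ?thesis
  proof (rule exI[of _ C], intro allI impI, elim conjE)
    fix \<nu> cs Up Um
    assume vv: "vanishing_viscosity c \<nu> cs" and J: "\<forall>k. cs k \<in> J 0"
      and up: "\<forall>k. upper_solution (\<nu> k) (cs k) (Up k)" and lo: "\<forall>k. lower_solution (\<nu> k) (cs k) (Um k)"
    show "\<forall>\<^sub>F k in sequentially. ?est C \<nu> cs Up Um k"
      using vanishing_viscosity_eventually[OF vv, of "1/8"]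
    proof (rule eventually_mono)
      fix k assume "0 < \<nu> k \<and> \<nu> k < 1/8 \<and> norm (cs k - c) < 1/8"
      then have k: "0 < \<nu> k" "\<nu> k \<le> 1/8" "norm (cs k - c) \<le> 1" by auto
      obtain e where e: "0 < e" "e \<le> 1/2" "\<nu> k = e ^ 3" "\<nu> k powr (2/3) = e\<^sup>2"
        using cube_root_scale[OF k(1,2)] by metis
      have e1: "e \<le> 1" and \<beta>1: "\<beta> < 1" using e \<beta> by auto
      have M: "\<bar>cs k $ i\<bar> \<le> M" for i using component_bound[OF k(3)] by (simp add: M_def)
      have Ms: "\<bar>swap (cs k) $ i\<bar> \<le> M" for i
        using M[of 1] M[of 2] M[of 3] by (simp add: swap_def)
      have up': "upper_solution (\<nu> k) (cs k) (Up k)" and lo': "lower_solution (\<nu> k) (cs k) (Um k)"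
        and Jk: "cs k \<in> J 0" using up lo J by auto
      have U: "\<bar>defect (cs k) (Up k) x\<bar> \<le> B * e\<^sup>2" if "-1 < x" "x < 1" for x
        unfolding B_def by (rule nondegenerate_defect[OF up' Jk e(3,1,2) M]) (use that in simp)
      have L: "\<bar>defect (cs k) (Um k) x\<bar> \<le> B * e\<^sup>2" if "-1 < x" "x < 1" for x
      proof -
        have "\<bar>(1/2) * (- Um k (- (- x)))\<^sup>2 - P (swap (cs k)) (- x)\<bar> \<le> B * e\<^sup>2"
          unfolding B_def
          by (rule nondegenerate_defect[OF lower_solution_reflect[OF lo'] _ e(3,1,2) Ms])
             (use that Jk in \<open>auto simp: swap_in_J\<close>)
        then show ?thesis by (simp add: P_swap)
      qed
      show "?est C \<nu> cs Up Um k"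
        unfolding e(4) C_def
        using up' lo' unfolding upper_solution_def lower_solution_def
        by (intro conjI solution_norm_estimate[OF _ _ e(3,1) e1 M _ \<epsilon> \<beta>(1) \<beta>1 N_def] U L) auto
    qed simp
  qed
qed

lemma nondegenerate_Cm_estimate:
  fixes c :: "real^3"
  assumes c0: "c \<noteq> 0" and c3: "c$3 = c3_star (c$1) (c$2)" and \<epsilon>: "0 < \<epsilon>"
  shows "\<exists>C::real. \<forall>\<nu> cs Up Um. vanishing_viscosity c \<nu> cs \<and> (\<forall>k. cs k \<in> J 0) \<and>
        (\<forall>k. upper_solution (\<nu> k) (cs k) (Up k)) \<and> (\<forall>k. lower_solution (\<nu> k) (cs k) (Um k)) \<longrightarrow>
        (\<forall>\<^sub>F k in sequentially.
          Cm_norm m ({-1..1-\<epsilon>} - {x_bar c - \<epsilon>..x_bar c + \<epsilon>}) (\<lambda>x. Up k x - sqrt (2 * P (cs k) x))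
          + Cm_norm m ({-1+\<epsilon>..1} - {x_bar c - \<epsilon>..x_bar c + \<epsilon>}) (\<lambda>x. Um k x + sqrt (2 * P (cs k) x))
          \<le> ennreal (C * \<nu> k))"
    (is "\<exists>C. \<forall>\<nu> cs Up Um. _ \<longrightarrow> (\<forall>\<^sub>F k in sequentially. ?est C \<nu> cs Up Um k)")
proof (cases "c$1 \<ge> 0 \<and> c$2 \<ge> 0")
  case False
  then show ?thesis using vanishing_viscosity_limit_nonneg by (intro exI[of _ 0]) blast
next
  case True
  then have c12: "c$1 \<ge> 0" "c$2 \<ge> 0" by auto
  have s: "sqrt (c$1) + sqrt (c$2) > 0"
  proof (rule ccontr)
    assume "\<not> ?thesis"
    then have "sqrt (c$1) + sqrt (c$2) \<le> 0" by simp
    moreover have "sqrt (c$1) \<ge> 0" "sqrt (c$2) \<ge> 0" using c12 by auto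
    ultimately have "sqrt (c$1) = 0" "sqrt (c$2) = 0" by linarith+
    then have "c$1 = 0" "c$2 = 0" by simp_all
    moreover from this have "c$3 = 0" using c3 by (simp add: c3_star_def c3_bar_def)
    ultimately show False using c0 by (simp add: vec_eq_iff forall_3)
  qed
  have s': "sqrt (swap c $ 1) + sqrt (swap c $ 2) > 0" and c3': "swap c $ 3 = c3_star (swap c $ 1) (swap c $ 2)"
    and c12': "swap c $ 1 \<ge> 0" "swap c $ 2 \<ge> 0"
    using s c3 c12 by (simp_all add: add.commute c3_star_commute)
  obtain \<eta>1 C1 where h1: "\<eta>1 > 0" "C1 \<ge> 0"
    "\<forall>\<nu> c' U. 0 < \<nu> \<and> \<nu> < \<eta>1 \<and> norm (c' - c) < \<eta>1 \<and> c' \<in> J 0 \<and> upper_solution \<nu> c' U \<longrightarrow>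
      Cm_bounded m (outer_set \<epsilon> (x_bar c)) (\<lambda>x. U x - sqrt (2 * P c' x)) (C1 * \<nu>)"
    by (rule Cm_estimate_upper[OF c12 c3 s \<epsilon>])
  obtain \<eta>2 C2 where h2: "\<eta>2 > 0" "C2 \<ge> 0"
    "\<forall>\<nu> c' U. 0 < \<nu> \<and> \<nu> < \<eta>2 \<and> norm (c' - swap c) < \<eta>2 \<and> c' \<in> J 0 \<and> upper_solution \<nu> c' U \<longrightarrow>
      Cm_bounded m (outer_set \<epsilon> (x_bar (swap c))) (\<lambda>x. U x - sqrt (2 * P c' x)) (C2 * \<nu>)"
    by (rule Cm_estimate_upper[OF c12' c3' s' \<epsilon>])
  note xb = x_bar_range[OF c12]
  have xb': "-1 \<le> x_bar (swap c)" "x_bar (swap c) \<le> 1" using xb by (simp_all add: x_bar_swap)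
  have S1: "{-1..1-\<epsilon>} - {x_bar c - \<epsilon>..x_bar c + \<epsilon>} = outer_set \<epsilon> (x_bar c)" by (simp add: outer_set_def)
  have S2: "{-1+\<epsilon>..1} - {x_bar c - \<epsilon>..x_bar c + \<epsilon>} = uminus ` outer_set \<epsilon> (x_bar (swap c))"
  proof -
    have "uminus ` outer_set \<epsilon> (x_bar (swap c)) = {x. - x \<in> outer_set \<epsilon> (x_bar (swap c))}"
      by (force simp: image_iff)
    then show ?thesis by (auto simp: outer_set_def x_bar_swap)
  qed
  have isolated: "at x within uminus ` outer_set \<epsilon> (x_bar (swap c)) \<noteq> bot"
    if x: "x \<in> uminus ` outer_set \<epsilon> (x_bar (swap c))" for x
  proof -
    have "at (- x) within outer_set \<epsilon> (x_bar (swap c)) \<noteq> bot"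
      using x xb' \<epsilon> by (intro outer_set_no_isolated) auto
    then have lp: "- x islimpt outer_set \<epsilon> (x_bar (swap c))" by (simp add: trivial_limit_within)
    have "x islimpt uminus ` outer_set \<epsilon> (x_bar (swap c))"
      unfolding islimpt_approachable
    proof (intro allI impI)
      fix d :: real assume "d > 0"
      then obtain y where y: "y \<in> outer_set \<epsilon> (x_bar (swap c))" "y \<noteq> - x" "dist y (- x) < d"
        using lp unfolding islimpt_approachable by blast
      then have "- y \<in> uminus ` outer_set \<epsilon> (x_bar (swap c)) \<and> - y \<noteq> x \<and> dist (- y) x < d"
        by (auto simp: dist_real_def)
      then show "\<exists>x'\<in>uminus ` outer_set \<epsilon> (x_bar (swap c)). x' \<noteq> x \<and> dist x' x < d" by blast
    qed
    then show ?thesis by (simp add: trivial_limit_within)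
  qed
  define C where "C = real (Suc m) * C1 + real (Suc m) * C2"
  show ?thesis
  proof (rule exI[of _ C], intro allI impI, elim conjE)
    fix \<nu> cs Up Um
    assume vv: "vanishing_viscosity c \<nu> cs" and J: "\<forall>k. cs k \<in> J 0"
      and up: "\<forall>k. upper_solution (\<nu> k) (cs k) (Up k)" and lo: "\<forall>k. lower_solution (\<nu> k) (cs k) (Um k)"
    show "\<forall>\<^sub>F k in sequentially. ?est C \<nu> cs Up Um k"
      using vanishing_viscosity_eventually[OF vv h1(1)] vanishing_viscosity_eventually[OF vanishing_viscosity_swap[OF vv] h2(1)]
    proof eventually_elim
      case (elim k)
      have "Cm_bounded m (outer_set \<epsilon> (x_bar c)) (\<lambda>x. Up k x - sqrt (2 * P (cs k) x)) (C1 * \<nu> k)"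
        using h1(3) elim(1) J up by blast
      then have 1: "Cm_norm m (outer_set \<epsilon> (x_bar c)) (\<lambda>x. Up k x - sqrt (2 * P (cs k) x))
          \<le> ennreal (real (Suc m) * (C1 * \<nu> k))"
        using xb \<epsilon> elim h1(2) by (intro Cm_bounded_norm outer_set_no_isolated) auto
      have "Cm_bounded m (outer_set \<epsilon> (x_bar (swap c))) (\<lambda>x. - Um k (- x) - sqrt (2 * P (swap (cs k)) x)) (C2 * \<nu> k)"
        by (rule h2(3)[rule_format]) (use elim(2) J lo lower_solution_reflect swap_in_J in auto)
      from Cm_bounded_reflect[OF this]
      have "Cm_bounded m (uminus ` outer_set \<epsilon> (x_bar (swap c))) (\<lambda>x. Um k x + sqrt (2 * P (cs k) x)) (C2 * \<nu> k)"
        by (simp add: P_swap add.commute)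
      then have 2: "Cm_norm m (uminus ` outer_set \<epsilon> (x_bar (swap c))) (\<lambda>x. Um k x + sqrt (2 * P (cs k) x))
          \<le> ennreal (real (Suc m) * (C2 * \<nu> k))"
        using elim h2(2) by (intro Cm_bounded_norm isolated) auto
      have "ennreal (real (Suc m) * (C1 * \<nu> k)) + ennreal (real (Suc m) * (C2 * \<nu> k)) = ennreal (C * \<nu> k)"
        using h1(2) h2(2) elim unfolding C_def by (subst ennreal_plus[symmetric]) (auto simp: algebra_simps)
      then show ?case using add_mono[OF 1 2] unfolding S1 S2 by simp
    qed
  qed
qed

subsection \<open>The degenerate case\<close>

lemma degenerate_rate_tendsto_0:
  assumes vv: "vanishing_viscosity c \<nu> cs" and c: "c$2 = 0" "2 * c$3 + c$1 = 0"
  shows "(\<lambda>k. degenerate_rate (cs k) (\<nu> k)) \<longlonglongrightarrow> 0"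
proof -
  have cs: "cs \<longlonglongrightarrow> c" using vv by (auto simp: vanishing_viscosity_def)
  have "(\<lambda>k. degenerate_rate (cs k) (\<nu> k)) \<longlonglongrightarrow>
      \<bar>c $ 2\<bar> + \<bar>2 * c $ 3 + c $ 1\<bar>\<^sup>2 + 0"
    by (intro tendsto_intros powr_tendsto_0[OF vv] tendsto_vec_nth[OF cs])
  then show ?thesis using c by simp
qed

lemma degenerate_estimates:
  fixes c :: "real^3"
  assumes c0: "c \<noteq> 0" and c3: "c$3 = c3_star (c$1) (c$2)" and c2: "c$2 = 0"
  obtains C :: real where
    "\<forall>\<nu> cs U. vanishing_viscosity c \<nu> cs \<and> (\<forall>k. upper_solution (\<nu> k) (cs k) (U k)) \<longrightarrow>
      (\<exists>B. B \<longlonglongrightarrow> 0 \<and> (\<forall>\<^sub>F k in sequentially. \<forall>x. -1 < x \<longrightarrow> x < 1 \<longrightarrow> \<bar>U k x - sqrt (2 * P c x)\<bar> \<le> B k))"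
    "\<forall>\<nu> cs U. vanishing_viscosity c \<nu> cs \<and> (\<forall>k. upper_solution (\<nu> k) (cs k) (U k)) \<longrightarrow>
      (\<forall>\<^sub>F k in sequentially. \<forall>x. -1 < x \<longrightarrow> x < 1 \<longrightarrow> \<bar>defect (cs k) (U k) x\<bar>
         \<le> C * degenerate_rate (cs k) (\<nu> k))"
    "\<forall>\<nu> cs. vanishing_viscosity c \<nu> cs \<longrightarrow>
      (\<lambda>k. C * degenerate_rate (cs k) (\<nu> k)) \<in> o(\<lambda>_. 1)"
proof (cases "c$1 > 0")
  case False
  \<comment> \<open>Limits of admissible parameters have \<open>c\<^sub>1 \<ge> 0\<close>, and \<open>c\<^sub>1 = 0\<close> would force \<open>c = 0\<close>.\<close>
  have "\<not> vanishing_viscosity c \<nu> cs" for \<nu> cs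
  proof
    assume "vanishing_viscosity c \<nu> cs"
    then have "c$1 = 0" using vanishing_viscosity_limit_nonneg(1) False by force
    moreover from this have "c$3 = 0" using c3 c2 by (simp add: c3_star_def c3_bar_def)
    ultimately show False using c0 c2 by (simp add: vec_eq_iff forall_3)
  qed
  then show ?thesis by (intro that[of 0]) blast+
next
  case True
  have c3': "c$3 = - (1/2) * c$1" using c3 c2 True by (simp add: c3_star_def c3_bar_def)
  obtain \<eta> C K where \<eta>: "\<eta> > 0" and C: "C \<ge> 0"
    and est: "\<And>\<nu> c' U x. upper_solution \<nu> c' U \<Longrightarrow> 0 < \<nu> \<Longrightarrow> \<nu> < \<eta> \<Longrightarrow> norm (c' - c) < \<eta> \<Longrightarrow> x \<in> {-1..1} \<Longrightarrow>
      \<bar>defect c' U x\<bar> \<le> C * degenerate_rate c' \<nu>"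
    and pos: "\<And>\<nu> c' U x. upper_solution \<nu> c' U \<Longrightarrow> 0 < \<nu> \<Longrightarrow> \<nu> < \<eta> \<Longrightarrow> norm (c' - c) < \<eta> \<Longrightarrow> x \<in> {-1..1} \<Longrightarrow>
      U x > 0 \<or> P c x \<le> K * degenerate_rate c' \<nu>" and K: "K \<ge> 0"
    using degenerate_near[OF True c2 c3'] by metis
  have P0: "P c x \<ge> 0" if "-1 < x" "x < 1" for x
    using that True c2 c3 by (intro P_nonneg) (auto simp: J_def c3_star_def)
  show ?thesis
  proof (rule that[of C])
    show "\<forall>\<nu> cs. vanishing_viscosity c \<nu> cs \<longrightarrow>
      (\<lambda>k. C * degenerate_rate (cs k) (\<nu> k)) \<in> o(\<lambda>_. 1)"
    proof (intro allI impI smalloI_tendsto)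
      fix \<nu> cs assume "vanishing_viscosity c \<nu> cs"
      from tendsto_mult_left[OF degenerate_rate_tendsto_0[OF this c2], of C]
      show "(\<lambda>k. C * degenerate_rate (cs k) (\<nu> k) / 1) \<longlonglongrightarrow> 0"
        using c3' by simp
    qed simp
    show "\<forall>\<nu> cs U. vanishing_viscosity c \<nu> cs \<and> (\<forall>k. upper_solution (\<nu> k) (cs k) (U k)) \<longrightarrow>
      (\<forall>\<^sub>F k in sequentially. \<forall>x. -1 < x \<longrightarrow> x < 1 \<longrightarrow> \<bar>defect (cs k) (U k) x\<bar>
         \<le> C * degenerate_rate (cs k) (\<nu> k))"
    proof (intro allI impI, elim conjE)
      fix \<nu> cs U assume vv: "vanishing_viscosity c \<nu> cs" and up: "\<forall>k. upper_solution (\<nu> k) (cs k) (U k)"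
      show "\<forall>\<^sub>F k in sequentially. \<forall>x. -1 < x \<longrightarrow> x < 1 \<longrightarrow> \<bar>defect (cs k) (U k) x\<bar>
         \<le> C * degenerate_rate (cs k) (\<nu> k)"
        using vanishing_viscosity_eventually[OF vv \<eta>]
      proof (rule eventually_mono, intro allI impI)
        fix k x assume "0 < \<nu> k \<and> \<nu> k < \<eta> \<and> norm (cs k - c) < \<eta>" "-1 < x" "x < (1::real)"
        then show "\<bar>defect (cs k) (U k) x\<bar>
          \<le> C * degenerate_rate (cs k) (\<nu> k)"
          using up by (intro est) auto
      qed
    qed
    show "\<forall>\<nu> cs U. vanishing_viscosity c \<nu> cs \<and> (\<forall>k. upper_solution (\<nu> k) (cs k) (U k)) \<longrightarrow>
      (\<exists>B. B \<longlonglongrightarrow> 0 \<and> (\<forall>\<^sub>F k in sequentially. \<forall>x. -1 < x \<longrightarrow> x < 1 \<longrightarrow> \<bar>U k x - sqrt (2 * P c x)\<bar> \<le> B k))"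
    proof (intro allI impI, elim conjE)
      fix \<nu> cs U assume vv: "vanishing_viscosity c \<nu> cs" and up: "\<forall>k. upper_solution (\<nu> k) (cs k) (U k)"
      have cs: "cs \<longlonglongrightarrow> c" using vv by (auto simp: vanishing_viscosity_def)
      define R where "R k = degenerate_rate (cs k) (\<nu> k)" for k
      have R: "R \<longlonglongrightarrow> 0"
        unfolding R_def by (rule degenerate_rate_tendsto_0[OF vv c2]) (simp add: c3')
      have R0: "R k \<ge> 0" for k by (simp add: R_def)
      define B where "B k = 2 * sqrt (2 * (K * R k + (C * R k + 5 * norm (cs k - c))))" for k
      have "(\<lambda>k. 2 * sqrt (2 * (K * R k + (C * R k + 5 * norm (cs k - c))))) \<longlonglongrightarrow> 2 * sqrt (2 * (K * 0 + (C * 0 + 5 * 0)))"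
        by (intro tendsto_intros R norm_diff_tendsto_0[OF cs])
      then have "B \<longlonglongrightarrow> 0" by (simp add: B_def[abs_def])
      moreover have "\<forall>\<^sub>F k in sequentially. \<forall>x. -1 < x \<longrightarrow> x < 1 \<longrightarrow> \<bar>U k x - sqrt (2 * P c x)\<bar> \<le> B k"
        using vanishing_viscosity_eventually[OF vv \<eta>]
      proof (rule eventually_mono, intro allI impI)
        fix k x assume k: "0 < \<nu> k \<and> \<nu> k < \<eta> \<and> norm (cs k - c) < \<eta>" and x: "-1 < x" "x < (1::real)"
        have "\<bar>defect (cs k) (U k) x\<bar> \<le> C * R k"
          unfolding R_def using up k x by (intro est) auto
        moreover have "\<bar>P (cs k) x - P c x\<bar> \<le> 5 * norm (cs k - c)" using x by (intro abs_P_diff_le) simp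
        ultimately have "\<bar>defect c (U k) x\<bar> \<le> C * R k + 5 * norm (cs k - c)" by linarith
        moreover have "U k x > 0 \<or> P c x \<le> K * R k"
          unfolding R_def using up k x by (intro pos) auto
        ultimately show "\<bar>U k x - sqrt (2 * P c x)\<bar> \<le> B k"
          unfolding B_def using P0[OF x] K R0[of k] by (intro sqrt_close) auto
      qed
      ultimately show "\<exists>B. B \<longlonglongrightarrow> 0 \<and> (\<forall>\<^sub>F k in sequentially. \<forall>x. -1 < x \<longrightarrow> x < 1 \<longrightarrow> \<bar>U k x - sqrt (2 * P c x)\<bar> \<le> B k)"
        by blast
    qed
  qed
qed

subsection \<open>Passage to norms\<close>

lemma upper_solutions_converge:
  assumes "\<And>k. upper_solution (\<nu> k) (cs k) (U k)" "B \<longlonglongrightarrow> 0"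
    "\<forall>\<^sub>F k in sequentially. \<forall>x. -1 < x \<longrightarrow> x < 1 \<longrightarrow> \<bar>U k x - sqrt (2 * P c x)\<bar> \<le> B k"
  shows "(\<lambda>k. Linf_norm {-1<..<1} (\<lambda>x. U k x - sqrt (2 * P c x))) \<longlonglongrightarrow> 0"
  using assms(1) by (intro Linf_norm_tendsto_0[OF _ assms(3,2)] continuous_error) (auto simp: upper_solution_def)

lemma lower_solutions_converge:
  assumes "\<And>k. lower_solution (\<nu> k) (cs k) (U k)" "B \<longlonglongrightarrow> 0"
    "\<forall>\<^sub>F k in sequentially. \<forall>x. -1 < x \<longrightarrow> x < 1 \<longrightarrow> \<bar>- U k (- x) - sqrt (2 * P (swap c) x)\<bar> \<le> B k"
  shows "(\<lambda>k. Linf_norm {-1<..<1} (\<lambda>x. U k x + sqrt (2 * P c x))) \<longlonglongrightarrow> 0"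
proof (rule Linf_norm_tendsto_0[OF _ _ assms(2)])
  show "continuous_on {-1<..<1} (\<lambda>x. U k x + sqrt (2 * P c x))" for k
    using assms(1)[of k] by (intro continuous_error) (auto simp: lower_solution_def)
  show "\<forall>\<^sub>F k in sequentially. \<forall>x. -1 < x \<longrightarrow> x < 1 \<longrightarrow> \<bar>U k x + sqrt (2 * P c x)\<bar> \<le> B k"
    using assms(3)
  proof (rule eventually_mono, intro allI impI)
    fix k x assume *: "\<forall>x. -1 < x \<longrightarrow> x < 1 \<longrightarrow> \<bar>- U k (- x) - sqrt (2 * P (swap c) x)\<bar> \<le> B k" and x: "-1 < x" "x < (1::real)"
    have "\<bar>- U k (- (- x)) - sqrt (2 * P (swap c) (- x))\<bar> \<le> B k"
      using *[rule_format, of "- x"] x by simp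
    then have "\<bar>- U k x - sqrt (2 * P c x)\<bar> \<le> B k" by (simp add: P_swap)
    moreover have "\<bar>- U k x - sqrt (2 * P c x)\<bar> = \<bar>U k x + sqrt (2 * P c x)\<bar>" by linarith
    ultimately show "\<bar>U k x + sqrt (2 * P c x)\<bar> \<le> B k" by simp
  qed
qed

theorem theorem1p6:
  fixes c :: "real^3"
  assumes "c \<noteq> 0" and "c$3 = c3_star (c$1) (c$2)"
  shows
  "((\<forall>\<nu> cs Up Um. vanishing_viscosity c \<nu> cs \<and> (\<forall>k. cs k \<in> J 0) \<and>
        (\<forall>k. upper_solution (\<nu> k) (cs k) (Up k)) \<and> (\<forall>k. lower_solution (\<nu> k) (cs k) (Um k)) \<longrightarrow>
        (\<lambda>k. Linf_norm {-1<..<1} (\<lambda>x. Up k x - sqrt (2 * P c x))) \<longlonglongrightarrow> 0 \<and>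
        (\<lambda>k. Linf_norm {-1<..<1} (\<lambda>x. Um k x + sqrt (2 * P c x))) \<longlonglongrightarrow> 0) \<and>
    (\<forall>\<beta> \<epsilon>. 0 < \<beta> \<and> \<beta> < 2/3 \<and> 0 < \<epsilon> \<longrightarrow>
      (\<exists>C::real. \<forall>\<nu> cs Up Um. vanishing_viscosity c \<nu> cs \<and> (\<forall>k. cs k \<in> J 0) \<and>
        (\<forall>k. upper_solution (\<nu> k) (cs k) (Up k)) \<and> (\<forall>k. lower_solution (\<nu> k) (cs k) (Um k)) \<longrightarrow>
        (\<forall>\<^sub>F k in sequentially.
          Linf_norm {-1<..<1} (\<lambda>x. (1/2) * (Up k x)\<^sup>2 - P (cs k) x)
            + ennreal (\<nu> k powr \<beta>) *
              holder_norm \<beta> {-1+\<epsilon><..<1-\<epsilon>} (\<lambda>x. (1/2) * (Up k x)\<^sup>2 - P (cs k) x)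
            \<le> ennreal (C * \<nu> k powr (2/3)) \<and>
          Linf_norm {-1<..<1} (\<lambda>x. (1/2) * (Um k x)\<^sup>2 - P (cs k) x)
            + ennreal (\<nu> k powr \<beta>) *
              holder_norm \<beta> {-1+\<epsilon><..<1-\<epsilon>} (\<lambda>x. (1/2) * (Um k x)\<^sup>2 - P (cs k) x)
            \<le> ennreal (C * \<nu> k powr (2/3))))) \<and>
    ((\<exists>\<nu> cs. vanishing_viscosity c \<nu> cs \<and> (\<forall>k. cs k \<in> J 0)) \<longrightarrow> x_bar c \<in> {-1..1}) \<and>
    (\<forall>\<epsilon> (m::nat). 0 < \<epsilon> \<longrightarrow>
      (\<exists>C::real. \<forall>\<nu> cs Up Um. vanishing_viscosity c \<nu> cs \<and> (\<forall>k. cs k \<in> J 0) \<and>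
        (\<forall>k. upper_solution (\<nu> k) (cs k) (Up k)) \<and> (\<forall>k. lower_solution (\<nu> k) (cs k) (Um k)) \<longrightarrow>
        (\<forall>\<^sub>F k in sequentially.
          Cm_norm m ({-1..1-\<epsilon>} - {x_bar c - \<epsilon>..x_bar c + \<epsilon>}) (\<lambda>x. Up k x - sqrt (2 * P (cs k) x))
          + Cm_norm m ({-1+\<epsilon>..1} - {x_bar c - \<epsilon>..x_bar c + \<epsilon>}) (\<lambda>x. Um k x + sqrt (2 * P (cs k) x))
          \<le> ennreal (C * \<nu> k)))))
   \<and>
   (c$2 = 0 \<longrightarrow>
    (\<forall>\<nu> cs Up. vanishing_viscosity c \<nu> cs \<and> (\<forall>k. upper_solution (\<nu> k) (cs k) (Up k)) \<longrightarrow>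
        (\<lambda>k. Linf_norm {-1<..<1} (\<lambda>x. Up k x - sqrt (2 * P c x))) \<longlonglongrightarrow> 0) \<and>
    (\<exists>C::real. \<forall>\<nu> cs Up. vanishing_viscosity c \<nu> cs \<and>
        (\<forall>k. upper_solution (\<nu> k) (cs k) (Up k)) \<longrightarrow>
        (\<forall>\<^sub>F k in sequentially.
          Linf_norm {-1<..<1} (\<lambda>x. (1/2) * (Up k x)\<^sup>2 - P (cs k) x)
            \<le> ennreal (C * (\<bar>cs k $ 2\<bar> + \<bar>2 * cs k $ 3 + cs k $ 1\<bar>\<^sup>2 + \<nu> k powr (2/3)))) \<and>
        (\<lambda>k. C * (\<bar>cs k $ 2\<bar> + \<bar>2 * cs k $ 3 + cs k $ 1\<bar>\<^sup>2 + \<nu> k powr (2/3))) \<in> o(\<lambda>_. 1)))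
   \<and>
   (c$1 = 0 \<longrightarrow>
    (\<forall>\<nu> cs Um. vanishing_viscosity c \<nu> cs \<and> (\<forall>k. lower_solution (\<nu> k) (cs k) (Um k)) \<longrightarrow>
        (\<lambda>k. Linf_norm {-1<..<1} (\<lambda>x. Um k x + sqrt (2 * P c x))) \<longlonglongrightarrow> 0) \<and>
    (\<exists>C::real. \<forall>\<nu> cs Um. vanishing_viscosity c \<nu> cs \<and>
        (\<forall>k. lower_solution (\<nu> k) (cs k) (Um k)) \<longrightarrow>
        (\<forall>\<^sub>F k in sequentially.
          Linf_norm {-1<..<1} (\<lambda>x. (1/2) * (Um k x)\<^sup>2 - P (cs k) x)
            \<le> ennreal (C * (\<bar>cs k $ 1\<bar> + \<bar>2 * cs k $ 3 + cs k $ 2\<bar>\<^sup>2 + \<nu> k powr (2/3)))) \<and>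
        (\<lambda>k. C * (\<bar>cs k $ 1\<bar> + \<bar>2 * cs k $ 3 + cs k $ 2\<bar>\<^sup>2 + \<nu> k powr (2/3))) \<in> o(\<lambda>_. 1)))"
proof -
  have swap3: "swap c $ 3 = c3_star (swap c $ 1) (swap c $ 2)"
    using assms(2) by (simp add: c3_star_commute)
  have swap0: "swap c \<noteq> 0" using assms(1) by (auto simp: vec_eq_iff forall_3)
  have limit_i: "(\<lambda>k. Linf_norm {-1<..<1} (\<lambda>x. Up k x - sqrt (2 * P c x))) \<longlonglongrightarrow> 0 \<and>
        (\<lambda>k. Linf_norm {-1<..<1} (\<lambda>x. Um k x + sqrt (2 * P c x))) \<longlonglongrightarrow> 0"
    if h: "vanishing_viscosity c \<nu> cs" "\<forall>k. cs k \<in> J 0"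
      "\<forall>k. upper_solution (\<nu> k) (cs k) (Up k)" "\<forall>k. lower_solution (\<nu> k) (cs k) (Um k)" for \<nu> cs Up Um
  proof
    obtain B where "B \<longlonglongrightarrow> 0"
      "\<forall>\<^sub>F k in sequentially. \<forall>x. -1 < x \<longrightarrow> x < 1 \<longrightarrow> \<bar>Up k x - sqrt (2 * P c x)\<bar> \<le> B k"
      by (rule nondegenerate_limit[OF assms(2) h(1) h(2)[rule_format] h(3)[rule_format]])
    then show "(\<lambda>k. Linf_norm {-1<..<1} (\<lambda>x. Up k x - sqrt (2 * P c x))) \<longlonglongrightarrow> 0"
      using h(3) by (intro upper_solutions_converge[of \<nu> cs Up]) auto
    have sw: "swap (cs k) \<in> J 0" "upper_solution (\<nu> k) (swap (cs k)) (\<lambda>x. - Um k (- x))" for k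
      using h(2,4) by (auto simp: swap_in_J intro: lower_solution_reflect)
    obtain B where "B \<longlonglongrightarrow> 0"
      "\<forall>\<^sub>F k in sequentially. \<forall>x. -1 < x \<longrightarrow> x < 1 \<longrightarrow> \<bar>- Um k (- x) - sqrt (2 * P (swap c) x)\<bar> \<le> B k"
      by (rule nondegenerate_limit[OF swap3 vanishing_viscosity_swap[OF h(1)] sw])
    then show "(\<lambda>k. Linf_norm {-1<..<1} (\<lambda>x. Um k x + sqrt (2 * P c x))) \<longlonglongrightarrow> 0"
      using h(4) by (intro lower_solutions_converge[of \<nu> cs Um]) auto
  qed
  have part_ii: "(\<forall>\<nu> cs Up. vanishing_viscosity c \<nu> cs \<and> (\<forall>k. upper_solution (\<nu> k) (cs k) (Up k)) \<longrightarrow>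
        (\<lambda>k. Linf_norm {-1<..<1} (\<lambda>x. Up k x - sqrt (2 * P c x))) \<longlonglongrightarrow> 0) \<and>
    (\<exists>C::real. \<forall>\<nu> cs Up. vanishing_viscosity c \<nu> cs \<and>
        (\<forall>k. upper_solution (\<nu> k) (cs k) (Up k)) \<longrightarrow>
        (\<forall>\<^sub>F k in sequentially.
          Linf_norm {-1<..<1} (\<lambda>x. defect (cs k) (Up k) x)
            \<le> ennreal (C * degenerate_rate (cs k) (\<nu> k))) \<and>
        (\<lambda>k. C * degenerate_rate (cs k) (\<nu> k)) \<in> o(\<lambda>_. 1))"
    if c2: "c$2 = 0"
  proof -
    obtain C where C1: "\<forall>\<nu> cs U. vanishing_viscosity c \<nu> cs \<and> (\<forall>k. upper_solution (\<nu> k) (cs k) (U k)) \<longrightarrow>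
      (\<exists>B. B \<longlonglongrightarrow> 0 \<and> (\<forall>\<^sub>F k in sequentially. \<forall>x. -1 < x \<longrightarrow> x < 1 \<longrightarrow> \<bar>U k x - sqrt (2 * P c x)\<bar> \<le> B k))"
      and C2: "\<forall>\<nu> cs U. vanishing_viscosity c \<nu> cs \<and> (\<forall>k. upper_solution (\<nu> k) (cs k) (U k)) \<longrightarrow>
      (\<forall>\<^sub>F k in sequentially. \<forall>x. -1 < x \<longrightarrow> x < 1 \<longrightarrow> \<bar>defect (cs k) (U k) x\<bar>
         \<le> C * degenerate_rate (cs k) (\<nu> k))"
      and C3: "\<forall>\<nu> cs. vanishing_viscosity c \<nu> cs \<longrightarrow>
      (\<lambda>k. C * degenerate_rate (cs k) (\<nu> k)) \<in> o(\<lambda>_. 1)"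
      by (rule degenerate_estimates[OF assms c2])
    show ?thesis
    proof (intro conjI allI impI exI[of _ C]; elim conjE)
      fix \<nu> cs Up assume vv: "vanishing_viscosity c \<nu> cs" and up: "\<forall>k. upper_solution (\<nu> k) (cs k) (Up k)"
      obtain B where "B \<longlonglongrightarrow> 0"
        "\<forall>\<^sub>F k in sequentially. \<forall>x. -1 < x \<longrightarrow> x < 1 \<longrightarrow> \<bar>Up k x - sqrt (2 * P c x)\<bar> \<le> B k"
        using C1[rule_format, of \<nu> cs Up] vv up by blast
      then show "(\<lambda>k. Linf_norm {-1<..<1} (\<lambda>x. Up k x - sqrt (2 * P c x))) \<longlonglongrightarrow> 0"
        using up by (intro upper_solutions_converge[of \<nu> cs Up]) auto
    next
      fix \<nu> cs Up assume vv: "vanishing_viscosity c \<nu> cs" and up: "\<forall>k. upper_solution (\<nu> k) (cs k) (Up k)"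
      have "\<forall>\<^sub>F k in sequentially. \<forall>x. -1 < x \<longrightarrow> x < 1 \<longrightarrow> \<bar>defect (cs k) (Up k) x\<bar>
         \<le> C * degenerate_rate (cs k) (\<nu> k)"
        using C2[rule_format, of \<nu> cs Up] vv up by blast
      then show "\<forall>\<^sub>F k in sequentially.
          Linf_norm {-1<..<1} (\<lambda>x. defect (cs k) (Up k) x)
            \<le> ennreal (C * degenerate_rate (cs k) (\<nu> k))"
      proof (rule eventually_mono)
        fix k assume *: "\<forall>x. -1 < x \<longrightarrow> x < 1 \<longrightarrow> \<bar>defect (cs k) (Up k) x\<bar>
           \<le> C * degenerate_rate (cs k) (\<nu> k)"
        have "continuous_on {-1..1} (Up k)" using up by (auto simp: upper_solution_def)
        from Linf_norm_le[OF continuous_error(3)[OF this] *[rule_format]]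
        show "Linf_norm {-1<..<1} (\<lambda>x. defect (cs k) (Up k) x)
            \<le> ennreal (C * degenerate_rate (cs k) (\<nu> k))" .
      qed
    next
      fix \<nu> cs Up assume "vanishing_viscosity c \<nu> cs"
      then show "(\<lambda>k. C * degenerate_rate (cs k) (\<nu> k)) \<in> o(\<lambda>_. 1)"
        using C3 by blast
    qed
  qed
  have part_iii: "(\<forall>\<nu> cs Um. vanishing_viscosity c \<nu> cs \<and> (\<forall>k. lower_solution (\<nu> k) (cs k) (Um k)) \<longrightarrow>
        (\<lambda>k. Linf_norm {-1<..<1} (\<lambda>x. Um k x + sqrt (2 * P c x))) \<longlonglongrightarrow> 0) \<and>
    (\<exists>C::real. \<forall>\<nu> cs Um. vanishing_viscosity c \<nu> cs \<and>
        (\<forall>k. lower_solution (\<nu> k) (cs k) (Um k)) \<longrightarrow>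
        (\<forall>\<^sub>F k in sequentially.
          Linf_norm {-1<..<1} (\<lambda>x. defect (cs k) (Um k) x)
            \<le> ennreal (C * (\<bar>cs k $ 1\<bar> + \<bar>2 * cs k $ 3 + cs k $ 2\<bar>\<^sup>2 + \<nu> k powr (2/3)))) \<and>
        (\<lambda>k. C * (\<bar>cs k $ 1\<bar> + \<bar>2 * cs k $ 3 + cs k $ 2\<bar>\<^sup>2 + \<nu> k powr (2/3))) \<in> o(\<lambda>_. 1))"
    if c1: "c$1 = 0"
  proof -
    have c1': "swap c $ 2 = 0" using c1 by simp
    obtain C where C1: "\<forall>\<nu> cs U. vanishing_viscosity (swap c) \<nu> cs \<and> (\<forall>k. upper_solution (\<nu> k) (cs k) (U k)) \<longrightarrow>
      (\<exists>B. B \<longlonglongrightarrow> 0 \<and> (\<forall>\<^sub>F k in sequentially. \<forall>x. -1 < x \<longrightarrow> x < 1 \<longrightarrow> \<bar>U k x - sqrt (2 * P (swap c) x)\<bar> \<le> B k))"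
      and C2: "\<forall>\<nu> cs U. vanishing_viscosity (swap c) \<nu> cs \<and> (\<forall>k. upper_solution (\<nu> k) (cs k) (U k)) \<longrightarrow>
      (\<forall>\<^sub>F k in sequentially. \<forall>x. -1 < x \<longrightarrow> x < 1 \<longrightarrow> \<bar>defect (cs k) (U k) x\<bar>
         \<le> C * degenerate_rate (cs k) (\<nu> k))"
      and C3: "\<forall>\<nu> cs. vanishing_viscosity (swap c) \<nu> cs \<longrightarrow>
      (\<lambda>k. C * degenerate_rate (cs k) (\<nu> k)) \<in> o(\<lambda>_. 1)"
      by (rule degenerate_estimates[OF swap0 swap3 c1'])
    show ?thesis
    proof (intro conjI allI impI exI[of _ C]; elim conjE)
      fix \<nu> cs Um assume vv: "vanishing_viscosity c \<nu> cs" and lo: "\<forall>k. lower_solution (\<nu> k) (cs k) (Um k)"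
      have up: "\<forall>k. upper_solution (\<nu> k) (swap (cs k)) (\<lambda>x. - Um k (- x))"
        using lo by (auto intro: lower_solution_reflect)
      obtain B where "B \<longlonglongrightarrow> 0"
        "\<forall>\<^sub>F k in sequentially. \<forall>x. -1 < x \<longrightarrow> x < 1 \<longrightarrow> \<bar>- Um k (- x) - sqrt (2 * P (swap c) x)\<bar> \<le> B k"
        using C1[rule_format, of \<nu> "\<lambda>k. swap (cs k)" "\<lambda>k x. - Um k (- x)"] vanishing_viscosity_swap[OF vv] up by blast
      then show "(\<lambda>k. Linf_norm {-1<..<1} (\<lambda>x. Um k x + sqrt (2 * P c x))) \<longlonglongrightarrow> 0"
        using lo by (intro lower_solutions_converge[of \<nu> cs Um]) auto
    next
      fix \<nu> cs Um assume vv: "vanishing_viscosity c \<nu> cs" and lo: "\<forall>k. lower_solution (\<nu> k) (cs k) (Um k)"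
      have up: "\<forall>k. upper_solution (\<nu> k) (swap (cs k)) (\<lambda>x. - Um k (- x))"
        using lo by (auto intro: lower_solution_reflect)
      have "\<forall>\<^sub>F k in sequentially. \<forall>x. -1 < x \<longrightarrow> x < 1 \<longrightarrow> \<bar>(1/2) * (- Um k (- x))\<^sup>2 - P (swap (cs k)) x\<bar>
         \<le> C * degenerate_rate (swap (cs k)) (\<nu> k)"
        using C2[rule_format, of \<nu> "\<lambda>k. swap (cs k)" "\<lambda>k x. - Um k (- x)"] vanishing_viscosity_swap[OF vv] up by blast
      then show "\<forall>\<^sub>F k in sequentially.
          Linf_norm {-1<..<1} (\<lambda>x. defect (cs k) (Um k) x)
            \<le> ennreal (C * (\<bar>cs k $ 1\<bar> + \<bar>2 * cs k $ 3 + cs k $ 2\<bar>\<^sup>2 + \<nu> k powr (2/3)))"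
      proof (rule eventually_mono)
        fix k assume *: "\<forall>x. -1 < x \<longrightarrow> x < 1 \<longrightarrow> \<bar>(1/2) * (- Um k (- x))\<^sup>2 - P (swap (cs k)) x\<bar>
           \<le> C * degenerate_rate (swap (cs k)) (\<nu> k)"
        have "continuous_on {-1..1} (Um k)" using lo by (auto simp: lower_solution_def)
        then show "Linf_norm {-1<..<1} (\<lambda>x. defect (cs k) (Um k) x)
            \<le> ennreal (C * (\<bar>cs k $ 1\<bar> + \<bar>2 * cs k $ 3 + cs k $ 2\<bar>\<^sup>2 + \<nu> k powr (2/3)))"
        proof (rule Linf_norm_le[OF continuous_error(3)])
          show "\<bar>defect (cs k) (Um k) x\<bar>
             \<le> C * (\<bar>cs k $ 1\<bar> + \<bar>2 * cs k $ 3 + cs k $ 2\<bar>\<^sup>2 + \<nu> k powr (2/3))" if "-1 < x" "x < 1" for x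
            using *[rule_format, of "- x"] that by (simp add: P_swap)
        qed
      qed
    next
      fix \<nu> cs Um assume vv: "vanishing_viscosity c \<nu> cs"
      have "(\<lambda>k. C * degenerate_rate (swap (cs k)) (\<nu> k)) \<in> o(\<lambda>_. 1)"
        using C3[rule_format, OF vanishing_viscosity_swap[OF vv]] .
      then show "(\<lambda>k. C * (\<bar>cs k $ 1\<bar> + \<bar>2 * cs k $ 3 + cs k $ 2\<bar>\<^sup>2 + \<nu> k powr (2/3))) \<in> o(\<lambda>_. 1)"
        by simp
    qed
  qed
  have x_bar: "(\<exists>\<nu> cs. vanishing_viscosity c \<nu> cs \<and> (\<forall>k. cs k \<in> J 0)) \<longrightarrow> x_bar c \<in> {-1..1}"
    using vanishing_viscosity_limit_nonneg x_bar_range[of c] by (metis atLeastAtMost_iff)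
  show ?thesis
    apply (intro conjI)
         apply (intro allI impI, elim conjE, rule limit_i; assumption)
        apply (intro allI impI, elim conjE, rule nondegenerate_norm_estimate; assumption)
       apply (rule x_bar)
      apply (intro allI impI, rule nondegenerate_Cm_estimate[OF assms], assumption)
     apply (rule impI, rule part_ii, assumption)
    apply (rule impI, rule part_iii, assumption)
    done
qed

end
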